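(* The KZ associator $A$ satisfies \[ \mathcal B(y_1\otimes1,\,1\otimes y_1)\,\Delta_*(A_Y)=A_Y\otimes A_Y \] in $W\widehat\otimes W$. Together with the group-like property of $A$ for the coproduct on $\mathbb C\langle\!\langle e_0,e_1\rangle\!\rangle$ in which $e_0,e_1$ are primitive, this is the beta-factor form of Racinet's regularized double shuffle relations.
   Context: **Associator.** For $dG=\left(e_0\frac{dz}{z}+e_1\frac{dz}{z-1}\right)G$ with values in $\mathbb C\langle\!\langle e_0,e_1\rangle\!\rangle$ on the interval $(0,1)$, let $G_0,G_1$ be the solutions with $G_0(z)z^{-e_0}\to1$ at $0$ and $G_1(z)(1-z)^{-e_1}\to1$ at $1$, and put $A=A(e_0,e_1)=G_1^{-1}G_0\in\mathbb C\langle\!\langle e_0,e_1\rangle\!\rangle$. For a series $f=1+f_0e_0+f_1e_1$ put $f_Y=1+f_1e_1$. **Transport algebra and harmonic coproduct.** $W=\mathbb C\cdot1\oplus\mathbb C\langle\!\langle e_0,e_1\rangle\!\rangle e_1$ with concatenation product, completed with respect to total degree. Put $y_0=1$ and $y_n=-e_0^{n-1}e_1$ for $n\ge1$; the $y_n$ ($n\ge1$) freely generate $W$ as a complete algebra, and $\Delta_*:W\to W\widehat\otimes W$ is the continuous algebra homomorphism with $\Delta_*(y_n)=\sum_{i=0}^ny_i\otimes y_{n-i}$. **Beta factor.** For commuting variables $a,b$, \[ \mathcal B(a,b)=\frac{\Gamma(1+a)\Gamma(1+b)}{\Gamma(1+a+b)} \] is the power series obtained from the Taylor series of $\Gamma$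 at $1$; equivalently $\mathcal B(a,b)=\exp\left(\sum_{n\ge2}\frac{(-1)^n\zeta(n)}{n}(a^n+b^n-(a+b)^n)\right)$. **Terminology.** Racinet's regularized double shuffle relations for $A$ state that $A$ is group-like for the coproduct with $e_0,e_1$ primitive and that the corrected series $\exp\left(\sum_{n\ge2}\frac{(-1)^{n-1}\zeta(n)}{n}y_1^n\right)A_Y$ is group-like for $\Delta_*$. *)

theory Defs
  imports "HOL-Complex_Analysis.Complex_Analysis"
begin

section \<open>Completed graded monoid algebras\<close>

text \<open>
  Words over an alphabet and pairs of words are both graded monoids in which every element has only
  finitely many factorizations. The completed algebra of the former is the algebra of
  noncommutative power series; that of the latter is the completed tensor square.
  The class has operations of its own, so that no arithmetic type class is instantiated for lists.
\<close>

class word_monoid =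
  fixes wcat :: "'a \<Rightarrow> 'a \<Rightarrow> 'a" and wone :: 'a and wdeg :: "'a \<Rightarrow> nat"
  assumes wcat_assoc: "wcat (wcat a b) c = wcat a (wcat b c)"
    and wcat_wone_left [simp]: "wcat wone a = a"
    and wcat_wone_right [simp]: "wcat a wone = a"
    and wdeg_wcat [simp]: "wdeg (wcat a b) = wdeg a + wdeg b"
    and wdeg_eq_0_iff [simp]: "wdeg a = 0 \<longleftrightarrow> a = wone"
    and finite_factorizations [simp]: "finite {(a, b). wcat a b = m}"

lemma finite_factorizations' [simp]: "finite {p. wcat (fst p) (snd p) = m}"
  using finite_factorizations[of m] by (simp add: case_prod_unfold)

instantiation list :: (type) word_monoid
begin
definition "wcat (xs :: 'a list) ys = xs @ ys"
definition "wone = ([] :: 'a list)"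
definition "wdeg (xs :: 'a list) = length xs"
instance
proof
  fix m :: "'a list"
  have "{(a, b). wcat a b = m} \<subseteq> (\<lambda>i. (take i m, drop i m)) ` {..length m}"
  proof (rule subsetI)
    fix p
    assume "p \<in> {(a, b). wcat a b = m}"
    then have "p = (take (length (fst p)) m, drop (length (fst p)) m)" "length (fst p) \<le> length m"
      by (auto simp: wcat_list_def)
    then show "p \<in> (\<lambda>i. (take i m, drop i m)) ` {..length m}"
      by blast
  qed
  then show "finite {(a, b). wcat a b = m}"
    by (rule finite_subset) simp
qed (auto simp: wcat_list_def wone_list_def wdeg_list_def)
end

instantiation prod :: (word_monoid, word_monoid) word_monoid
begin
definition "wcat (p :: 'a \<times> 'b) q = (wcat (fst p) (fst q), wcat (snd p) (snd q))"
definition "wone = (wone :: 'a, wone :: 'b)"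
definition "wdeg (p :: 'a \<times> 'b) = wdeg (fst p) + wdeg (snd p)"
instance
proof
  fix m :: "'a \<times> 'b"
  let ?f = "\<lambda>((a, b), (c, d)). ((a, c), (b, d))"
  have "{(p, q). wcat p q = m} \<subseteq>
          ?f ` ({(a, b). wcat a b = fst m} \<times> {(c, d). wcat c d = snd m})"
    by (force simp: wcat_prod_def image_iff)
  then show "finite {(p, q). wcat p q = m}"
    by (rule finite_subset) simp
qed (auto simp: wcat_prod_def wone_prod_def wdeg_prod_def wcat_assoc prod_eq_iff)
end

typedef 'm series = "UNIV :: ('m \<Rightarrow> complex) set"
  morphisms scoeff Series by simp

setup_lifting type_definition_series

lemma scoeff_Series [simp]: "scoeff (Series f) = f"
  by (simp add: Series_inverse)

lemma series_eqI: "(\<And>m. scoeff f m = scoeff g m) \<Longrightarrow> f = g"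
  by (metis scoeff_inject ext)

instantiation series :: (word_monoid) ring_1
begin
lift_definition zero_series :: "'a series" is "\<lambda>_. 0" .
lift_definition one_series :: "'a series" is "\<lambda>m. if m = wone then 1 else 0" .
lift_definition plus_series :: "'a series \<Rightarrow> 'a series \<Rightarrow> 'a series" is "\<lambda>f g m. f m + g m" .
lift_definition minus_series :: "'a series \<Rightarrow> 'a series \<Rightarrow> 'a series" is "\<lambda>f g m. f m - g m" .
lift_definition uminus_series :: "'a series \<Rightarrow> 'a series" is "\<lambda>f m. - f m" .
lift_definition times_series :: "'a series \<Rightarrow> 'a series \<Rightarrow> 'a series"
  is "\<lambda>f g m. \<Sum>(a, b) | wcat a b = m. f a * g b" .
instance
proof
  fix f g h :: "'a series"
  show "f * g * h = f * (g * h)"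
  proof (rule series_eqI)
    fix m
    let ?D = "\<lambda>m. {p :: 'a \<times> 'a. wcat (fst p) (snd p) = m}"
    have "scoeff (f * g * h) m =
        (\<Sum>p\<in>?D m. \<Sum>q\<in>?D (fst p). scoeff f (fst q) * scoeff g (snd q) * scoeff h (snd p))"
      by (simp add: times_series.rep_eq case_prod_unfold sum_distrib_right)
    also have "\<dots> = (\<Sum>(p, q)\<in>(SIGMA p:?D m. ?D (fst p)).
        scoeff f (fst q) * scoeff g (snd q) * scoeff h (snd p))"
      by (rule sum.Sigma) auto
    also have "\<dots> = (\<Sum>(p, q)\<in>(SIGMA p:?D m. ?D (snd p)).
        scoeff f (fst p) * (scoeff g (fst q) * scoeff h (snd q)))"
      by (rule sum.reindex_bij_witness
          [of _ "\<lambda>((a, x), (b, c)). ((wcat a b, c), (a, b))"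
                "\<lambda>((x, c), (a, b)). ((a, wcat b c), (b, c))"])
         (auto simp: wcat_assoc)
    also have "\<dots> = (\<Sum>p\<in>?D m. \<Sum>q\<in>?D (snd p).
        scoeff f (fst p) * (scoeff g (fst q) * scoeff h (snd q)))"
      by (rule sum.Sigma [symmetric]) auto
    also have "\<dots> = scoeff (f * (g * h)) m"
      by (simp add: times_series.rep_eq case_prod_unfold sum_distrib_left)
    finally show "scoeff (f * g * h) m = scoeff (f * (g * h)) m" .
  qed
  show "1 * f = f"
  proof (rule series_eqI)
    fix m
    have "scoeff (1 * f) m = (\<Sum>(a, b)\<in>{(wone, m)}. scoeff 1 a * scoeff f b)"
      unfolding times_series.rep_eq
      by (rule sum.mono_neutral_right) (auto simp: one_series.rep_eq split: if_splits)
    then show "scoeff (1 * f) m = scoeff f m"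
      by (simp add: one_series.rep_eq)
  qed
  show "f * 1 = f"
  proof (rule series_eqI)
    fix m
    have "scoeff (f * 1) m = (\<Sum>(a, b)\<in>{(m, wone)}. scoeff f a * scoeff 1 b)"
      unfolding times_series.rep_eq
      by (rule sum.mono_neutral_right) (auto simp: one_series.rep_eq split: if_splits)
    then show "scoeff (f * 1) m = scoeff f m"
      by (simp add: one_series.rep_eq)
  qed
  show "(f + g) * h = f * h + g * h"
    by (rule series_eqI)
       (simp add: times_series.rep_eq plus_series.rep_eq case_prod_unfold sum.distrib algebra_simps)
  show "f * (g + h) = f * g + f * h"
    by (rule series_eqI)
       (simp add: times_series.rep_eq plus_series.rep_eq case_prod_unfold sum.distrib algebra_simps)
  have "scoeff (0 :: 'a series) wone \<noteq> scoeff 1 wone"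
    by (simp add: zero_series.rep_eq one_series.rep_eq)
  then show "(0 :: 'a series) \<noteq> 1"
    by metis
qed (rule series_eqI;
     simp add: zero_series.rep_eq plus_series.rep_eq minus_series.rep_eq uminus_series.rep_eq)+
end

lift_definition series_scale :: "complex \<Rightarrow> 'm series \<Rightarrow> 'm series" is "\<lambda>c f m. c * f m" .

lift_definition word_monom :: "'m \<Rightarrow> 'm series" is "\<lambda>u m. if m = u then 1 else 0" .

lift_definition tensor :: "'m series \<Rightarrow> 'n series \<Rightarrow> ('m \<times> 'n) series"
  is "\<lambda>f g (u, v). f u * g v" .

text \<open>
  Series carry the topology of coefficientwise convergence.
\<close>

definition series_tendsto :: "('a \<Rightarrow> 'm series) \<Rightarrow> 'm series \<Rightarrow> 'a filter \<Rightarrow> bool" where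
  "series_tendsto F L A \<longleftrightarrow> (\<forall>m. ((\<lambda>t. scoeff (F t) m) \<longlongrightarrow> scoeff L m) A)"

definition series_inverse :: "'m::word_monoid series \<Rightarrow> 'm series" where
  "series_inverse f = (THE g. f * g = 1 \<and> g * f = 1)"

text \<open>
  Meaningful for \<open>x\<close> without constant term: then the sum over \<open>n\<close> has, for each
  coefficient \<open>m\<close>, no nonzero term with \<open>n > wdeg m\<close>.
\<close>

definition fps_subst :: "complex fps \<Rightarrow> 'm::word_monoid series \<Rightarrow> 'm series" where
  "fps_subst F x = Series (\<lambda>m. \<Sum>n. fps_nth F n * scoeff (x ^ n) m)"

definition series_exp :: "'m::word_monoid series \<Rightarrow> 'm series" where
  "series_exp = fps_subst (fps_exp 1)"

text \<open>
  The continuous algebra homomorphism sending each letter \<open>x\<close> to \<open>\<phi> x\<close>. It is applied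
  only where, for each coefficient \<open>m\<close>, the sum over words has finitely many nonzero terms.
\<close>

definition alg_ext :: "('x \<Rightarrow> 'm::word_monoid series) \<Rightarrow> 'x list series \<Rightarrow> 'm series" where
  "alg_ext \<phi> f = Series (\<lambda>m. \<Sum>\<^sub>\<infinity>w. scoeff f w * scoeff (prod_list (map \<phi> w)) m)"

section \<open>Series in two letters and the associator\<close>

datatype letter = E0 | E1

type_synonym nc_series = "letter list series"

definition e0 :: nc_series where "e0 = word_monom [E0]"

definition e1 :: nc_series where "e1 = word_monom [E1]"

text \<open>
  Differentiation is coefficientwise; \<open>real_pow z f\<close> is \<open>z\<close> to the power \<open>f\<close>.
\<close>

definition KZ_solution :: "(real \<Rightarrow> nc_series) \<Rightarrow> bool" where
  "KZ_solution G \<longleftrightarrow> (\<forall>z\<in>{0<..<1}. \<forall>w.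
     ((\<lambda>t. scoeff (G t) w) has_vector_derivative
        scoeff ((series_scale (of_real (1 / z)) e0 + series_scale (of_real (1 / (z - 1))) e1) * G z) w) (at z))"

definition real_pow :: "real \<Rightarrow> nc_series \<Rightarrow> nc_series" where
  "real_pow z f = series_exp (series_scale (of_real (ln z)) f)"

definition KZ_normalized_0 :: "(real \<Rightarrow> nc_series) \<Rightarrow> bool" where
  "KZ_normalized_0 G \<longleftrightarrow> series_tendsto (\<lambda>z. G z * real_pow z (- e0)) 1 (at_right 0)"

definition KZ_normalized_1 :: "(real \<Rightarrow> nc_series) \<Rightarrow> bool" where
  "KZ_normalized_1 G \<longleftrightarrow> series_tendsto (\<lambda>z. G z * real_pow (1 - z) (- e1)) 1 (at_left 1)"

text \<open>
  For \<open>f = 1 + f\<^sub>0 e\<^sub>0 + f\<^sub>1 e\<^sub>1\<close>, the series \<open>f\<^sub>1\<close> is \<open>right_quot E1 f\<close>.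
\<close>

lift_definition right_quot :: "letter \<Rightarrow> nc_series \<Rightarrow> nc_series" is "\<lambda>x f w. f (w @ [x])" .

definition Y_part :: "nc_series \<Rightarrow> nc_series" where
  "Y_part f = 1 + right_quot E1 f * e1"

section \<open>The two coproducts\<close>

definition prim_coproduct :: "nc_series \<Rightarrow> (letter list \<times> letter list) series" where
  "prim_coproduct = alg_ext (\<lambda>x. tensor (word_monom [x]) 1 + tensor 1 (word_monom [x]))"

definition W_words :: "letter list set" where
  "W_words = {w. w = [] \<or> last w = E1}"

definition W_alg :: "nc_series set" where
  "W_alg = {f. \<forall>w. w \<notin> W_words \<longrightarrow> scoeff f w = 0}"

definition W_tensor_W :: "(letter list \<times> letter list) series set" where
  "W_tensor_W = {f. \<forall>p. p \<notin> W_words \<times> W_words \<longrightarrow> scoeff f p = 0}"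

definition Y_gen :: "nat \<Rightarrow> nc_series" where
  "Y_gen n = (if n = 0 then 1 else - (e0 ^ (n - 1) * e1))"

text \<open>
  An element of \<open>W_alg\<close> is a series in the free generators \<open>Y_gen n\<close>, \<open>n \<ge> 1\<close>; \<open>Y_expansion\<close> gives
  its coefficients, indexed by lists of positive integers (the letter 0 never occurs). The sign
  comes from the sign in \<open>Y_gen n\<close>.
\<close>

definition Y_word :: "nat list \<Rightarrow> letter list" where
  "Y_word ns = concat (map (\<lambda>n. replicate (n - 1) E0 @ [E1]) ns)"

definition Y_expansion :: "nc_series \<Rightarrow> nat list series" where
  "Y_expansion f =
     Series (\<lambda>ns. if 0 \<in> set ns then 0 else (- 1) ^ length ns * scoeff f (Y_word ns))"

definition harm_coproduct :: "nc_series \<Rightarrow> (letter list \<times> letter list) series" where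
  "harm_coproduct f = alg_ext (\<lambda>n. \<Sum>i\<le>n. tensor (Y_gen i) (Y_gen (n - i))) (Y_expansion f)"

definition group_like :: "nc_series \<Rightarrow> bool" where
  "group_like f \<longleftrightarrow> scoeff f [] = 1 \<and> prim_coproduct f = tensor f f"

definition harm_group_like :: "nc_series \<Rightarrow> bool" where
  "harm_group_like f \<longleftrightarrow> f \<in> W_alg \<and> scoeff f [] = 1 \<and> harm_coproduct f = tensor f f"

section \<open>The beta factor and the regularized double shuffle relations\<close>

text \<open>
  \<open>fps_expansion Gamma 1\<close> is the power series of \<open>\<Gamma>(1 + t)\<close>. The arguments are meant to be
  commuting series without constant term.
\<close>

definition beta_factor :: "'m::word_monoid series \<Rightarrow> 'm series \<Rightarrow> 'm series" where
  "beta_factor a b = fps_subst (fps_expansion Gamma 1) a * fps_subst (fps_expansion Gamma 1) b *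
     fps_subst (inverse (fps_expansion Gamma 1)) (a + b)"

definition beta_relation :: "nc_series \<Rightarrow> bool" where
  "beta_relation f \<longleftrightarrow>
     beta_factor (tensor (Y_gen 1) 1) (tensor 1 (Y_gen 1)) * harm_coproduct (Y_part f) =
       tensor (Y_part f) (Y_part f)"

definition zeta :: "nat \<Rightarrow> complex" where
  "zeta n = (\<Sum>k. 1 / of_nat (Suc k) ^ n)"

definition corrected_Y_part :: "nc_series \<Rightarrow> nc_series" where
  "corrected_Y_part f =
     series_exp (fps_subst (Abs_fps (\<lambda>n. if n \<ge> 2 then (- 1) ^ (n - 1) * zeta n / of_nat n else 0))
       (Y_gen 1)) * Y_part f"

definition regularized_double_shuffle :: "nc_series \<Rightarrow> bool" where
  "regularized_double_shuffle f \<longleftrightarrow> group_like f \<and> harm_group_like (corrected_Y_part f)"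

section \<open>Characteristic properties of the coproducts\<close>

text \<open>
  Both coproducts are linear and multiplicative (the harmonic one on \<open>W_alg\<close>) with the expected
  values on generators, and they are continuous: a coefficient of degree \<open>d\<close> of the image depends
  only on the coefficients of degree \<open>d\<close> of the argument (the lemmas ending in \<open>_local\<close>).
\<close>

lemma scoeff_simps [simp]:
  "scoeff 0 m = 0" "scoeff 1 m = (if m = wone then 1 else 0)"
  "scoeff (f + g) m = scoeff f m + scoeff g m" "scoeff (- f) m = - scoeff f m"
  "scoeff (f - g) m = scoeff f m - scoeff g m"
  "scoeff (series_scale c f) m = c * scoeff f m"
  "scoeff (word_monom u) m = (if m = u then 1 else 0)"
  by (simp_all add: zero_series.rep_eq one_series.rep_eq plus_series.rep_eq uminus_series.rep_eq
      minus_series.rep_eq series_scale.rep_eq word_monom.rep_eq)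

lemma scoeff_tensor [simp]: "scoeff (tensor f g) p = scoeff f (fst p) * scoeff g (snd p)"
  by (simp add: tensor.rep_eq case_prod_unfold)

lemma scoeff_sum [simp]: "scoeff (sum f A) m = (\<Sum>i\<in>A. scoeff (f i) m)"
  by (induction A rule: infinite_finite_induct) simp_all

lemma scoeff_mult: "scoeff (f * g) m = (\<Sum>(a, b) | wcat a b = m. scoeff f a * scoeff g b)"
  by (simp add: times_series.rep_eq)

lemma mult_nonzeroE:
  assumes "scoeff (f * g) m \<noteq> 0"
  obtains a b where "wcat a b = m" "scoeff f a \<noteq> 0" "scoeff g b \<noteq> 0"
proof -
  have "\<exists>p\<in>{(a, b). wcat a b = m}. (case p of (a, b) \<Rightarrow> scoeff f a * scoeff g b) \<noteq> 0"
    using assms unfolding scoeff_mult by (meson sum.neutral)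
  with that show thesis by auto
qed

context
  fixes \<phi> :: "'x \<Rightarrow> 'm::word_monoid series" and wt :: "'x \<Rightarrow> nat" and X :: "'x set"
  assumes homog: "\<And>x m. scoeff (\<phi> x) m \<noteq> 0 \<Longrightarrow> wdeg m = wt x"
    and wt_pos: "\<And>x. x \<in> X \<Longrightarrow> wt x \<ge> 1"
    and fin_wt: "\<And>d. finite {x \<in> X. wt x \<le> d}"
begin

lemma prod_homog: "scoeff (prod_list (map \<phi> w)) m \<noteq> 0 \<Longrightarrow> wdeg m = sum_list (map wt w)"
proof (induction w arbitrary: m)
  case Nil
  then show ?case by (auto split: if_splits)
next
  case (Cons x w)
  from Cons.prems obtain a b where "wcat a b = m" "scoeff (\<phi> x) a \<noteq> 0"
    "scoeff (prod_list (map \<phi> w)) b \<noteq> 0"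
    by (auto elim: mult_nonzeroE)
  with Cons.IH homog show ?case by fastforce
qed

lemma length_le_wt: "w \<in> lists X \<Longrightarrow> length w \<le> sum_list (map wt w)"
  by (induction rule: lists.induct) (auto dest: wt_pos)

lemma finite_wt_lists: "finite {w \<in> lists X. sum_list (map wt w) \<le> d}"
proof (rule finite_subset)
  show "{w \<in> lists X. sum_list (map wt w) \<le> d} \<subseteq>
      {w. set w \<subseteq> {x \<in> X. wt x \<le> d} \<and> length w \<le> d}"
  proof (intro subsetI CollectI conjI)
    fix w x assume w: "w \<in> {w \<in> lists X. sum_list (map wt w) \<le> d}" and "x \<in> set w"
    then have "wt x \<le> sum_list (map wt w)" by (intro member_le_sum_list) auto
    with w \<open>x \<in> set w\<close> show "x \<in> X" "wt x \<le> d" by auto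
  next
    fix w assume "w \<in> {w \<in> lists X. sum_list (map wt w) \<le> d}"
    with length_le_wt[of w] show "length w \<le> d" by auto
  qed
  show "finite {w. set w \<subseteq> {x \<in> X. wt x \<le> d} \<and> length w \<le> d}"
    by (rule finite_lists_length_le[OF fin_wt])
qed

lemma scoeff_alg_ext:
  assumes "\<And>w. w \<notin> lists X \<Longrightarrow> scoeff f w = 0"
    and "finite S" "{w \<in> lists X. sum_list (map wt w) = wdeg m} \<subseteq> S"
  shows "scoeff (alg_ext \<phi> f) m = (\<Sum>w\<in>S. scoeff f w * scoeff (prod_list (map \<phi> w)) m)"
proof -
  have "scoeff (alg_ext \<phi> f) m =
      (\<Sum>\<^sub>\<infinity>w\<in>S. scoeff f w * scoeff (prod_list (map \<phi> w)) m)"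
    unfolding alg_ext_def scoeff_Series
  proof (rule infsum_cong_neutral)
    fix w assume "w \<in> UNIV - S"
    then have "w \<notin> lists X \<or> sum_list (map wt w) \<noteq> wdeg m" using assms(3) by auto
    then show "scoeff f w * scoeff (prod_list (map \<phi> w)) m = 0"
      using assms(1)[of w] prod_homog[of w m] by auto
  qed auto
  with \<open>finite S\<close> show ?thesis by simp
qed

lemma alg_ext_mult:
  assumes f: "\<And>w. w \<notin> lists X \<Longrightarrow> scoeff f w = 0" and g: "\<And>w. w \<notin> lists X \<Longrightarrow> scoeff g w = 0"
  shows "alg_ext \<phi> (f * g) = alg_ext \<phi> f * alg_ext \<phi> g"
proof (rule series_eqI)
  fix m :: 'm
  let ?p = "\<lambda>w. prod_list (map \<phi> w)"
  define S where "S = {w \<in> lists X. sum_list (map wt w) \<le> wdeg m}"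
  have fS: "finite S" unfolding S_def by (rule finite_wt_lists)
  have fg: "scoeff (f * g) w = 0" if "w \<notin> lists X" for w
  proof (rule ccontr)
    assume "scoeff (f * g) w \<noteq> 0"
    then obtain a b where "wcat a b = w" "scoeff f a \<noteq> 0" "scoeff g b \<noteq> 0"
      by (rule mult_nonzeroE)
    moreover from this f g have "a \<in> lists X" "b \<in> lists X" by blast+
    ultimately show False using that by (auto simp: wcat_list_def)
  qed
  have "scoeff (alg_ext \<phi> (f * g)) m = (\<Sum>w\<in>S. scoeff (f * g) w * scoeff (?p w) m)"
    by (rule scoeff_alg_ext[OF fg fS]) (auto simp: S_def)
  also have "\<dots> = (\<Sum>w\<in>S. \<Sum>q | wcat (fst q) (snd q) = w.
      scoeff f (fst q) * scoeff g (snd q) * scoeff (?p (fst q) * ?p (snd q)) m)"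
    by (auto simp: scoeff_mult[of f] case_prod_unfold sum_distrib_right wcat_list_def intro!: sum.cong)
  also have "\<dots> = (\<Sum>(w, q)\<in>(SIGMA w:S. {q. wcat (fst q) (snd q) = w}).
      scoeff f (fst q) * scoeff g (snd q) * scoeff (?p (fst q) * ?p (snd q)) m)"
    by (rule sum.Sigma) (use fS in auto)
  also have "\<dots> = (\<Sum>q\<in>{q. fst q @ snd q \<in> S}.
      scoeff f (fst q) * scoeff g (snd q) * scoeff (?p (fst q) * ?p (snd q)) m)"
    by (rule sum.reindex_bij_witness[of _ "\<lambda>q. (fst q @ snd q, q)" snd]) (auto simp: wcat_list_def)
  also have "\<dots> = (\<Sum>q\<in>S \<times> S.
      scoeff f (fst q) * scoeff g (snd q) * scoeff (?p (fst q) * ?p (snd q)) m)"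
  proof (rule sum.mono_neutral_left)
    show "\<forall>q\<in>S \<times> S - {q. fst q @ snd q \<in> S}.
        scoeff f (fst q) * scoeff g (snd q) * scoeff (?p (fst q) * ?p (snd q)) m = 0"
    proof
      fix q assume q: "q \<in> S \<times> S - {q. fst q @ snd q \<in> S}"
      then have "sum_list (map wt (fst q @ snd q)) \<noteq> wdeg m"
        by (auto simp: S_def)
      then have "scoeff (?p (fst q @ snd q)) m = 0"
        using prod_homog by metis
      then show "scoeff f (fst q) * scoeff g (snd q) * scoeff (?p (fst q) * ?p (snd q)) m = 0"
        by simp
    qed
  qed (use fS in \<open>auto simp: S_def\<close>)
  also have "\<dots> = (\<Sum>u\<in>S. \<Sum>v\<in>S. scoeff f u * scoeff g v * scoeff (?p u * ?p v) m)"
    by (simp add: sum.cartesian_product case_prod_unfold)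
  also have "\<dots> = (\<Sum>u\<in>S. \<Sum>v\<in>S. \<Sum>(a, b) | wcat a b = m.
      (scoeff f u * scoeff (?p u) a) * (scoeff g v * scoeff (?p v) b))"
    by (simp add: scoeff_mult case_prod_unfold sum_distrib_left mult_ac)
  also have "\<dots> = (\<Sum>(a, b) | wcat a b = m. \<Sum>u\<in>S. \<Sum>v\<in>S.
      (scoeff f u * scoeff (?p u) a) * (scoeff g v * scoeff (?p v) b))"
    unfolding case_prod_unfold by (subst sum.swap, subst (2) sum.swap) (rule refl)
  also have "\<dots> = (\<Sum>(a, b) | wcat a b = m.
      (\<Sum>u\<in>S. scoeff f u * scoeff (?p u) a) * (\<Sum>v\<in>S. scoeff g v * scoeff (?p v) b))"
    by (simp add: sum_product)
  also have "\<dots> = (\<Sum>(a, b) | wcat a b = m. scoeff (alg_ext \<phi> f) a * scoeff (alg_ext \<phi> g) b)"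
  proof (rule sum.cong[OF refl], clarify)
    fix a b assume "m = wcat a b"
    then show "(\<Sum>u\<in>S. scoeff f u * scoeff (?p u) a) * (\<Sum>v\<in>S. scoeff g v * scoeff (?p v) b) =
        scoeff (alg_ext \<phi> f) a * scoeff (alg_ext \<phi> g) b"
      by (subst (1 2) scoeff_alg_ext[where S = S]) (use f g fS in \<open>auto simp: S_def\<close>)
  qed
  also have "\<dots> = scoeff (alg_ext \<phi> f * alg_ext \<phi> g) m"
    by (simp add: scoeff_mult)
  finally show "scoeff (alg_ext \<phi> (f * g)) m = scoeff (alg_ext \<phi> f * alg_ext \<phi> g) m" .
qed

lemma alg_ext_linear:
  assumes f: "\<And>w. w \<notin> lists X \<Longrightarrow> scoeff f w = 0" and g: "\<And>w. w \<notin> lists X \<Longrightarrow> scoeff g w = 0"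
  shows "alg_ext \<phi> (series_scale c f + g) = series_scale c (alg_ext \<phi> f) + alg_ext \<phi> g"
proof (rule series_eqI)
  fix m :: 'm
  define S where "S = {w \<in> lists X. sum_list (map wt w) \<le> wdeg m}"
  have fS: "finite S" unfolding S_def by (rule finite_wt_lists)
  have fg: "scoeff (series_scale c f + g) w = 0" if "w \<notin> lists X" for w
    using f[OF that] g[OF that] by simp
  have sub: "{w \<in> lists X. sum_list (map wt w) = wdeg m} \<subseteq> S" by (auto simp: S_def)
  show "scoeff (alg_ext \<phi> (series_scale c f + g)) m =
      scoeff (series_scale c (alg_ext \<phi> f) + alg_ext \<phi> g) m"
    by (subst scoeff_alg_ext[OF fg fS sub])
       (simp_all add: scoeff_alg_ext[OF f fS sub] scoeff_alg_ext[OF g fS sub] sum.distrib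
         sum_distrib_left algebra_simps)
qed

lemma alg_ext_local:
  assumes f: "\<And>w. w \<notin> lists X \<Longrightarrow> scoeff f w = 0" and g: "\<And>w. w \<notin> lists X \<Longrightarrow> scoeff g w = 0"
    and eq: "\<And>w. sum_list (map wt w) = wdeg m \<Longrightarrow> scoeff f w = scoeff g w"
  shows "scoeff (alg_ext \<phi> f) m = scoeff (alg_ext \<phi> g) m"
proof -
  define S where "S = {w \<in> lists X. sum_list (map wt w) = wdeg m}"
  have fS: "finite S" unfolding S_def
    by (rule finite_subset[OF _ finite_wt_lists[of "wdeg m"]]) auto
  show ?thesis
    by (subst (1 2) scoeff_alg_ext[where S = S]) (use f g fS eq in \<open>auto simp: S_def intro!: sum.cong\<close>)
qed

end

lemma alg_ext_monom: "alg_ext \<phi> (word_monom u) = prod_list (map \<phi> u)"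
proof (rule series_eqI)
  fix m
  have "scoeff (alg_ext \<phi> (word_monom u)) m =
      (\<Sum>\<^sub>\<infinity>w\<in>{u}. scoeff (word_monom u) w * scoeff (prod_list (map \<phi> w)) m)"
    unfolding alg_ext_def scoeff_Series by (rule infsum_cong_neutral) auto
  then show "scoeff (alg_ext \<phi> (word_monom u)) m = scoeff (prod_list (map \<phi> u)) m" by simp
qed

lemma prim_coproduct_letter:
  "prim_coproduct (word_monom [x]) = tensor (word_monom [x]) 1 + tensor 1 (word_monom [x])"
  by (simp add: prim_coproduct_def alg_ext_monom)

lemma prim_homog:
  "scoeff (tensor (word_monom [x]) 1 + tensor 1 (word_monom [x])) m \<noteq> 0 \<Longrightarrow> wdeg m = 1"
  by (auto simp: wdeg_prod_def wdeg_list_def wone_list_def split: if_splits)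

lemma alg_ext_1:
  fixes \<phi> :: "'x \<Rightarrow> 'm::word_monoid series"
  shows "alg_ext \<phi> 1 = 1"
proof -
  have eq: "(1 :: 'x list series) = word_monom []"
    by (rule series_eqI) (simp add: wone_list_def)
  show ?thesis unfolding eq alg_ext_monom by simp
qed

lemma prim_coproduct_1: "prim_coproduct 1 = 1"
  by (simp add: prim_coproduct_def alg_ext_1)

lemma finite_letters: "finite (A :: letter set)"
  by (rule finite_subset[of _ "{E0, E1}"]) (auto intro: letter.exhaust)

lemma prim_coproduct_mult: "prim_coproduct (f * g) = prim_coproduct f * prim_coproduct g"
  unfolding prim_coproduct_def
  by (rule alg_ext_mult[where X = UNIV and wt = "\<lambda>_. 1"]) (auto simp: prim_homog finite_letters)

lemma prim_coproduct_linear: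
  "prim_coproduct (series_scale c f + g) = series_scale c (prim_coproduct f) + prim_coproduct g"
  unfolding prim_coproduct_def
  by (rule alg_ext_linear[where X = UNIV and wt = "\<lambda>_. 1"]) (auto simp: prim_homog finite_letters)

lemma prim_coproduct_local:
  assumes "\<And>w. length w = wdeg m \<Longrightarrow> scoeff f w = scoeff g w"
  shows "scoeff (prim_coproduct f) m = scoeff (prim_coproduct g) m"
  unfolding prim_coproduct_def
  by (rule alg_ext_local[where X = UNIV and wt = "\<lambda>_. 1"])
     (auto simp: prim_homog finite_letters assms sum_list_triv)

lemma word_monom_mult: "word_monom u * word_monom v = word_monom (wcat u v)"
proof (rule series_eqI)
  fix m
  have "scoeff (word_monom u * word_monom v) m =
      (\<Sum>(a, b)\<in>(if wcat u v = m then {(u, v)} else {}). 1)"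
    unfolding scoeff_mult by (rule sum.mono_neutral_cong_right) (auto split: if_splits)
  then show "scoeff (word_monom u * word_monom v) m = scoeff (word_monom (wcat u v)) m" by simp
qed

lemma Y_gen_eq: "n \<ge> 1 \<Longrightarrow> Y_gen n = - word_monom (replicate (n - 1) E0 @ [E1])"
proof -
  have "e0 ^ k = word_monom (replicate k E0)" for k
  proof (induction k)
    case 0
    show ?case by (rule series_eqI) (simp add: wone_list_def)
  qed (simp add: e0_def word_monom_mult wcat_list_def)
  then show "n \<ge> 1 \<Longrightarrow> ?thesis"
    by (simp add: Y_gen_def e1_def word_monom_mult wcat_list_def)
qed

lemma Y_gen_homog: "scoeff (Y_gen n) w \<noteq> 0 \<Longrightarrow> w \<in> W_words \<and> length w = n"
proof (cases "n = 0")
  case False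
  then show "scoeff (Y_gen n) w \<noteq> 0 \<Longrightarrow> ?thesis"
    by (auto simp: Y_gen_eq W_words_def split: if_splits)
qed (auto simp: Y_gen_def W_words_def wone_list_def split: if_splits)

lemma harm_homog:
  "scoeff (\<Sum>i\<le>n. tensor (Y_gen i) (Y_gen (n - i))) m \<noteq> 0 \<Longrightarrow>
     wdeg m = n \<and> m \<in> W_words \<times> W_words"
proof -
  assume "scoeff (\<Sum>i\<le>n. tensor (Y_gen i) (Y_gen (n - i))) m \<noteq> 0"
  then obtain i where "i \<le> n" "scoeff (Y_gen i) (fst m) * scoeff (Y_gen (n - i)) (snd m) \<noteq> 0"
    by (auto elim: sum.not_neutral_contains_not_neutral)
  with Y_gen_homog[of i "fst m"] Y_gen_homog[of "n - i" "snd m"] show ?thesis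
    by (cases m) (auto simp: wdeg_prod_def wdeg_list_def)
qed

lemma Y_word_simps [simp]:
  "Y_word [] = []" "Y_word (n # ns) = replicate (n - 1) E0 @ E1 # Y_word ns"
  "Y_word (ms @ ns) = Y_word ms @ Y_word ns"
  by (simp_all add: Y_word_def)

lemma length_Y_word: "0 \<notin> set ns \<Longrightarrow> length (Y_word ns) = sum_list ns"
  by (induction ns) auto

lemma Y_word_in_W_words: "Y_word ns \<in> W_words"
  by (induction ns) (auto simp: W_words_def)

lemma replicate_E0_inj: "replicate m E0 @ E1 # u = replicate n E0 @ E1 # v \<Longrightarrow> m = n \<and> u = v"
proof (induction m arbitrary: n)
  case 0
  then show ?case by (cases n) auto
next
  case (Suc m)
  then show ?case by (cases n) auto
qed

lemma Y_word_inj: "0 \<notin> set ms \<Longrightarrow> 0 \<notin> set ns \<Longrightarrow> Y_word ms = Y_word ns \<Longrightarrow> ms = ns"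
proof (induction ms arbitrary: ns)
  case Nil
  then show ?case by (cases ns) auto
next
  case (Cons m ms)
  then obtain k ks where ns: "ns = k # ks" by (cases ns) auto
  from Cons.prems(3) ns have "m - 1 = k - 1 \<and> Y_word ms = Y_word ks"
    by (intro replicate_E0_inj) simp
  moreover from this have "ms = ks"
    using Cons.prems ns by (intro Cons.IH) simp_all
  ultimately show ?case
    using Cons.prems(1,2) ns by (cases m; cases k) simp_all
qed

lemma Y_word_surj: "w \<in> W_words \<Longrightarrow> \<exists>ns. 0 \<notin> set ns \<and> Y_word ns = w"
proof (induction w)
  case Nil
  show ?case by (rule exI[of _ "[]"]) simp
next
  case (Cons x w)
  show ?case
  proof (cases x)
    case E1
    from Cons obtain ns where "0 \<notin> set ns" "Y_word ns = w"
      by (auto simp: W_words_def split: if_splits)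
    with E1 show ?thesis by (intro exI[of _ "1 # ns"]) simp
  next
    case E0
    with Cons obtain ns where ns: "0 \<notin> set ns" "Y_word ns = w" "w \<noteq> []"
      by (auto simp: W_words_def split: if_splits)
    then obtain k ks where "ns = k # ks" "k \<noteq> 0" by (cases ns) auto
    with ns E0 show ?thesis
      by (intro exI[of _ "Suc k # ks"]) (cases k; simp)
  qed
qed

lemma scoeff_Y_expansion:
  "scoeff (Y_expansion f) ns = (if 0 \<in> set ns then 0 else (- 1) ^ length ns * scoeff f (Y_word ns))"
  by (simp add: Y_expansion_def)

lemma Y_expansion_support: "ns \<notin> lists {1..} \<Longrightarrow> scoeff (Y_expansion f) ns = 0"
proof -
  assume "ns \<notin> lists {1..}"
  then obtain n where "n \<in> set ns" "\<not> 1 \<le> n" by auto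
  then have "0 \<in> set ns" by (cases "n = 0") auto
  then show ?thesis by (simp add: scoeff_Y_expansion)
qed

lemma W_words_suffix: "u @ v \<in> W_words \<Longrightarrow> v \<in> W_words"
  by (cases "v = []") (auto simp: W_words_def)

lemma Y_expansion_mult:
  assumes "f \<in> W_alg"
  shows "Y_expansion (f * g) = Y_expansion f * Y_expansion g"
proof (rule series_eqI)
  fix ns
  show "scoeff (Y_expansion (f * g)) ns = scoeff (Y_expansion f * Y_expansion g) ns"
  proof (cases "0 \<in> set ns")
    case True
    then have "\<forall>p\<in>{(a, b). wcat a b = ns}.
        (case p of (a, b) \<Rightarrow> scoeff (Y_expansion f) a * scoeff (Y_expansion g) b) = 0"
      by (auto simp: wcat_list_def scoeff_Y_expansion)
    with True show ?thesis
      unfolding scoeff_mult by (subst sum.neutral) (simp_all add: scoeff_Y_expansion)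
  next
    case False
    have "scoeff (f * g) (Y_word ns) =
        (\<Sum>(u, v) | u @ v = Y_word ns \<and> u \<in> W_words. scoeff f u * scoeff g v)"
      unfolding scoeff_mult
      by (rule sum.mono_neutral_cong_right)
         (use assms in \<open>auto simp: W_alg_def wcat_list_def simp flip: wcat_list_def\<close>)
    also have "\<dots> = (\<Sum>(ks, ls) | ks @ ls = ns. scoeff f (Y_word ks) * scoeff g (Y_word ls))"
    proof -
      have pos: "0 \<notin> set ks" "0 \<notin> set ls" if "ks @ ls = ns" for ks ls
        using that False by auto
      have "bij_betw (\<lambda>p. (Y_word (fst p), Y_word (snd p))) {p. fst p @ snd p = ns}
          {p. fst p @ snd p = Y_word ns \<and> fst p \<in> W_words}"
        unfolding bij_betw_def
      proof (intro conjI inj_onI set_eqI iffI)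
        fix p q :: "nat list \<times> nat list"
        assume "p \<in> {p. fst p @ snd p = ns}" "q \<in> {p. fst p @ snd p = ns}"
          "(Y_word (fst p), Y_word (snd p)) = (Y_word (fst q), Y_word (snd q))"
        then show "p = q" using pos by (auto simp: prod_eq_iff intro: Y_word_inj)
      next
        fix p
        assume "p \<in> (\<lambda>p. (Y_word (fst p), Y_word (snd p))) ` {p. fst p @ snd p = ns}"
        then show "p \<in> {p. fst p @ snd p = Y_word ns \<and> fst p \<in> W_words}"
          by (auto simp: Y_word_in_W_words)
      next
        fix p
        assume p: "p \<in> {p. fst p @ snd p = Y_word ns \<and> fst p \<in> W_words}"
        then have "snd p \<in> W_words"
          using Y_word_in_W_words[of ns] W_words_suffix by (metis (mono_tags) mem_Collect_eq)
        with p obtain ks ls where *: "0 \<notin> set ks" "Y_word ks = fst p" "0 \<notin> set ls" "Y_word ls = snd p"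
          using Y_word_surj by blast
        then have "ks @ ls = ns"
          using p False by (intro Y_word_inj) auto
        with * show "p \<in> (\<lambda>p. (Y_word (fst p), Y_word (snd p))) ` {p. fst p @ snd p = ns}"
          by (intro image_eqI[of _ _ "(ks, ls)"]) auto
      qed
      from sum.reindex_bij_betw[OF this, of "\<lambda>q. scoeff f (fst q) * scoeff g (snd q)"]
      show ?thesis by (simp add: case_prod_unfold)
    qed
    finally have "scoeff (Y_expansion (f * g)) ns = (\<Sum>(ks, ls) | ks @ ls = ns.
        (- 1) ^ length ns * (scoeff f (Y_word ks) * scoeff g (Y_word ls)))"
      using False by (simp add: scoeff_Y_expansion sum_distrib_left case_prod_unfold)
    also have "\<dots> = scoeff (Y_expansion f * Y_expansion g) ns"
      unfolding scoeff_mult using False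
      by (intro sum.cong) (auto simp: wcat_list_def scoeff_Y_expansion power_add)
    finally show ?thesis .
  qed
qed

lemma Y_expansion_linear:
  "Y_expansion (series_scale c f + g) = series_scale c (Y_expansion f) + Y_expansion g"
  by (rule series_eqI) (simp add: scoeff_Y_expansion algebra_simps)

lemma Y_expansion_Y_gen: "n \<ge> 1 \<Longrightarrow> Y_expansion (Y_gen n) = word_monom [n]"
proof (rule series_eqI)
  fix ns assume n: "n \<ge> 1"
  show "scoeff (Y_expansion (Y_gen n)) ns = scoeff (word_monom [n]) ns"
  proof (cases "ns = [n]")
    case False
    then have "0 \<in> set ns \<or> Y_word ns \<noteq> replicate (n - 1) E0 @ [E1]"
      using n Y_word_inj[of ns "[n]"] by auto
    with n False show ?thesis by (auto simp: scoeff_Y_expansion Y_gen_eq)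
  qed (use n in \<open>simp add: scoeff_Y_expansion Y_gen_eq\<close>)
qed

lemma Y_expansion_1: "Y_expansion 1 = 1"
proof (rule series_eqI)
  fix ns show "scoeff (Y_expansion 1) ns = scoeff 1 ns"
    by (cases ns) (auto simp: scoeff_Y_expansion wone_list_def)
qed

lemma harm_coproduct_Y_gen: "harm_coproduct (Y_gen n) = (\<Sum>i\<le>n. tensor (Y_gen i) (Y_gen (n - i)))"
proof (cases "n = 0")
  case True
  have "1 = tensor 1 (1 :: nc_series)"
    by (rule series_eqI) (auto simp: wone_prod_def prod_eq_iff)
  with True show ?thesis
    by (simp add: harm_coproduct_def Y_gen_def Y_expansion_1 alg_ext_1)
qed (simp add: harm_coproduct_def Y_expansion_Y_gen alg_ext_monom)

lemma finite_pos_le: "finite {x \<in> {1..}. x \<le> (d :: nat)}"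
  by (rule finite_subset[of _ "{..d}"]) auto

lemma harm_coproduct_mult:
  assumes "f \<in> W_alg"
  shows "harm_coproduct (f * g) = harm_coproduct f * harm_coproduct g"
  unfolding harm_coproduct_def Y_expansion_mult[OF assms]
  by (rule alg_ext_mult[where X = "{1..}" and wt = id])
     (use Y_expansion_support finite_pos_le harm_homog in \<open>auto simp del: scoeff_sum\<close>)

lemma harm_coproduct_linear:
  "harm_coproduct (series_scale c f + g) = series_scale c (harm_coproduct f) + harm_coproduct g"
  unfolding harm_coproduct_def Y_expansion_linear
  by (rule alg_ext_linear[where X = "{1..}" and wt = id])
     (use Y_expansion_support finite_pos_le harm_homog in \<open>auto simp del: scoeff_sum\<close>)

lemma harm_coproduct_local:
  assumes "\<And>w. length w = wdeg m \<Longrightarrow> scoeff f w = scoeff g w"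
  shows "scoeff (harm_coproduct f) m = scoeff (harm_coproduct g) m"
  unfolding harm_coproduct_def
  by (rule alg_ext_local[where X = "{1..}" and wt = id])
     (use Y_expansion_support finite_pos_le harm_homog assms length_Y_word in
       \<open>auto simp: scoeff_Y_expansion simp del: scoeff_sum\<close>)

lemma W_words_append: "u \<in> W_words \<Longrightarrow> v \<in> W_words \<Longrightarrow> u @ v \<in> W_words"
  by (cases "v = []") (auto simp: W_words_def)

lemma harm_coproduct_in_W_tensor_W: "harm_coproduct f \<in> W_tensor_W"
proof -
  let ?\<phi> = "\<lambda>n. \<Sum>i\<le>n. tensor (Y_gen i) (Y_gen (n - i))"
  have "p \<in> W_words \<times> W_words" if "scoeff (prod_list (map ?\<phi> ns)) p \<noteq> 0" for ns p
    using that
  proof (induction ns arbitrary: p)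
    case Nil
    then show ?case by (auto simp: wone_prod_def wone_list_def W_words_def split: if_splits)
  next
    case (Cons n ns)
    from Cons.prems obtain a b where "wcat a b = p" "scoeff (?\<phi> n) a \<noteq> 0"
      "scoeff (prod_list (map ?\<phi> ns)) b \<noteq> 0"
      by (auto elim: mult_nonzeroE simp del: scoeff_sum)
    with Cons.IH[of b] harm_homog[of n a] show ?case
      by (auto simp: wcat_prod_def wcat_list_def W_words_append simp del: scoeff_sum)
  qed
  then have *: "scoeff (prod_list (map ?\<phi> ns)) p = 0" if "p \<notin> W_words \<times> W_words" for ns p
    using that by blast
  have "scoeff (harm_coproduct f) p = 0" if "p \<notin> W_words \<times> W_words" for p
    unfolding harm_coproduct_def alg_ext_def scoeff_Series *[OF that] by simp
  then show ?thesis by (auto simp: W_tensor_W_def)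
qed

end

theory Submission
  imports Defs "HOL-Real_Asymp.Real_Asymp"
begin

text \<open>
  Uniqueness for the KZ equation with prescribed asymptotics at 0 holds in the completed algebra of
  any graded monoid, by induction on the degree. Applied to the coproduct of a normalized solution
  and to its tensor square, it makes both normalized solutions, hence \<open>A\<close>, group-like.

  For the harmonic relation, write \<open>H\<^sub>N\<close> for the series of truncated multiple harmonic sums. Its
  factorization \<open>H\<^sub>N = Q\<^sub>N \<cdots> Q\<^sub>1\<close> with \<open>Q\<^sub>m = \<Sum>\<^sub>n y\<^sub>n m\<^sup>-\<^sup>n\<close> shows that it is group-like for the harmonic
  coproduct, and on \<open>W\<close> the solution \<open>G0\<close> is \<open>(1 - z) \<Sum>\<^sub>N H\<^sub>N z\<^sup>N\<close>. The same factorization shows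
  that \<open>H\<^sub>N = P\<^sub>N(y\<^sub>1) D + o(1)\<close> with \<open>P\<^sub>N(s) = \<Prod>\<^sub>j\<^sub>\<le>\<^sub>N (1 + s / j)\<close> and a constant series \<open>D\<close>. Because
  \<open>(1 - z) \<Sum>\<^sub>N P\<^sub>N(s) z\<^sup>N = (1 - z)\<^sup>-\<^sup>s\<close>, Abel summation gives \<open>G0 = (1 - z)\<^sup>e\<^sup>1 D + o(1)\<close> on \<open>W\<close> as
  \<open>z \<rightarrow> 1\<close>, so that \<open>D\<close> is the \<open>Y\<close>-part of \<open>A\<close>. Finally the group-like series \<open>N\<close> to the power \<open>-y\<^sub>1\<close>
  times \<open>H\<^sub>N\<close> converges to \<open>\<Gamma>(1 + y\<^sub>1)\<^sup>-\<^sup>1 D\<close>, and the beta factor measures exactly how far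
  \<open>\<Gamma>(1 + y\<^sub>1)\<close> is from being group-like.
\<close>

section \<open>Substitution into power series\<close>

text \<open>Convergence of coefficients alone does not suffice near 1: the factors that carry the
  divergence have coefficients growing like powers of a logarithm, and an o(1) error multiplied by
  them is out of control. Both comparisons therefore carry rates. The normalized solution reaches
  its limit with an error O(t), and the regularized harmonic sums have increments of size N^(-2) up
  to powers of log N, so their tails still vanish after multiplication by any power of log N. Two
  normalizations of the divergence compete. P_N(y_1) has an exact generating function and cancels
  the degree-one part of each Q_m exactly, but it is not group-like. N to the power y_1 is the
  exponential of a multiple of the primitive element y_1, hence group-like, but has no such
  generating function. The limit of their quotient is what brings Gamma into the harmonic side. All
  these factors are series in the single element y_1, so identities between them are proved for
  ordinary power series and then substituted.\<close>

lemma wcat_eq_wone_iff [simp]: "wcat a b = wone \<longleftrightarrow> a = wone \<and> b = (wone :: 'm::word_monoid)"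
  by (metis wcat_wone_left wdeg_wcat wdeg_eq_0_iff add_is_0)

lemma scoeff_mult_wone [simp]: "scoeff (f * g) wone = scoeff f wone * scoeff g (wone :: 'm::word_monoid)"
proof -
  have "{(a, b). wcat a b = (wone :: 'm)} = {(wone, wone)}" by auto
  then show ?thesis by (simp add: scoeff_mult)
qed

lemma scoeff_power_wone [simp]: "scoeff (f ^ n) (wone :: 'm::word_monoid) = scoeff f wone ^ n"
  by (induction n) simp_all

lemma scoeff_mult_cong:
  assumes "\<And>a. wdeg a \<le> wdeg m \<Longrightarrow> scoeff f a = scoeff f' a"
    and "\<And>a. wdeg a \<le> wdeg m \<Longrightarrow> scoeff g a = scoeff g' a"
  shows "scoeff (f * g) (m :: 'm::word_monoid) = scoeff (f' * g') m"
  unfolding scoeff_mult by (intro sum.cong refl) (use assms in auto)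

lemma series_scale_mult_left: "series_scale c f * g = series_scale c (f * (g :: 'm::word_monoid series))"
  by (rule series_eqI) (simp add: scoeff_mult sum_distrib_left case_prod_unfold mult_ac)

lemma series_scale_mult_right: "f * series_scale c g = series_scale c (f * (g :: 'm::word_monoid series))"
  by (rule series_eqI) (simp add: scoeff_mult sum_distrib_left case_prod_unfold mult_ac)

lemma series_scale_scale [simp]: "series_scale c (series_scale d f) = series_scale (c * d) (f :: 'm::word_monoid series)"
  by (rule series_eqI) simp

lemma series_scale_1 [simp]: "series_scale 1 f = (f :: 'm::word_monoid series)"
  by (rule series_eqI) simp

lemma series_scale_0 [simp]: "series_scale 0 f = (0 :: 'm::word_monoid series)"
  by (rule series_eqI) simp

lemma series_scale_minus1: "series_scale (- 1) f = - (f :: 'm::word_monoid series)"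
  by (rule series_eqI) simp

lemma series_scale_minus: "series_scale c (- f) = series_scale (- c) (f :: 'm::word_monoid series)"
  by (rule series_eqI) simp

lemma series_scale_add: "series_scale c (f + g) = series_scale c f + series_scale c (g :: 'm::word_monoid series)"
  by (rule series_eqI) (simp add: algebra_simps)

lemma series_scale_power: "series_scale c f ^ n = series_scale (c ^ n) (f ^ n :: 'm::word_monoid series)"
  by (induction n) (simp_all add: series_scale_mult_left series_scale_mult_right mult_ac)

lemma scoeff_of_nat_mult: "scoeff (of_nat k * f) m = of_nat k * scoeff (f :: 'm::word_monoid series) m"
  by (induction k) (simp_all add: algebra_simps)

text \<open>A factor without constant term raises the degree by at least 1. Two bases are allowed
  because the same truncation is applied to products of substitutions at different
  arguments.\<close>

lemma scoeff_power_mult_eq_0: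
  fixes x y :: "'m::word_monoid series"
  assumes x: "scoeff x wone = 0" and y: "scoeff y wone = 0"
  shows "wdeg m < i + j \<Longrightarrow> scoeff (x ^ i * y ^ j) m = 0"
proof (induction i arbitrary: m)
  case 0
  have "wdeg m < j \<Longrightarrow> scoeff (y ^ j) m = 0" for m
  proof (induction j arbitrary: m)
    case (Suc j)
    show ?case
    proof (rule ccontr)
      assume "scoeff (y ^ Suc j) m \<noteq> 0"
      then obtain a b where ab: "wcat a b = m" "scoeff y a \<noteq> 0" "scoeff (y ^ j) b \<noteq> 0"
        by (auto elim: mult_nonzeroE)
      with y have "wdeg a > 0" by (metis gr0I wdeg_eq_0_iff)
      moreover have "wdeg b \<ge> j" using ab Suc.IH[of b] by linarith
      ultimately show False using Suc.prems wdeg_wcat[of a b] unfolding ab(1) by linarith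
    qed
  qed simp
  with 0 show ?case by simp
next
  case (Suc i)
  show ?case
  proof (rule ccontr)
    assume "scoeff (x ^ Suc i * y ^ j) m \<noteq> 0"
    then have "scoeff (x * (x ^ i * y ^ j)) m \<noteq> 0" by (simp add: mult.assoc)
    then obtain a b where ab: "wcat a b = m" "scoeff x a \<noteq> 0" "scoeff (x ^ i * y ^ j) b \<noteq> 0"
      by (rule mult_nonzeroE)
    with x have "wdeg a > 0" by (metis gr0I wdeg_eq_0_iff)
    moreover have "wdeg b \<ge> i + j" using ab Suc.IH[of b] by linarith
    ultimately show False using Suc.prems wdeg_wcat[of a b] unfolding ab(1) by linarith
  qed
qed

lemma scoeff_power_eq_0:
  "scoeff x wone = 0 \<Longrightarrow> wdeg m < n \<Longrightarrow> scoeff (x ^ n) (m :: 'm::word_monoid) = 0"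
  using scoeff_power_mult_eq_0[of x x m n 0] by simp

lemma scoeff_fps_subst:
  assumes "scoeff x wone = 0" "wdeg (m :: 'm::word_monoid) \<le> N"
  shows "scoeff (fps_subst F x) m = (\<Sum>n\<le>N. fps_nth F n * scoeff (x ^ n) m)"
  unfolding fps_subst_def scoeff_Series
  by (rule suminf_finite) (use assms in \<open>auto simp: scoeff_power_eq_0\<close>)

lemma scoeff_fps_subst_trunc:
  assumes "scoeff x wone = 0" "wdeg (m :: 'm::word_monoid) \<le> N"
  shows "scoeff (fps_subst F x) m = scoeff (\<Sum>n\<le>N. series_scale (fps_nth F n) (x ^ n)) m"
  by (simp add: scoeff_fps_subst[OF assms])

lemma scoeff_fps_subst_wone [simp]:
  "scoeff x (wone :: 'm::word_monoid) = 0 \<Longrightarrow> scoeff (fps_subst F x) wone = fps_nth F 0"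
  by (subst scoeff_fps_subst[where N = 0]) auto

text \<open>Products of powers beyond the degree of \<open>m\<close> vanish, so the double sum may
  be cut to a triangle and grouped by total exponent. With \<open>x = y\<close> this yields
  multiplicativity of substitution, with two commuting arguments the addition formula for
  exponentials.\<close>

lemma scoeff_fps_subst_mult:
  fixes x y :: "'m::word_monoid series"
  assumes x: "scoeff x wone = 0" and y: "scoeff y wone = 0"
  shows "scoeff (fps_subst F x * fps_subst G y) m =
    (\<Sum>n\<le>wdeg m. \<Sum>i\<le>n. fps_nth F i * fps_nth G (n - i) * scoeff (x ^ i * y ^ (n - i)) m)"
proof -
  let ?N = "wdeg m"
  let ?c = "\<lambda>i j. fps_nth F i * fps_nth G j * scoeff (x ^ i * y ^ j) m"
  have nz: "i + j \<le> ?N" if "scoeff (x ^ i * y ^ j) m \<noteq> 0" for i j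
    using scoeff_power_mult_eq_0[OF x y, of m i j] that by linarith
  have "scoeff (fps_subst F x * fps_subst G y) m =
      scoeff ((\<Sum>n\<le>?N. series_scale (fps_nth F n) (x ^ n)) *
              (\<Sum>n\<le>?N. series_scale (fps_nth G n) (y ^ n))) m"
    by (rule scoeff_mult_cong; rule scoeff_fps_subst_trunc) (use x y in auto)
  also have "\<dots> = (\<Sum>i\<le>?N. \<Sum>j\<le>?N. ?c i j)"
    by (simp add: sum_product series_scale_mult_left series_scale_mult_right mult_ac)
  also have "\<dots> = (\<Sum>(i, j)\<in>{..?N} \<times> {..?N}. ?c i j)"
    by (simp add: sum.cartesian_product)
  also have "\<dots> = (\<Sum>(i, j) | i + j \<le> ?N. ?c i j)"
    by (rule sum.mono_neutral_right) (auto intro: nz)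
  also have "\<dots> = (\<Sum>n\<le>?N. \<Sum>i\<le>n. ?c i (n - i))"
    by (rule sum.triangle_reindex_eq)
  finally show ?thesis .
qed

text \<open>Substitution becomes a homomorphism from the commutative ring of ordinary power series,
  where commutation and inverses of series in one \<open>x\<close> can be settled.\<close>

lemma fps_subst_mult:
  fixes x :: "'m::word_monoid series"
  assumes x: "scoeff x wone = 0"
  shows "fps_subst (F * G) x = fps_subst F x * fps_subst G x"
proof (rule series_eqI)
  fix m
  show "scoeff (fps_subst (F * G) x) m = scoeff (fps_subst F x * fps_subst G x) m"
    by (simp add: scoeff_fps_subst_mult[OF x x] scoeff_fps_subst[OF x order.refl] fps_mult_nth
        sum_distrib_right atLeast0AtMost flip: power_add)
qed

lemma fps_subst_add:
  fixes x :: "'m::word_monoid series"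
  assumes x: "scoeff x wone = 0"
  shows "fps_subst (F + G) x = fps_subst F x + fps_subst G x"
  by (rule series_eqI)
     (simp add: scoeff_fps_subst[OF x order.refl] algebra_simps sum.distrib)

lemma fps_subst_const:
  fixes x :: "'m::word_monoid series"
  assumes x: "scoeff x wone = 0"
  shows "fps_subst (fps_const c) x = series_scale c 1"
proof (rule series_eqI)
  fix m
  have "scoeff (fps_subst (fps_const c) x) m = (\<Sum>n\<in>{0}. fps_nth (fps_const c) n * scoeff (x ^ n) m)"
    unfolding scoeff_fps_subst[OF x order.refl]
    by (rule sum.mono_neutral_right) auto
  then show "scoeff (fps_subst (fps_const c) x) m = scoeff (series_scale c 1) m" by simp
qed

lemma fps_subst_1 [simp]:
  fixes x :: "'m::word_monoid series"
  assumes x: "scoeff x wone = 0"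
  shows "fps_subst 1 x = 1"
  using fps_subst_const[OF x, of 1] by simp

lemma fps_subst_X [simp]:
  fixes x :: "'m::word_monoid series"
  assumes x: "scoeff x wone = 0"
  shows "fps_subst fps_X x = x"
proof (rule series_eqI)
  fix m
  \<comment> \<open>The truncation bound is taken one above the degree, so that the index 1 lies in
    the range even when \<open>wdeg m\<close> is 0.\<close>
  have "scoeff (fps_subst fps_X x) m = (\<Sum>n\<in>{1}. fps_nth fps_X n * scoeff (x ^ n) m)"
    unfolding scoeff_fps_subst[OF x le_SucI[OF order.refl]]
    by (rule sum.mono_neutral_right) auto
  then show "scoeff (fps_subst fps_X x) m = scoeff x m" by simp
qed

lemma fps_subst_power:
  fixes x :: "'m::word_monoid series"
  assumes x: "scoeff x wone = 0"
  shows "fps_subst (F ^ n) x = fps_subst F x ^ n"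
  by (induction n) (simp_all add: x fps_subst_mult)

lemma fps_subst_commute:
  fixes x :: "'m::word_monoid series"
  assumes x: "scoeff x wone = 0"
  shows "x * fps_subst F x = fps_subst F x * x"
  using fps_subst_mult[OF x, of fps_X F] fps_subst_mult[OF x, of F fps_X]
  by (simp add: x mult.commute)

lemma fps_subst_compose:
  fixes x :: "'m::word_monoid series"
  assumes x: "scoeff x wone = 0" and G: "fps_nth G 0 = 0"
  shows "fps_subst F (fps_subst G x) = fps_subst (F oo G) x"
proof (rule series_eqI)
  fix m :: 'm
  let ?N = "wdeg m"
  have Gx: "scoeff (fps_subst G x) wone = 0" using x G by simp
  have "scoeff (fps_subst F (fps_subst G x)) m =
      (\<Sum>n\<le>?N. \<Sum>k\<le>?N. fps_nth F n * fps_nth (G ^ n) k * scoeff (x ^ k) m)"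
    by (simp add: scoeff_fps_subst[OF Gx order.refl] scoeff_fps_subst[OF x order.refl]
        sum_distrib_left mult.assoc flip: fps_subst_power[OF x])
  also have "\<dots> = (\<Sum>k\<le>?N. \<Sum>n\<le>?N. fps_nth F n * fps_nth (G ^ n) k * scoeff (x ^ k) m)"
    by (rule sum.swap)
  also have "\<dots> = (\<Sum>k\<le>?N. \<Sum>n\<le>k. fps_nth F n * fps_nth (G ^ n) k * scoeff (x ^ k) m)"
    by (intro sum.cong refl sum.mono_neutral_right)
       (auto simp: startsby_zero_power_prefix[OF G])
  also have "\<dots> = scoeff (fps_subst (F oo G) x) m"
    by (simp add: scoeff_fps_subst[OF x order.refl] fps_compose_nth sum_distrib_right atLeast0AtMost)
  finally show "scoeff (fps_subst F (fps_subst G x)) m = scoeff (fps_subst (F oo G) x) m" .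
qed

text \<open>One coefficient of the image sees only one degree of the argument, so the substitution
  may be replaced by a finite sum, where linearity applies; locality thus stands in for continuity.
  Only powers of \<open>x\<close> are asked to be preserved, because the harmonic coproduct is
  multiplicative only for left factors in \<open>W_alg\<close>.\<close>

lemma fps_subst_hom:
  fixes \<Phi> :: "'m::word_monoid series \<Rightarrow> 'n::word_monoid series"
  assumes lin: "\<And>c f g. \<Phi> (series_scale c f + g) = series_scale c (\<Phi> f) + \<Phi> g"
    and pow: "\<And>n. \<Phi> (x ^ n) = \<Phi> x ^ n"
    and loc: "\<And>f g m. (\<And>w. wdeg w = wdeg m \<Longrightarrow> scoeff f w = scoeff g w) \<Longrightarrow>
                scoeff (\<Phi> f) m = scoeff (\<Phi> g) m"
    and x: "scoeff x wone = 0"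
  shows "\<Phi> (fps_subst F x) = fps_subst F (\<Phi> x)"
proof (rule series_eqI)
  fix m :: 'n
  have zero: "\<Phi> 0 = 0" using lin[of "-1" 0 0] by (simp add: series_scale_minus1)
  \<comment> \<open>In degree 0 the series \<open>x\<close> agrees with 0, so locality leaves
    \<open>\<Phi> x\<close> without constant term.\<close>
  have "scoeff (\<Phi> x) wone = scoeff (\<Phi> 0) wone" by (rule loc) (metis scoeff_simps(1) wdeg_eq_0_iff x)
  then have \<Phi>x: "scoeff (\<Phi> x) wone = 0" by (simp add: zero)
  have "\<Phi> (\<Sum>n\<in>A. series_scale (fps_nth F n) (x ^ n)) =
      (\<Sum>n\<in>A. series_scale (fps_nth F n) (\<Phi> x ^ n))" if "finite A" for A
    using that by induction (simp_all add: zero lin pow)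
  then have sum: "\<Phi> (\<Sum>n\<le>wdeg m. series_scale (fps_nth F n) (x ^ n)) =
      (\<Sum>n\<le>wdeg m. series_scale (fps_nth F n) (\<Phi> x ^ n))" by simp
  have "scoeff (\<Phi> (fps_subst F x)) m =
      scoeff (\<Phi> (\<Sum>n\<le>wdeg m. series_scale (fps_nth F n) (x ^ n))) m"
    by (rule loc, rule scoeff_fps_subst_trunc) (simp_all add: x)
  also have "\<dots> = scoeff (fps_subst F (\<Phi> x)) m"
    unfolding sum by (rule scoeff_fps_subst_trunc[symmetric]) (simp_all add: \<Phi>x)
  finally show "scoeff (\<Phi> (fps_subst F x)) m = scoeff (fps_subst F (\<Phi> x)) m" .
qed

lemma power_add_commuting:
  fixes x y :: "'a::ring_1"
  assumes "x * y = y * x"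
  shows "(x + y) ^ n = (\<Sum>k\<le>n. of_nat (n choose k) * (x ^ k * y ^ (n - k)))"
proof (induction n)
  case (Suc n)
  have yx: "y * x ^ k = x ^ k * y" for k
    by (metis assms power_commuting_commutes)
  let ?A = "\<lambda>k. of_nat (n choose k) * (x ^ Suc k * y ^ (n - k))"
  let ?B = "\<lambda>k. of_nat (n choose k) * (x ^ k * y ^ (Suc n - k))"
  have "(x + y) ^ Suc n = x * (x + y) ^ n + y * (x + y) ^ n"
    by (simp add: distrib_right)
  also have "x * (x + y) ^ n = (\<Sum>k\<le>n. ?A k)"
    unfolding Suc sum_distrib_left
    by (intro sum.cong refl) (metis (no_types, opaque_lifting) mult.assoc mult_of_nat_commute power_Suc)
  also have "y * (x + y) ^ n = (\<Sum>k\<le>n. ?B k)"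
    unfolding Suc sum_distrib_left
    by (intro sum.cong refl)
       (metis (no_types, opaque_lifting) Suc_diff_le atMost_iff mult.assoc mult_of_nat_commute power_Suc yx)
  also have "(\<Sum>k\<le>n. ?B k) = (\<Sum>k\<le>Suc n. ?B k)" by (simp add: binomial_eq_0)
  also have "\<dots> = ?B 0 + (\<Sum>k\<le>n. ?B (Suc k))" by (rule sum.atMost_Suc_shift)
  also have "(\<Sum>k\<le>n. ?A k) + (?B 0 + (\<Sum>k\<le>n. ?B (Suc k))) = ?B 0 + (\<Sum>k\<le>n. ?A k + ?B (Suc k))"
    by (simp add: sum.distrib)
  also have "\<dots> = (\<Sum>k\<le>Suc n. of_nat (Suc n choose k) * (x ^ k * y ^ (Suc n - k)))"
    unfolding sum.atMost_Suc_shift by (simp add: distrib_right)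
  finally show ?case .
qed simp

lemma fps_subst_exp_add:
  fixes x y :: "'m::word_monoid series"
  assumes x: "scoeff x wone = 0" and y: "scoeff y wone = 0" and "x * y = y * x"
  shows "fps_subst (fps_exp c) (x + y) = fps_subst (fps_exp c) x * fps_subst (fps_exp c) y"
proof (rule series_eqI)
  fix m
  have xy: "scoeff (x + y) wone = 0" using x y by simp
  have eq: "c ^ n / fact n * of_nat (n choose k) = c ^ k / fact k * (c ^ (n - k) / fact (n - k))"
    if "k \<le> n" for n k
    using that by (simp add: binomial_fact field_simps flip: power_add)
  show "scoeff (fps_subst (fps_exp c) (x + y)) m =
      scoeff (fps_subst (fps_exp c) x * fps_subst (fps_exp c) y) m"
    unfolding scoeff_fps_subst_mult[OF x y] scoeff_fps_subst[OF xy order.refl]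
      power_add_commuting[OF assms(3)] scoeff_sum scoeff_of_nat_mult fps_exp_nth of_nat_fact
      sum_distrib_left
    by (intro sum.cong refl) (simp only: mult.assoc[symmetric] eq atMost_iff)
qed

lemma series_exp_scale:
  fixes x :: "'m::word_monoid series"
  assumes x: "scoeff x wone = 0"
  shows "series_exp (series_scale c x) = fps_subst (fps_exp c) x"
proof (rule series_eqI)
  fix m
  have "scoeff (series_scale c x) wone = 0" using x by simp
  from scoeff_fps_subst[OF this order.refl]
  show "scoeff (series_exp (series_scale c x)) m = scoeff (fps_subst (fps_exp c) x) m"
    by (simp add: series_exp_def series_scale_power scoeff_fps_subst[OF x order.refl])
qed

lemma fps_subst_exp_uminus:
  fixes x :: "'m::word_monoid series"
  assumes x: "scoeff x wone = 0"
  shows "fps_subst (fps_exp (- c)) x * fps_subst (fps_exp c) x = 1"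
    and "fps_subst (fps_exp c) x * fps_subst (fps_exp (- c)) x = 1"
  using x by (simp_all flip: fps_subst_mult[OF x] fps_exp_add_mult)

section \<open>The tensor square\<close>

lemma tensor_mult:
  fixes f f' :: "'m::word_monoid series" and g g' :: "'n::word_monoid series"
  shows "tensor f g * tensor f' g' = tensor (f * f') (g * g')"
proof (rule series_eqI)
  fix p :: "'m \<times> 'n"
  have "scoeff (tensor f g * tensor f' g') p =
      (\<Sum>(q, r)\<in>{q. wcat (fst q) (snd q) = fst p} \<times> {r. wcat (fst r) (snd r) = snd p}.
        (scoeff f (fst q) * scoeff f' (snd q)) * (scoeff g (fst r) * scoeff g' (snd r)))"
    unfolding scoeff_mult
    by (rule sum.reindex_bij_witness[of _ "\<lambda>(q, r). ((fst q, fst r), (snd q, snd r))"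
          "\<lambda>(a, b). ((fst a, fst b), (snd a, snd b))"])
       (auto simp: wcat_prod_def)
  also have "\<dots> = scoeff (tensor (f * f') (g * g')) p"
    by (simp add: scoeff_mult case_prod_unfold sum_product sum.cartesian_product)
  finally show "scoeff (tensor f g * tensor f' g') p = scoeff (tensor (f * f') (g * g')) p" .
qed

lemma tensor_1_1: "tensor 1 1 = (1 :: ('m::word_monoid \<times> 'n::word_monoid) series)"
  by (rule series_eqI) (auto simp: wone_prod_def prod_eq_iff)

lemma tensor_power: "tensor f g ^ n = tensor (f ^ n) (g ^ n)"
  for f :: "'m::word_monoid series" and g :: "'n::word_monoid series"
  by (induction n) (simp_all add: tensor_mult tensor_1_1)

lemma fst_wone [simp]: "fst wone = wone" and snd_wone [simp]: "snd wone = wone"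
  by (simp_all add: wone_prod_def)

lemma tensor_wone_left [simp]:
  "scoeff x wone = 0 \<Longrightarrow> scoeff (tensor x 1) (wone :: 'm::word_monoid \<times> 'n::word_monoid) = 0"
  by simp

lemma tensor_wone_right [simp]:
  "scoeff x wone = 0 \<Longrightarrow> scoeff (tensor 1 x) (wone :: 'm::word_monoid \<times> 'n::word_monoid) = 0"
  by simp

lemma tensor_fps_subst_left:
  fixes x :: "'m::word_monoid series"
  assumes x: "scoeff x wone = 0"
  shows "tensor (fps_subst F x) 1 = fps_subst F (tensor x (1 :: 'n::word_monoid series))"
proof (rule fps_subst_hom[OF _ _ _ x])
  show "tensor (series_scale c f + g) (1 :: 'n series) = series_scale c (tensor f 1) + tensor g 1"
    for c and f g :: "'m series"
    by (rule series_eqI) (simp add: algebra_simps)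
  show "tensor (x ^ n) (1 :: 'n series) = tensor x 1 ^ n" for n
    by (simp add: tensor_power)
  show "scoeff (tensor f 1) m = scoeff (tensor g (1 :: 'n series)) m"
    if "\<And>w. wdeg w = wdeg m \<Longrightarrow> scoeff f w = scoeff g w" for f g :: "'m series" and m
    using that[of "fst m"] by (cases "snd m = wone") (auto simp: wdeg_prod_def)
qed

lemma tensor_fps_subst_right:
  fixes x :: "'n::word_monoid series"
  assumes x: "scoeff x wone = 0"
  shows "tensor 1 (fps_subst F x) = fps_subst F (tensor (1 :: 'm::word_monoid series) x)"
proof (rule fps_subst_hom[OF _ _ _ x])
  show "tensor (1 :: 'm series) (series_scale c f + g) = series_scale c (tensor 1 f) + tensor 1 g"
    for c and f g :: "'n series"
    by (rule series_eqI) (simp add: algebra_simps)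
  show "tensor (1 :: 'm series) (x ^ n) = tensor 1 x ^ n" for n
    by (simp add: tensor_power)
  show "scoeff (tensor 1 f) m = scoeff (tensor (1 :: 'm series) g) m"
    if "\<And>w. wdeg w = wdeg m \<Longrightarrow> scoeff f w = scoeff g w" for f g :: "'n series" and m
    using that[of "snd m"] by (cases "fst m = wone") (auto simp: wdeg_prod_def)
qed

text \<open>\<open>tensor x 1\<close> and \<open>tensor 1 x\<close> commute, so the exponential of
  their sum splits. Applied to primitive elements of either coproduct, this makes their exponentials
  group-like.\<close>

lemma fps_subst_exp_primitive:
  fixes x :: "'m::word_monoid series"
  assumes x: "scoeff x wone = 0"
  shows "fps_subst (fps_exp c) (tensor x 1 + tensor 1 x) =
    tensor (fps_subst (fps_exp c) x) (fps_subst (fps_exp c) x)"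
proof -
  have "fps_subst (fps_exp c) (tensor x 1 + tensor 1 x) =
      fps_subst (fps_exp c) (tensor x 1) * fps_subst (fps_exp c) (tensor 1 x)"
    by (rule fps_subst_exp_add) (simp_all add: x tensor_mult)
  also have "\<dots> = tensor (fps_subst (fps_exp c) x) (fps_subst (fps_exp c) x)"
    unfolding tensor_fps_subst_left[OF x, symmetric] tensor_fps_subst_right[OF x, symmetric]
      tensor_mult by simp
  finally show ?thesis .
qed

lemma prim_coproduct_fps_subst:
  assumes x: "scoeff x wone = 0"
  shows "prim_coproduct (fps_subst F x) = fps_subst F (prim_coproduct x)"
proof (rule fps_subst_hom[OF _ _ _ x])
  show "prim_coproduct (x ^ n) = prim_coproduct x ^ n" for n
    by (induction n) (simp_all add: prim_coproduct_1 prim_coproduct_mult)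
next
  show "scoeff (prim_coproduct f) m = scoeff (prim_coproduct g) m"
    if "\<And>w. wdeg w = wdeg m \<Longrightarrow> scoeff f w = scoeff g w" for f g m
    by (rule prim_coproduct_local, rule that) (simp add: wdeg_list_def)
qed (rule prim_coproduct_linear)

lemma W_alg_1: "1 \<in> W_alg"
  by (simp add: W_alg_def W_words_def wone_list_def)

lemma W_alg_mult: "f \<in> W_alg \<Longrightarrow> g \<in> W_alg \<Longrightarrow> f * g \<in> W_alg"
  unfolding W_alg_def mem_Collect_eq by (metis W_words_append mult_nonzeroE wcat_list_def)

lemma W_alg_power: "f \<in> W_alg \<Longrightarrow> f ^ n \<in> W_alg"
  by (induction n) (simp_all add: W_alg_1 W_alg_mult)

lemma W_alg_fps_subst: "x \<in> W_alg \<Longrightarrow> fps_subst F x \<in> W_alg"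
  using W_alg_power[of x] by (simp add: W_alg_def fps_subst_def)

lemma harm_coproduct_fps_subst:
  assumes x: "scoeff x wone = 0" and W: "x \<in> W_alg"
  shows "harm_coproduct (fps_subst F x) = fps_subst F (harm_coproduct x)"
proof (rule fps_subst_hom[OF _ _ _ x])
  have one: "harm_coproduct 1 = 1"
    unfolding harm_coproduct_def Y_expansion_1 by (rule alg_ext_1)
  show "harm_coproduct (x ^ n) = harm_coproduct x ^ n" for n
    by (induction n) (simp_all add: one harm_coproduct_mult[OF W])
next
  show "scoeff (harm_coproduct f) m = scoeff (harm_coproduct g) m"
    if "\<And>w. wdeg w = wdeg m \<Longrightarrow> scoeff f w = scoeff g w" for f g m
    by (rule harm_coproduct_local, rule that) (simp add: wdeg_list_def)
qed (rule harm_coproduct_linear)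

section \<open>Differential equations of KZ type\<close>

definition series_deriv :: "(real \<Rightarrow> 'm series) \<Rightarrow> 'm series \<Rightarrow> real \<Rightarrow> bool" where
  "series_deriv F F' z \<longleftrightarrow> (\<forall>m. ((\<lambda>t. scoeff (F t) m) has_vector_derivative scoeff F' m) (at z))"

lemma series_deriv_const: "series_deriv (\<lambda>_. C) 0 z"
  by (simp add: series_deriv_def)

lemma series_deriv_diff:
  "series_deriv F F' z \<Longrightarrow> series_deriv G G' z \<Longrightarrow> series_deriv (\<lambda>t. F t - G t) (F' - G') z"
  for F :: "real \<Rightarrow> 'm::word_monoid series"
  by (auto simp: series_deriv_def intro!: has_vector_derivative_diff)

lemma series_deriv_mult:
  fixes F G :: "real \<Rightarrow> 'm::word_monoid series"
  assumes "series_deriv F F' z" "series_deriv G G' z"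
  shows "series_deriv (\<lambda>t. F t * G t) (F z * G' + F' * G z) z"
proof -
  have *: "((\<lambda>t. scoeff (F t) a * scoeff (G t) b) has_vector_derivative
      scoeff (F z) a * scoeff G' b + scoeff F' a * scoeff (G z) b) (at z)" for a b
    using assms by (auto simp: series_deriv_def intro!: has_vector_derivative_mult)
  have "((\<lambda>t. scoeff (F t * G t) m) has_vector_derivative scoeff (F z * G' + F' * G z) m) (at z)" for m
    unfolding scoeff_mult scoeff_simps case_prod_unfold sum.distrib[symmetric]
    by (intro has_vector_derivative_sum *)
  then show ?thesis by (simp add: series_deriv_def)
qed

lemma series_deriv_tensor:
  fixes F :: "real \<Rightarrow> 'm::word_monoid series" and G :: "real \<Rightarrow> 'n::word_monoid series"
  assumes "series_deriv F F' z" "series_deriv G G' z"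
  shows "series_deriv (\<lambda>t. tensor (F t) (G t)) (tensor (F z) G' + tensor F' (G z)) z"
  using assms by (auto simp: series_deriv_def intro!: has_vector_derivative_mult)

text \<open>The power of \<open>t\<close> with exponent \<open>E\<close>, with \<open>ln t\<close>
  moved into the exponential series: the substituted element is \<open>E\<close> itself, and each
  coefficient is visibly a polynomial in \<open>ln t\<close>.\<close>

abbreviation rpow :: "real \<Rightarrow> 'm::word_monoid series \<Rightarrow> 'm series" where
  "rpow t E \<equiv> fps_subst (fps_exp (of_real (ln t))) E"

lemma real_pow_eq: "scoeff E wone = 0 \<Longrightarrow> real_pow t E = rpow t E"
  by (simp add: real_pow_def series_exp_scale)

lemma fps_subst_exp_minus:
  fixes x :: "'m::word_monoid series"
  assumes x: "scoeff x wone = 0"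
  shows "fps_subst (fps_exp c) (- x) = fps_subst (fps_exp (- c)) x"
proof -
  have "scoeff (- x) wone = 0" using x by simp
  then show ?thesis
    by (simp add: x series_scale_minus flip: series_exp_scale)
qed

lemma series_deriv_rpow:
  fixes E :: "'m::word_monoid series"
  assumes E: "scoeff E wone = 0" and z: "z > 0"
  shows "series_deriv (\<lambda>t. rpow t E) (series_scale (of_real (1 / z)) (E * rpow z E)) z"
  unfolding series_deriv_def
proof
  fix m :: 'm
  let ?c = "\<lambda>n. scoeff (E ^ n) m"
  have D: "((\<lambda>t. ln t ^ n / fact n) has_real_derivative
      (if n = 0 then 0 else ln z ^ (n - 1) / fact (n - 1)) / z) (at z)" for n
  proof (cases n)
    case (Suc k)
    have "((\<lambda>t. ln t ^ n / fact n) has_real_derivative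
        of_nat n * (1 / z * ln z ^ (n - Suc 0)) / fact n) (at z)"
      by (intro DERIV_cdivide DERIV_power DERIV_ln_divide z)
    then show ?thesis by (simp add: Suc fact_Suc mult.commute del: of_nat_Suc)
  qed simp
  have "E * rpow z E = fps_subst (fps_X * fps_exp (of_real (ln z))) E"
    by (simp add: E fps_subst_mult)
  then have "scoeff (series_scale (of_real (1 / z)) (E * rpow z E)) m =
      (\<Sum>n\<le>wdeg m. of_real ((if n = 0 then 0 else ln z ^ (n - 1) / fact (n - 1)) / z) * ?c n)"
    by (auto simp: scoeff_fps_subst[OF E order.refl] sum_distrib_left fps_X_mult_nth intro!: sum.cong)
  moreover have "scoeff (rpow t E) m = (\<Sum>n\<le>wdeg m. of_real (ln t ^ n / fact n) * ?c n)" for t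
    by (simp add: scoeff_fps_subst[OF E order.refl])
  ultimately show "((\<lambda>t. scoeff (rpow t E) m) has_vector_derivative
      scoeff (series_scale (of_real (1 / z)) (E * rpow z E)) m) (at z)"
    by (simp only:) (intro has_vector_derivative_sum has_vector_derivative_mult_left
        has_vector_derivative_of_real D)
qed

lemma rpow_inverse:
  assumes E: "scoeff E (wone :: 'm::word_monoid) = 0"
  shows "rpow t (- E) * rpow t E = 1"
  using E by (simp add: fps_subst_exp_minus fps_subst_exp_uminus)

definition KZ_eq :: "'m::word_monoid series \<Rightarrow> 'm series \<Rightarrow> (real \<Rightarrow> 'm series) \<Rightarrow> bool" where
  "KZ_eq E F G \<longleftrightarrow> (\<forall>z\<in>{0<..<1}. series_deriv G
     ((series_scale (of_real (1 / z)) E + series_scale (of_real (1 / (z - 1))) F) * G z) z)"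

lemma KZ_solution_iff: "KZ_solution G \<longleftrightarrow> KZ_eq e0 e1 G"
  by (simp add: KZ_solution_def KZ_eq_def series_deriv_def)

text \<open>Passing from \<open>t\<close> to \<open>1 - t\<close> exchanges the two poles together
  with their letters, the sign of the inner derivative being absorbed by the denominators.
  Statements about \<open>G1\<close> at 1 thereby become instances of statements at 0.\<close>

lemma KZ_eq_reflect:
  assumes "KZ_eq E F G"
  shows "KZ_eq F E (\<lambda>t. G (1 - t))"
  unfolding KZ_eq_def series_deriv_def
proof (intro ballI allI)
  fix z :: real and m assume z: "z \<in> {0<..<1}"
  let ?D = "scoeff ((series_scale (of_real (1 / (1 - z))) E +
      series_scale (of_real (1 / (1 - z - 1))) F) * G (1 - z)) m"
  have "((\<lambda>t. scoeff (G t) m) has_vector_derivative ?D) (at (1 - z))"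
    by (rule bspec[OF assms[unfolded KZ_eq_def series_deriv_def], rule_format]) (use z in auto)
  moreover have "((\<lambda>t. 1 - t) has_vector_derivative - 1) (at z)"
    by (auto intro!: derivative_eq_intros)
  ultimately have "(((\<lambda>t. scoeff (G t) m) \<circ> (\<lambda>t. 1 - t)) has_vector_derivative (- 1) *\<^sub>R ?D) (at z)"
    by (intro vector_diff_chain_at) auto
  moreover have "1 / (1 - z) = - (1 / (z - 1))" "1 / (1 - z - 1) = - (1 / z)"
    using z by (auto simp: field_simps)
  ultimately show "((\<lambda>t. scoeff (G (1 - t)) m) has_vector_derivative
      scoeff ((series_scale (of_real (1 / z)) F + series_scale (of_real (1 / (z - 1))) E) * G (1 - z)) m)
      (at z)"
    by (simp add: o_def distrib_right series_scale_mult_left)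
qed

lemma KZ_eq_mult_right: "KZ_eq E F G \<Longrightarrow> KZ_eq E F (\<lambda>t. G t * C)"
  unfolding KZ_eq_def
  by (intro ballI, drule bspec, assumption, drule series_deriv_mult[OF _ series_deriv_const[of C]])
     (simp add: mult.assoc)

lemma KZ_eq_diff: "KZ_eq E F G \<Longrightarrow> KZ_eq E F H \<Longrightarrow> KZ_eq E F (\<lambda>t. G t - H t)"
  unfolding KZ_eq_def right_diff_distrib by (intro ballI series_deriv_diff) simp_all

lemma scoeff_mult_left_eq_0:
  fixes m :: "'m::word_monoid"
  assumes "scoeff E wone = 0" "\<And>b. wdeg b < wdeg m \<Longrightarrow> scoeff S b = 0"
  shows "scoeff (E * S) m = 0"
  unfolding scoeff_mult
proof (rule sum.neutral, clarify)
  fix a b assume m: "m = wcat a b"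
  show "scoeff E a * scoeff S b = 0"
  proof (cases "a = wone")
    case False
    then have "wdeg a \<noteq> 0" by simp
    then have "wdeg b < wdeg m" unfolding m wdeg_wcat by linarith
    then show ?thesis by (simp add: assms)
  qed (simp add: assms)
qed

lemma scoeff_mult_right_eq_0:
  fixes m :: "'m::word_monoid"
  assumes "scoeff E wone = 0" "\<And>b. wdeg b < wdeg m \<Longrightarrow> scoeff S b = 0"
  shows "scoeff (S * E) m = 0"
  unfolding scoeff_mult
proof (rule sum.neutral, clarify)
  fix a b assume m: "m = wcat a b"
  show "scoeff S a * scoeff E b = 0"
  proof (cases "b = wone")
    case False
    then have "wdeg b \<noteq> 0" by simp
    then have "wdeg a < wdeg m" unfolding m wdeg_wcat by linarith
    then show ?thesis by (simp add: assms)
  qed (simp add: assms)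
qed

lemma norm_diff_le_derivative_bound:
  fixes f :: "real \<Rightarrow> 'b::real_normed_vector"
  assumes S: "convex S" "x \<in> S" "y \<in> S" and B: "B \<ge> 0"
    and D: "\<And>t. t \<in> S \<Longrightarrow> (f has_vector_derivative f' t) (at t)"
    and le: "\<And>t. t \<in> S \<Longrightarrow> norm (f' t) \<le> B"
  shows "norm (f x - f y) \<le> B * \<bar>x - y\<bar>"
proof -
  have "norm (f x - f y) \<le> B * norm (x - y)"
  proof (rule differentiable_bound[OF S(1) _ _ S(2,3)])
    show "(f has_derivative (\<lambda>h. h *\<^sub>R f' t)) (at t within S)" if "t \<in> S" for t
      using D[OF that] by (auto simp: has_vector_derivative_def intro: has_derivative_at_withinI)
    show "onorm (\<lambda>h. h *\<^sub>R f' t) \<le> B" if "t \<in> S" for t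
      by (rule onorm_bound) (use le[OF that] B in \<open>auto simp: mult.commute[of B] intro!: mult_left_mono\<close>)
  qed
  then show ?thesis by simp
qed

lemma zero_derivative_constant:
  fixes f :: "real \<Rightarrow> 'b::real_normed_vector"
  assumes "\<And>t. t \<in> {0<..<1} \<Longrightarrow> (f has_vector_derivative 0) (at t)" "x \<in> {0<..<1}" "y \<in> {0<..<1}"
  shows "f x = f y"
  using norm_diff_le_derivative_bound[of "{0<..<1}" x y 0 f "\<lambda>_. 0"] assms by auto

lemma eventually_at_right_0_1: "eventually (\<lambda>z::real. z \<in> {0<..<1}) (at_right 0)"
  by (rule eventually_at_right_real) simp

section \<open>Uniqueness from a value at a point and from the behaviour at 0\<close>

lemma KZ_eq_initial_unique:
  fixes T :: "real \<Rightarrow> 'm::word_monoid series"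
  assumes T: "KZ_eq E F T" and E: "scoeff E wone = 0" and F: "scoeff F wone = 0"
    and z0: "z0 \<in> {0<..<1}" "T z0 = 0" and z: "z \<in> {0<..<1}"
  shows "T z = 0"
proof (rule series_eqI)
  have "\<forall>z\<in>{0<..<1}. scoeff (T z) m = 0" for m
  proof (induction "wdeg m" arbitrary: m rule: less_induct)
    case less
    have "((\<lambda>t. scoeff (T t) m) has_vector_derivative 0) (at t)" if t: "t \<in> {0<..<1}" for t
    proof -
      have eq: "scoeff ((series_scale (of_real (1 / t)) E + series_scale (of_real (1 / (t - 1))) F) * T t) m = 0"
        by (rule scoeff_mult_left_eq_0) (use E F less t in auto)
      show ?thesis
        using bspec[OF T[unfolded KZ_eq_def series_deriv_def] t, THEN spec, of m] unfolding eq .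
    qed
    from zero_derivative_constant[OF this _ z0(1)] z0(2) show ?case by simp
  qed
  then show "scoeff (T z) m = scoeff 0 m" for m using z by simp
qed

text \<open>Multiplication by \<open>rpow t (- E)\<close> removes the logarithms at 0 and turns left
  multiplication by \<open>E\<close> in the singular term into a commutator, to which scalars
  contribute nothing.\<close>

lemma KZ_eq_gauge:
  fixes T :: "real \<Rightarrow> 'm::word_monoid series"
  assumes T: "KZ_eq E F T" and E: "scoeff E wone = 0" and z: "z \<in> {0<..<1}"
  defines "S \<equiv> \<lambda>t. T t * rpow t (- E)"
  shows "series_deriv S (series_scale (of_real (1 / z)) (E * S z - S z * E) +
           series_scale (of_real (1 / (z - 1))) (F * S z)) z"
proof -
  have E': "scoeff (- E) wone = 0" using E by simp
  have comm: "E * rpow z (- E) = rpow z (- E) * E"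
    using fps_subst_commute[OF E', of "fps_exp (of_real (ln z))"] by simp
  have "series_deriv S (T z * series_scale (of_real (1 / z)) (- E * rpow z (- E)) +
      (series_scale (of_real (1 / z)) E + series_scale (of_real (1 / (z - 1))) F) * T z * rpow z (- E)) z"
    unfolding S_def using T z
    by (intro series_deriv_mult series_deriv_rpow E') (auto simp: KZ_eq_def)
  also have "T z * series_scale (of_real (1 / z)) (- E * rpow z (- E)) +
      (series_scale (of_real (1 / z)) E + series_scale (of_real (1 / (z - 1))) F) * T z * rpow z (- E) =
      series_scale (of_real (1 / z)) (E * S z - S z * E) +
           series_scale (of_real (1 / (z - 1))) (F * S z)"
    unfolding S_def
    by (rule series_eqI)
       (simp add: comm distrib_right series_scale_mult_left series_scale_mult_right mult.assoc algebra_simps)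
  finally show ?thesis .
qed

text \<open>After the gauge transformation the derivative of a coefficient involves only
  coefficients of smaller degree. These vanish by induction, so the coefficient is constant and
  equals its limit 0. The limit is known only for the gauged function, hence the induction runs on
  \<open>S\<close> and not on \<open>T\<close>.\<close>

lemma KZ_eq_asymptotic_unique:
  fixes T :: "real \<Rightarrow> 'm::word_monoid series"
  assumes T: "KZ_eq E F T" and E: "scoeff E wone = 0" and F: "scoeff F wone = 0"
    and lim: "series_tendsto (\<lambda>z. T z * rpow z (- E)) 0 (at_right 0)" and z: "z \<in> {0<..<1}"
  shows "T z = 0"
proof -
  define S where "S = (\<lambda>t. T t * rpow t (- E))"
  have "\<forall>z\<in>{0<..<1}. scoeff (S z) m = 0" for m
  proof (induction "wdeg m" arbitrary: m rule: less_induct)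
    case less
    have half: "1 / 2 \<in> {0<..<1::real}" by simp
    have "((\<lambda>t. scoeff (S t) m) has_vector_derivative 0) (at t)" if t: "t \<in> {0<..<1}" for t
    proof -
      have "scoeff (E * S t) m = 0" "scoeff (F * S t) m = 0" "scoeff (S t * E) m = 0"
        using less t
        by (auto intro!: scoeff_mult_left_eq_0[OF E] scoeff_mult_left_eq_0[OF F] scoeff_mult_right_eq_0[OF E])
      moreover have "series_deriv S (series_scale (of_real (1 / t)) (E * S t - S t * E) +
           series_scale (of_real (1 / (t - 1))) (F * S t)) t"
        using KZ_eq_gauge[OF T E t] by (simp only: S_def)
      then have "((\<lambda>t. scoeff (S t) m) has_vector_derivative
          scoeff (series_scale (of_real (1 / t)) (E * S t - S t * E) +
           series_scale (of_real (1 / (t - 1))) (F * S t)) m) (at t)"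
        by (simp only: series_deriv_def)
      ultimately show ?thesis by simp
    qed
    from zero_derivative_constant[OF this _ half]
    have const: "scoeff (S t) m = scoeff (S (1 / 2)) m" if "t \<in> {0<..<1}" for t
      using that by blast
    have "((\<lambda>t. scoeff (S t) m) \<longlongrightarrow> scoeff (S (1 / 2)) m) (at_right 0)"
      by (rule tendsto_eventually, rule eventually_mono[OF eventually_at_right_0_1 const])
    moreover have "((\<lambda>t. scoeff (S t) m) \<longlongrightarrow> 0) (at_right 0)"
      using lim by (simp add: series_tendsto_def S_def)
    ultimately have "scoeff (S (1 / 2)) m = 0"
      using tendsto_unique trivial_limit_at_right_real by blast
    then show ?case using const by metis
  qed
  then have "S z = 0" using z by (intro series_eqI) simp
  moreover have "T z = S z * rpow z E"
    by (simp add: S_def mult.assoc rpow_inverse E)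
  ultimately show ?thesis by simp
qed

section \<open>Linear rate of convergence at 0\<close>

definition lin_small :: "(real \<Rightarrow> complex) \<Rightarrow> bool" where
  "lin_small f \<longleftrightarrow> (\<exists>K. eventually (\<lambda>z. norm (f z) \<le> K * z) (at_right 0))"

lemma lin_small_0: "lin_small (\<lambda>_. 0)"
  unfolding lin_small_def by (intro exI[of _ 0]) simp

lemma lin_small_add: "lin_small f \<Longrightarrow> lin_small g \<Longrightarrow> lin_small (\<lambda>z. f z + g z)"
proof -
  assume "lin_small f" "lin_small g"
  then obtain K L where "eventually (\<lambda>z. norm (f z) \<le> K * z) (at_right 0)"
    "eventually (\<lambda>z. norm (g z) \<le> L * z) (at_right 0)" by (auto simp: lin_small_def)
  then have "eventually (\<lambda>z. norm (f z + g z) \<le> (K + L) * z) (at_right 0)"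
    by eventually_elim (simp add: distrib_right norm_triangle_mono)
  then show ?thesis by (auto simp: lin_small_def)
qed

lemma lin_small_cmult: "lin_small f \<Longrightarrow> lin_small (\<lambda>z. c * f z)"
proof -
  assume "lin_small f"
  then obtain K where "eventually (\<lambda>z. norm (f z) \<le> K * z) (at_right 0)" by (auto simp: lin_small_def)
  then have "eventually (\<lambda>z. norm (c * f z) \<le> (norm c * K) * z) (at_right 0)"
    by eventually_elim (simp add: norm_mult mult.assoc mult_left_mono)
  then show ?thesis by (auto simp: lin_small_def)
qed

lemma lin_small_diff: "lin_small f \<Longrightarrow> lin_small g \<Longrightarrow> lin_small (\<lambda>z. f z - g z)"
  using lin_small_add[of f "\<lambda>z. - 1 * g z"] lin_small_cmult[of g "-1"] by simp

lemma lin_small_sum: "(\<And>i. i \<in> I \<Longrightarrow> lin_small (f i)) \<Longrightarrow> lin_small (\<lambda>z. \<Sum>i\<in>I. f i z)"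
  by (induction I rule: infinite_finite_induct) (auto intro: lin_small_add lin_small_0)

lemma lin_small_series_mult_left:
  fixes m :: "'m::word_monoid"
  assumes "scoeff E wone = 0" "\<And>b. wdeg b < wdeg m \<Longrightarrow> lin_small (\<lambda>z. scoeff (S z) b)"
  shows "lin_small (\<lambda>z. scoeff (E * S z) m)"
  unfolding scoeff_mult case_prod_unfold
proof (rule lin_small_sum)
  fix p :: "'m \<times> 'm" assume "p \<in> {p. wcat (fst p) (snd p) = m}"
  then have m: "m = wcat (fst p) (snd p)" by simp
  show "lin_small (\<lambda>z. scoeff E (fst p) * scoeff (S z) (snd p))"
  proof (cases "fst p = wone")
    case False
    then have "wdeg (fst p) \<noteq> 0" by simp
    then have "wdeg (snd p) < wdeg m" unfolding m wdeg_wcat by linarith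
    then show ?thesis by (intro lin_small_cmult assms)
  qed (simp add: assms lin_small_0)
qed

lemma lin_small_series_mult_right:
  fixes m :: "'m::word_monoid"
  assumes "scoeff E wone = 0" "\<And>b. wdeg b < wdeg m \<Longrightarrow> lin_small (\<lambda>z. scoeff (S z) b)"
  shows "lin_small (\<lambda>z. scoeff (S z * E) m)"
  unfolding scoeff_mult case_prod_unfold
proof (rule lin_small_sum)
  fix p :: "'m \<times> 'm" assume "p \<in> {p. wcat (fst p) (snd p) = m}"
  then have m: "m = wcat (fst p) (snd p)" by simp
  show "lin_small (\<lambda>z. scoeff (S z) (fst p) * scoeff E (snd p))"
  proof (cases "snd p = wone")
    case False
    then have "wdeg (snd p) \<noteq> 0" by simp
    then have "wdeg (fst p) < wdeg m" unfolding m wdeg_wcat by linarith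
    then show ?thesis by (subst mult.commute) (intro lin_small_cmult assms)
  qed (simp add: assms lin_small_0)
qed

text \<open>A mean value estimate between \<open>z\<close> and a smaller point \<open>w\<close>,
  followed by \<open>w\<close> tending to 0.\<close>

lemma lin_small_of_derivative_bounded:
  assumes D: "\<And>z. z \<in> {0<..<1} \<Longrightarrow> (f has_vector_derivative f' z) (at z)"
    and B: "eventually (\<lambda>z. norm (f' z) \<le> K) (at_right 0)"
    and lim: "(f \<longlongrightarrow> 0) (at_right 0)"
  shows "lin_small f"
proof -
  from B obtain b where b: "b > 0" "\<And>z. 0 < z \<Longrightarrow> z < b \<Longrightarrow> norm (f' z) \<le> K"
    by (auto simp: eventually_at_right_field)
  define d where "d = min b 1"
  have d: "d > 0" "d \<le> 1" "d \<le> b" using b by (auto simp: d_def)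
  have "norm (f' (d / 2)) \<le> K" using b d by simp
  then have K: "K \<ge> 0" by (rule order.trans[OF norm_ge_zero])
  have "norm (f z) \<le> K * z" if z: "0 < z" "z < d" for z
  proof (rule tendsto_upperbound)
    have "((\<lambda>w. norm (f z - f w)) \<longlongrightarrow> norm (f z - 0)) (at_right 0)"
      by (intro tendsto_intros lim)
    then show "((\<lambda>w. norm (f z - f w)) \<longlongrightarrow> norm (f z)) (at_right 0)" by simp
    show "eventually (\<lambda>w. norm (f z - f w) \<le> K * z) (at_right 0)"
      using eventually_at_right_real[OF z(1)]
    proof eventually_elim
      case (elim w)
      have "norm (f z - f w) \<le> K * \<bar>z - w\<bar>"
        by (rule norm_diff_le_derivative_bound[of "{0<..<d}" _ _ _ _ f']) (use elim z d b K D in auto)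
      also have "\<dots> \<le> K * z" using elim K by (intro mult_left_mono) auto
      finally show ?case .
    qed
  qed simp
  then have "eventually (\<lambda>z. norm (f z) \<le> K * z) (at_right 0)"
    using d(1) by (auto simp: eventually_at_right_field)
  then show ?thesis by (auto simp: lin_small_def)
qed

text \<open>The 1 drops out of the commutator in \<open>KZ_eq_gauge\<close>, so the singular term
  contains only coefficients of \<open>R\<close> of smaller degree. These are O(z) by induction,
  division by \<open>z\<close> leaves something bounded, and a bounded derivative together with the
  limit 0 gives the rate.\<close>

lemma KZ_normalized_rate:
  fixes T :: "real \<Rightarrow> 'm::word_monoid series"
  assumes T: "KZ_eq E F T" and E: "scoeff E wone = 0" and F: "scoeff F wone = 0"
    and lim: "series_tendsto (\<lambda>z. T z * rpow z (- E)) 1 (at_right 0)"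
  shows "lin_small (\<lambda>z. scoeff (T z * rpow z (- E) - 1) m)"
proof (induction "wdeg m" arbitrary: m rule: less_induct)
  case less
  define S where "S = (\<lambda>t. T t * rpow t (- E))"
  define R where "R = (\<lambda>t. S t - 1)"
  have IH: "lin_small (\<lambda>z. scoeff (R z) b)" if "wdeg b < wdeg m" for b
    using less that by (simp add: R_def S_def)
  let ?R' = "\<lambda>z. of_real (1 / z) * (scoeff (E * R z) m - scoeff (R z * E) m) +
      of_real (1 / (z - 1)) * (scoeff (F * R z) m + scoeff F m)"
  have D: "((\<lambda>t. scoeff (R t) m) has_vector_derivative ?R' z) (at z)" if "z \<in> {0<..<1}" for z
  proof -
    have "series_deriv R (series_scale (of_real (1 / z)) (E * S z - S z * E) +
           series_scale (of_real (1 / (z - 1))) (F * S z) - 0) z"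
      unfolding R_def
      by (intro series_deriv_diff series_deriv_const) (use KZ_eq_gauge[OF T E that] in \<open>simp add: S_def\<close>)
    moreover have "S z = R z + 1" by (simp add: R_def)
    ultimately show ?thesis by (simp add: series_deriv_def algebra_simps)
  qed
  have "lin_small (\<lambda>z. scoeff (E * R z) m - scoeff (R z * E) m)"
    by (intro lin_small_diff lin_small_series_mult_left lin_small_series_mult_right E IH)
  moreover have "lin_small (\<lambda>z. scoeff (F * R z) m)"
    by (intro lin_small_series_mult_left F IH)
  ultimately obtain K L where
    "eventually (\<lambda>z. norm (scoeff (E * R z) m - scoeff (R z * E) m) \<le> K * z) (at_right 0)"
    "eventually (\<lambda>z. norm (scoeff (F * R z) m) \<le> L * z) (at_right 0)"
    by (auto simp: lin_small_def)
  moreover have "eventually (\<lambda>z::real. z \<in> {0<..<1/2}) (at_right 0)"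
    by (rule eventually_at_right_real) simp
  \<comment> \<open>\<open>K\<close> comes from the pole at 0 after \<open>z\<close> has cancelled;
    the 2 bounds the absolute value of \<open>1 / (z - 1)\<close> on the interval from 0 to
    1/2.\<close>
  ultimately have B: "eventually (\<lambda>z. norm (?R' z) \<le> K + 2 * (\<bar>L\<bar> + norm (scoeff F m))) (at_right 0)"
  proof eventually_elim
    case (elim z)
    have "norm (of_real (1 / z) * (scoeff (E * R z) m - scoeff (R z * E) m)) \<le> (1 / z) * (K * z)"
      unfolding norm_mult norm_of_real using elim by (intro mult_mono) auto
    moreover have "norm (of_real (1 / (z - 1)) * (scoeff (F * R z) m + scoeff F m)) \<le>
        2 * (\<bar>L\<bar> + norm (scoeff F m))"
    proof -
      have "L * z \<le> \<bar>L\<bar> * 1" using elim by (intro mult_mono) auto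
      then have "norm (scoeff (F * R z) m + scoeff F m) \<le> \<bar>L\<bar> + norm (scoeff F m)"
        using elim by (intro norm_triangle_mono) auto
      moreover have "\<bar>1 / (z - 1)\<bar> \<le> 2" using elim by (auto simp: field_simps abs_if)
      ultimately show ?thesis unfolding norm_mult norm_of_real by (intro mult_mono) auto
    qed
    ultimately have "norm (?R' z) \<le> (1 / z) * (K * z) + 2 * (\<bar>L\<bar> + norm (scoeff F m))"
      by (rule norm_triangle_mono)
    with elim show ?case by simp
  qed
  have "((\<lambda>t. scoeff (R t) m) \<longlongrightarrow> scoeff 1 m - scoeff 1 m) (at_right 0)"
    using lim unfolding R_def S_def series_tendsto_def scoeff_simps(5) by (intro tendsto_intros) auto
  from lin_small_of_derivative_bounded[OF D B] this
  show ?case by (simp add: R_def S_def)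
qed

section \<open>The associator is group-like\<close>

text \<open>Letters go to elements of degree 1, so only the finitely many words of length
  \<open>wdeg m\<close> contribute, with weights independent of \<open>f\<close>. Derivatives and
  limits then pass through the coproduct term by term.\<close>

lemma scoeff_prim_coproduct_finite:
  "\<exists>S c. finite S \<and> (\<forall>f. scoeff (prim_coproduct f) m = (\<Sum>w\<in>S. scoeff f w * c w))"
proof -
  let ?S = "{w :: letter list. length w = wdeg m}"
  have fin: "finite ?S"
    using finite_lists_length_eq[OF finite_letters[of UNIV], of "wdeg m"] by simp
  let ?c = "\<lambda>w. scoeff (prod_list
      (map (\<lambda>x. tensor (word_monom [x]) 1 + tensor 1 (word_monom [x])) w)) m"
  have "scoeff (prim_coproduct f) m = (\<Sum>w\<in>?S. scoeff f w * ?c w)" for f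
    unfolding prim_coproduct_def
    by (rule scoeff_alg_ext[where X = UNIV and wt = "\<lambda>_. 1", OF prim_homog _ finite_letters _ fin])
       (auto simp: sum_list_triv)
  with fin show ?thesis by (intro exI[of _ ?S] exI[of _ ?c]) simp
qed

lemma series_deriv_prim_coproduct:
  assumes "series_deriv F F' z"
  shows "series_deriv (\<lambda>t. prim_coproduct (F t)) (prim_coproduct F') z"
  unfolding series_deriv_def
proof
  fix m
  obtain S c where "finite S" "\<And>f. scoeff (prim_coproduct f) m = (\<Sum>w\<in>S. scoeff f w * c w)"
    using scoeff_prim_coproduct_finite by metis
  then show "((\<lambda>t. scoeff (prim_coproduct (F t)) m) has_vector_derivative scoeff (prim_coproduct F') m) (at z)"
    using assms by (auto simp: series_deriv_def intro!: has_vector_derivative_sum has_vector_derivative_mult_left)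
qed

lemma series_tendsto_prim_coproduct:
  assumes "series_tendsto F L A"
  shows "series_tendsto (\<lambda>t. prim_coproduct (F t)) (prim_coproduct L) A"
  unfolding series_tendsto_def
proof
  fix m
  obtain S c where "finite S" "\<And>f. scoeff (prim_coproduct f) m = (\<Sum>w\<in>S. scoeff f w * c w)"
    using scoeff_prim_coproduct_finite by metis
  then show "((\<lambda>t. scoeff (prim_coproduct (F t)) m) \<longlongrightarrow> scoeff (prim_coproduct L) m) A"
    using assms by (auto simp: series_tendsto_def intro!: tendsto_intros)
qed

lemma series_tendsto_mult:
  fixes F G :: "'a \<Rightarrow> 'm::word_monoid series"
  assumes "series_tendsto F L A" "series_tendsto G M A"
  shows "series_tendsto (\<lambda>t. F t * G t) (L * M) A"
  using assms unfolding series_tendsto_def scoeff_mult case_prod_unfold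
  by (auto intro!: tendsto_intros)

lemma series_tendsto_tensor:
  assumes "series_tendsto F L A" "series_tendsto G M A"
  shows "series_tendsto (\<lambda>t. tensor (F t) (G t)) (tensor L M) A"
  using assms unfolding series_tendsto_def by (auto intro!: tendsto_intros)

lemma series_tendsto_diff:
  fixes F G :: "'a \<Rightarrow> 'm::word_monoid series"
  assumes "series_tendsto F L A" "series_tendsto G M A"
  shows "series_tendsto (\<lambda>t. F t - G t) (L - M) A"
  using assms unfolding series_tendsto_def by (auto intro!: tendsto_intros)

lemma prim_coproduct_scale: "prim_coproduct (series_scale c f) = series_scale c (prim_coproduct f)"
proof -
  have "prim_coproduct 0 = 0"
    using prim_coproduct_linear[of "-1" 0 0] by (simp add: series_scale_minus1)
  then show ?thesis using prim_coproduct_linear[of c f 0] by simp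
qed

lemma tensor_add_left: "tensor (f + g) h = tensor f h + tensor g h"
  by (rule series_eqI) (simp add: algebra_simps)

lemma tensor_scale_left:
  fixes f :: "'m::word_monoid series" and h :: "'n::word_monoid series"
  shows "tensor (series_scale c f) h = series_scale c (tensor f h)"
  by (rule series_eqI) simp

lemma tensor_scale_right:
  fixes f :: "'m::word_monoid series" and h :: "'n::word_monoid series"
  shows "tensor h (series_scale c f) = series_scale c (tensor h f)"
  by (rule series_eqI) simp

lemma tensor_add_right: "tensor h (f + g) = tensor h f + tensor h g"
  by (rule series_eqI) (simp add: algebra_simps)

lemma KZ_eq_prim_coproduct:
  assumes "KZ_eq E F G"
  shows "KZ_eq (prim_coproduct E) (prim_coproduct F) (\<lambda>t. prim_coproduct (G t))"
  unfolding KZ_eq_def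
proof
  fix z :: real assume "z \<in> {0<..<1}"
  from series_deriv_prim_coproduct[OF bspec[OF assms[unfolded KZ_eq_def] this]]
  show "series_deriv (\<lambda>t. prim_coproduct (G t)) ((series_scale (of_real (1 / z)) (prim_coproduct E) +
      series_scale (of_real (1 / (z - 1))) (prim_coproduct F)) * prim_coproduct (G z)) z"
    by (simp only: prim_coproduct_mult prim_coproduct_linear prim_coproduct_scale)
qed

lemma KZ_eq_tensor:
  fixes G :: "real \<Rightarrow> 'm::word_monoid series"
  assumes "KZ_eq E F G"
  shows "KZ_eq (tensor E 1 + tensor 1 E) (tensor F 1 + tensor 1 F) (\<lambda>t. tensor (G t) (G t))"
  unfolding KZ_eq_def
proof
  fix z :: real assume z: "z \<in> {0<..<1}"
  let ?a = "of_real (1 / z)" and ?b = "of_real (1 / (z - 1))"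
  let ?\<Omega> = "series_scale ?a E + series_scale ?b F"
  have "series_scale ?a (tensor E 1 + tensor 1 E) + series_scale ?b (tensor F 1 + tensor 1 F) =
      tensor 1 ?\<Omega> + tensor ?\<Omega> 1"
    by (simp add: series_scale_add tensor_add_left tensor_add_right tensor_scale_left tensor_scale_right)
  then have "(series_scale ?a (tensor E 1 + tensor 1 E) + series_scale ?b (tensor F 1 + tensor 1 F)) *
      tensor (G z) (G z) = tensor (G z) (?\<Omega> * G z) + tensor (?\<Omega> * G z) (G z)"
    by (simp add: distrib_right tensor_mult)
  with series_deriv_tensor[OF bspec[OF assms[unfolded KZ_eq_def] z] bspec[OF assms[unfolded KZ_eq_def] z]]
  show "series_deriv (\<lambda>t. tensor (G t) (G t)) ((series_scale ?a (tensor E 1 + tensor 1 E) +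
      series_scale ?b (tensor F 1 + tensor 1 F)) * tensor (G z) (G z)) z"
    by simp
qed

text \<open>The difference of the two solutions in the tensor square loses their common
  normalization 1 and so has the limit 0 that uniqueness asks for. \<open>E\<close> and
  \<open>F\<close> stay general so that \<open>G1\<close> is covered by reflection, with
  \<open>e1\<close> in the role of \<open>E\<close>.\<close>

lemma KZ_normalized_group_like:
  fixes E F :: nc_series
  assumes G: "KZ_eq E F G" and E0: "scoeff E wone = 0" and F0: "scoeff F wone = 0"
    and E: "prim_coproduct E = tensor E 1 + tensor 1 E" and F: "prim_coproduct F = tensor F 1 + tensor 1 F"
    and lim: "series_tendsto (\<lambda>z. G z * rpow z (- E)) 1 (at_right 0)" and z: "z \<in> {0<..<1}"
  shows "prim_coproduct (G z) = tensor (G z) (G z)"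
proof -
  have E0': "scoeff (- E) wone = 0" using E0 by simp
  have \<Delta>E: "prim_coproduct (- E) = tensor (- E) 1 + tensor 1 (- E)"
    using prim_coproduct_scale[of "-1" E]
    by (simp add: E tensor_scale_left tensor_scale_right series_scale_add flip: series_scale_minus1)
  then have \<Delta>E': "- (tensor E 1 + tensor 1 E) = tensor (- E) 1 + tensor 1 (- E)"
    by (simp add: tensor_scale_left tensor_scale_right series_scale_add flip: series_scale_minus1)
  have "prim_coproduct (G z * rpow z (- E)) =
      prim_coproduct (G z) * rpow z (- (tensor E 1 + tensor 1 E))" for z
    unfolding prim_coproduct_mult prim_coproduct_fps_subst[OF E0'] \<Delta>E \<Delta>E' ..
  with series_tendsto_prim_coproduct[OF lim]
  have 1: "series_tendsto (\<lambda>z. prim_coproduct (G z) * rpow z (- (tensor E 1 + tensor 1 E))) 1 (at_right 0)"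
    by (simp add: prim_coproduct_1)
  have "tensor (G z * rpow z (- E)) (G z * rpow z (- E)) =
      tensor (G z) (G z) * rpow z (- (tensor E 1 + tensor 1 E))" for z
    unfolding tensor_mult[symmetric] \<Delta>E' fps_subst_exp_primitive[OF E0'] ..
  with series_tendsto_tensor[OF lim lim]
  have 2: "series_tendsto (\<lambda>z. tensor (G z) (G z) * rpow z (- (tensor E 1 + tensor 1 E))) 1 (at_right 0)"
    by (simp add: tensor_1_1)
  have 3: "KZ_eq (tensor E 1 + tensor 1 E) (tensor F 1 + tensor 1 F)
      (\<lambda>t. prim_coproduct (G t) - tensor (G t) (G t))"
    by (intro KZ_eq_diff KZ_eq_tensor G) (use KZ_eq_prim_coproduct[OF G] in \<open>simp add: E F\<close>)
  have 4: "series_tendsto (\<lambda>z. (prim_coproduct (G z) - tensor (G z) (G z)) *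
      rpow z (- (tensor E 1 + tensor 1 E))) 0 (at_right 0)"
    using series_tendsto_diff[OF 1 2] by (simp add: left_diff_distrib)
  have "prim_coproduct (G z) - tensor (G z) (G z) = 0"
    by (rule KZ_eq_asymptotic_unique[OF 3 _ _ 4 z]) (use E0 F0 in simp_all)
  then show ?thesis by simp
qed

section \<open>Inverses and the comparison of two solutions\<close>

lemma series_inverse_unique:
  assumes "f * g = 1" "g * f = 1"
  shows "series_inverse f = (g :: 'm::word_monoid series)"
  unfolding series_inverse_def
proof (rule the_equality)
  fix h assume "f * h = 1 \<and> h * f = 1"
  then show "h = g" using assms by (metis mult.assoc mult_1_left mult_1_right)
qed (use assms in simp)

lemma series_inverse:
  fixes f :: "'m::word_monoid series"
  assumes f: "scoeff f wone = 1"
  shows "f * series_inverse f = 1" "series_inverse f * f = 1"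
proof -
  define x where "x = f - 1"
  have x: "scoeff x wone = 0" "f = fps_subst (1 + fps_X) x"
    using f by (simp_all add: x_def fps_subst_add)
  define g where "g = fps_subst (inverse (1 + fps_X)) x"
  have "(1 + fps_X) * inverse (1 + fps_X) = (1 :: complex fps)"
    by (rule inverse_mult_eq_1') simp
  then have "f * g = 1" "g * f = 1"
    unfolding g_def using x by (simp_all add: mult.commute flip: fps_subst_mult)
  then show "f * series_inverse f = 1" "series_inverse f * f = 1"
    by (simp_all add: series_inverse_unique)
qed

lemma e_wone [simp]: "scoeff e0 wone = 0" "scoeff e1 wone = 0"
  by (simp_all add: e0_def e1_def wone_list_def)

lemma prim_coproduct_e: "prim_coproduct e0 = tensor e0 1 + tensor 1 e0" "prim_coproduct e1 = tensor e1 1 + tensor 1 e1"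
  by (simp_all add: e0_def e1_def prim_coproduct_letter)

lemma word_monom_power: "word_monom [x] ^ n = word_monom (replicate n x)"
proof (induction n)
  case 0
  show ?case by (rule series_eqI) (simp add: wone_list_def)
qed (simp add: word_monom_mult wcat_list_def)

lemma scoeff_fps_subst_letter:
  "scoeff (fps_subst F (series_scale c (word_monom [x]))) w =
     (if w = replicate (length w) x then c ^ length w * fps_nth F (length w) else 0)"
proof -
  have 0: "scoeff (series_scale c (word_monom [x])) wone = 0" by (simp add: wone_list_def)
  have "scoeff (fps_subst F (series_scale c (word_monom [x]))) w =
      (\<Sum>n\<le>length w. fps_nth F n * (c ^ n * (if w = replicate n x then 1 else 0)))"
    by (simp add: scoeff_fps_subst[OF 0, of w "length w"] wdeg_list_def series_scale_power word_monom_power)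
  also have "\<dots> = (\<Sum>n\<in>{length w}. fps_nth F n * (c ^ n * (if w = replicate n x then 1 else 0)))"
    by (rule sum.mono_neutral_right) auto
  finally show ?thesis by simp
qed

lemma scoeff_letter_mult:
  "scoeff (word_monom [x] * f) (y # w) = (if x = y then scoeff f w else 0)"
  "scoeff (word_monom [x] * f) [] = 0"
proof -
  have "scoeff (word_monom [x] * f) (y # w) =
      (\<Sum>(a, b)\<in>(if x = y then {([x], w)} else {}). scoeff (word_monom [x]) a * scoeff f b)"
    unfolding scoeff_mult
    by (rule sum.mono_neutral_right, rule finite_factorizations) (auto simp: wcat_list_def split: if_splits)
  then show "scoeff (word_monom [x] * f) (y # w) = (if x = y then scoeff f w else 0)" by simp
  show "scoeff (word_monom [x] * f) [] = 0"
    using scoeff_mult_wone[of "word_monom [x]" f] by (simp add: wone_list_def)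
qed

lemma KZ_normalized_wone:
  fixes G :: "real \<Rightarrow> 'm::word_monoid series"
  assumes G: "KZ_eq E F G" and E: "scoeff E wone = 0" and F: "scoeff F wone = 0"
    and lim: "series_tendsto (\<lambda>z. G z * rpow z (- E)) 1 (at_right 0)" and z: "z \<in> {0<..<1}"
  shows "scoeff (G z) wone = 1"
proof -
  have D: "((\<lambda>t. scoeff (G t) wone) has_vector_derivative 0) (at t)" if t: "t \<in> {0<..<1}" for t
  proof -
    have eq: "scoeff ((series_scale (of_real (1 / t)) E + series_scale (of_real (1 / (t - 1))) F) * G t) wone = 0"
      by (simp add: E F)
    show ?thesis
      using bspec[OF G[unfolded KZ_eq_def series_deriv_def] t, THEN spec, of wone] unfolding eq .
  qed
  have const: "scoeff (G t) wone = scoeff (G z) wone" if "t \<in> {0<..<1}" for t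
    by (rule zero_derivative_constant[OF D that z])
  have "((\<lambda>t. scoeff (G t) wone) \<longlongrightarrow> scoeff (G z) wone) (at_right 0)"
    by (rule tendsto_eventually, rule eventually_mono[OF eventually_at_right_0_1 const])
  moreover have "scoeff (- E) wone = 0" using E by simp
  then have "((\<lambda>t. scoeff (G t) wone) \<longlongrightarrow> 1) (at_right 0)"
    using lim[unfolded series_tendsto_def, THEN spec, of wone] by simp
  ultimately show ?thesis
    using tendsto_unique trivial_limit_at_right_real by blast
qed

text \<open>A constant right factor preserves the equation, and the two sides agree at
  \<open>z\<close>. This also shows that the associator does not depend on the base point.\<close>

lemma KZ_eq_connection:
  fixes G0 G1 :: "real \<Rightarrow> 'm::word_monoid series"
  assumes G0: "KZ_eq E F G0" and G1: "KZ_eq E F G1" and E: "scoeff E wone = 0" and F: "scoeff F wone = 0"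
    and one: "scoeff (G1 z) wone = 1" and z: "z \<in> {0<..<1}" and t: "t \<in> {0<..<1}"
  shows "G0 t = G1 t * (series_inverse (G1 z) * G0 z)"
proof -
  have "G1 z * (series_inverse (G1 z) * G0 z) - G0 z = 0"
    using series_inverse(1)[OF one] by (simp flip: mult.assoc)
  then have "G1 t * (series_inverse (G1 z) * G0 z) - G0 t = 0"
    by (intro KZ_eq_initial_unique[OF KZ_eq_diff[OF KZ_eq_mult_right[OF G1] G0] E F z _ t])
  then show ?thesis by simp
qed

section \<open>Asymptotics of normalized solutions\<close>

text \<open>Named after the functions it serves, polynomials in \<open>ln t\<close>; the condition
  itself is just what a factor of size O(t) needs to force the product to 0.\<close>

definition log_growth :: "(real \<Rightarrow> complex) \<Rightarrow> bool" where
  "log_growth f \<longleftrightarrow> ((\<lambda>t. of_real t * f t) \<longlongrightarrow> 0) (at_right 0)"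

lemma log_growth_cmult_ln: "log_growth (\<lambda>t. c * of_real (ln t) ^ n)"
proof -
  have "((\<lambda>t::real. t * ln t ^ n) \<longlongrightarrow> 0) (at_right 0)"
  proof -
    \<comment> \<open>With x = -ln t the claim is the decay of x^n / exp x at infinity.\<close>
    have "((\<lambda>x::real. (- 1) ^ n * (x ^ n / exp x)) \<longlongrightarrow> (- 1) ^ n * 0) at_top"
      by (intro tendsto_mult tendsto_const tendsto_power_div_exp_0)
    moreover have "filterlim (\<lambda>t::real. - ln t) at_top (at_right 0)"
      using ln_at_0 by (simp add: filterlim_uminus_at_bot)
    ultimately have "((\<lambda>t::real. (- 1) ^ n * ((- ln t) ^ n / exp (- ln t))) \<longlongrightarrow> (- 1) ^ n * 0) (at_right 0)"
      by (rule filterlim_compose)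
    then have "((\<lambda>t::real. (- 1) ^ n * ((- ln t) ^ n / exp (- ln t))) \<longlongrightarrow> 0) (at_right 0)"
      by simp
    moreover have "eventually (\<lambda>t::real. (- 1) ^ n * ((- ln t) ^ n / exp (- ln t)) = t * ln t ^ n) (at_right 0)"
      using eventually_at_right_less[of 0]
    proof eventually_elim
      case (elim t)
      then show ?case by (simp add: exp_minus field_simps flip: power_mult_distrib)
    qed
    ultimately show ?thesis by (rule Lim_transform_eventually)
  qed
  then have "((\<lambda>t::real. c * of_real (t * ln t ^ n)) \<longlongrightarrow> c * of_real 0) (at_right 0)"
    by (intro tendsto_intros)
  then show ?thesis by (simp add: log_growth_def mult_ac)
qed

lemma log_growth_cmult: "log_growth f \<Longrightarrow> log_growth (\<lambda>t. f t * c)"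
  unfolding log_growth_def using tendsto_mult_left_zero[of _ _ c] by (auto simp: mult_ac)

lemma log_growth_sum: "(\<And>i. i \<in> I \<Longrightarrow> log_growth (f i)) \<Longrightarrow> log_growth (\<lambda>t. \<Sum>i\<in>I. f i t)"
  unfolding log_growth_def sum_distrib_left by (rule tendsto_null_sum)

lemma lin_small_log_growth_tendsto:
  assumes "lin_small f" "log_growth g"
  shows "((\<lambda>t. f t * g t) \<longlongrightarrow> 0) (at_right 0)"
proof -
  from assms(1) obtain K where "eventually (\<lambda>t. norm (f t) \<le> K * t) (at_right 0)"
    by (auto simp: lin_small_def)
  then have "eventually (\<lambda>t. norm (f t * g t) \<le> norm (of_real t * g t) * K) (at_right 0)"
    using eventually_at_right_less[of 0]
  proof eventually_elim
    case (elim t)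
    then have "norm (f t) * norm (g t) \<le> K * t * norm (g t)" by (intro mult_right_mono) auto
    with elim show ?case by (simp add: norm_mult mult_ac)
  qed
  with assms(2) show ?thesis
    unfolding log_growth_def by (rule Lim_null_comparison[rotated, OF tendsto_mult_left_zero[OF tendsto_norm_zero]])
qed

lemma log_growth_rpow_mult:
  fixes E :: "'m::word_monoid series"
  assumes E: "scoeff E wone = 0"
  shows "log_growth (\<lambda>t. scoeff (rpow t E * A) m)"
  unfolding scoeff_mult case_prod_unfold scoeff_fps_subst[OF E order.refl]
  by (intro log_growth_sum log_growth_cmult)
     (use log_growth_cmult_ln[of "1 / fact _"] in simp)

text \<open>The difference is \<open>S t * (rpow t F * A)\<close>, where the coefficients of
  \<open>S\<close> are O(t) by \<open>KZ_normalized_rate\<close>, while those of the other factor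
  grow only like powers of the logarithm.\<close>

lemma KZ_asymptotics_1:
  fixes G0 G1 :: "real \<Rightarrow> 'm::word_monoid series"
  assumes G1: "KZ_eq E F G1" and E: "scoeff E wone = 0" and F: "scoeff F wone = 0"
    and lim: "series_tendsto (\<lambda>t. G1 (1 - t) * rpow t (- F)) 1 (at_right 0)"
    and A: "\<And>t. t \<in> {0<..<1} \<Longrightarrow> G0 t = G1 t * A"
  shows "((\<lambda>t. scoeff (G0 (1 - t)) m - scoeff (rpow t F * A) m) \<longlongrightarrow> 0) (at_right 0)"
proof -
  define S where "S = (\<lambda>t. G1 (1 - t) * rpow t (- F) - 1)"
  have "((\<lambda>t. scoeff (S t * (rpow t F * A)) m) \<longlongrightarrow> 0) (at_right 0)"
    unfolding scoeff_mult[of "S _"] case_prod_unfold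
    by (intro tendsto_null_sum lin_small_log_growth_tendsto log_growth_rpow_mult F)
       (simp add: S_def KZ_normalized_rate[OF KZ_eq_reflect[OF G1] F E lim] del: scoeff_simps)
  moreover have "eventually (\<lambda>t. scoeff (S t * (rpow t F * A)) m =
      scoeff (G0 (1 - t)) m - scoeff (rpow t F * A) m) (at_right 0)"
    using eventually_at_right_0_1
  proof eventually_elim
    case (elim t)
    have "G1 (1 - t) * rpow t (- F) * (rpow t F * A) = G1 (1 - t) * ((rpow t (- F) * rpow t F) * A)"
      by (simp only: mult.assoc)
    also have "\<dots> = G0 (1 - t)"
      using A[of "1 - t"] elim by (simp add: rpow_inverse F)
    finally show ?case by (simp add: S_def left_diff_distrib)
  qed
  ultimately show ?thesis by (rule Lim_transform_eventually)
qed

text \<open>Every word in \<open>rpow t (- e0)\<close> is a power of \<open>E0\<close>, and such a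
  word is a suffix of an element of \<open>W_words\<close> only if it is empty. The regularizing
  factor is therefore invisible on these coefficients.\<close>

lemma KZ_asymptotics_0:
  assumes lim: "series_tendsto (\<lambda>t. G t * rpow t (- e0)) 1 (at_right 0)" and w: "w \<in> W_words"
  shows "((\<lambda>t. scoeff (G t) w) \<longlongrightarrow> scoeff 1 w) (at_right 0)"
proof -
  have "scoeff (G t * rpow t (- e0)) w = scoeff (G t) w" for t
  proof -
    have e0: "- e0 = series_scale (- 1) (word_monom [E0])"
      by (simp add: e0_def series_scale_minus1)
    have nil: "b = []" if "scoeff (rpow t (- e0)) b \<noteq> 0" "a @ b = w" for a b
    proof (rule ccontr)
      assume "b \<noteq> []"
      with w that(2) have "last b = E1" by (auto simp: W_words_def)
      moreover have "b = replicate (length b) E0"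
        using that(1) unfolding e0 scoeff_fps_subst_letter by (auto split: if_splits)
      then have "last b = E0" using \<open>b \<noteq> []\<close> by (metis last_in_set in_set_replicate)
      ultimately show False by simp
    qed
    have "scoeff (G t * rpow t (- e0)) w = (\<Sum>(a, b)\<in>{(w, [])}. scoeff (G t) a * scoeff (rpow t (- e0)) b)"
      unfolding scoeff_mult
      by (rule sum.mono_neutral_right, rule finite_factorizations) (use nil in \<open>auto simp: wcat_list_def\<close>)
    moreover have "scoeff (rpow t (- e0)) [] = 1"
      unfolding e0 scoeff_fps_subst_letter by simp
    ultimately show ?thesis by simp
  qed
  then show ?thesis using spec[OF lim[unfolded series_tendsto_def], of w] by (simp only:)
qed

section \<open>Multiple polylogarithms and harmonic sums\<close>

text \<open>
  Division by zero gives the intended value 0 at \<open>n = 0\<close>. The signs are those of the coefficients of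
  the normalized KZ solution, so \<open>polylog\<close> of the word of \<open>Y_gen n\<close> is \<open>- Li\<^sub>n\<close>.
\<close>

fun polylog_coeff :: "letter list \<Rightarrow> nat \<Rightarrow> complex" where
  "polylog_coeff [] n = (if n = 0 then 1 else 0)"
| "polylog_coeff (E0 # w) n = polylog_coeff w n / of_nat n"
| "polylog_coeff (E1 # w) n = - (\<Sum>k<n. polylog_coeff w k) / of_nat n"

definition harm_sum :: "letter list \<Rightarrow> nat \<Rightarrow> complex" where
  "harm_sum w n = (\<Sum>k\<le>n. polylog_coeff w k)"

definition polylog :: "letter list \<Rightarrow> complex \<Rightarrow> complex" where
  "polylog w x = (\<Sum>n. polylog_coeff w n * x ^ n)"

lemma polylog_coeff_0: "w \<noteq> [] \<Longrightarrow> polylog_coeff w 0 = 0"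
proof (cases w)
  case (Cons x v)
  then show ?thesis by (cases x) simp_all
qed simp

lemma norm_polylog_coeff_le: "norm (polylog_coeff w n) \<le> 1"
proof (induction w n rule: polylog_coeff.induct)
  case (2 w n)
  then show ?case
    by (cases n) (auto simp: norm_divide divide_le_eq simp del: of_nat_Suc intro: order.trans)
next
  case (3 w n)
  have "norm (\<Sum>k<n. polylog_coeff w k) \<le> (\<Sum>k<n. 1)"
    by (rule sum_norm_le) (use 3 in auto)
  then show ?case
    unfolding polylog_coeff.simps norm_divide norm_minus_cancel norm_of_nat
    by (auto simp: divide_le_eq)
qed simp

lemma summable_polylog: "norm x < 1 \<Longrightarrow> summable (\<lambda>n. polylog_coeff w n * x ^ n)"
proof (rule summable_comparison_test)
  assume "norm x < 1"
  then show "summable (\<lambda>n. norm x ^ n)" by (intro summable_geometric) simp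
  show "\<exists>N. \<forall>n\<ge>N. norm (polylog_coeff w n * x ^ n) \<le> norm x ^ n"
    using norm_polylog_coeff_le by (auto simp: norm_mult norm_power mult_left_le_one_le)
qed

lemma polylog_has_derivative:
  assumes "norm x < 1"
  shows "(polylog w has_field_derivative (\<Sum>n. diffs (polylog_coeff w) n * x ^ n)) (at x)"
proof -
  define K where "K = (1 + norm x) / 2"
  have K: "norm x < K" "K < 1" "0 \<le> K" using assms by (auto simp: K_def)
  have "summable (\<lambda>n. polylog_coeff w n * of_real K ^ n)"
    using K by (intro summable_polylog) simp
  then have "DERIV (\<lambda>x. \<Sum>n. polylog_coeff w n * x ^ n) x :> (\<Sum>n. diffs (polylog_coeff w) n * x ^ n)"
    by (rule termdiffs_strong) (use K in simp)
  then show ?thesis unfolding polylog_def[abs_def] .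
qed

lemma norm_harm_sum_le: "norm (harm_sum w n) \<le> real n + 1"
proof -
  have "norm (harm_sum w n) \<le> (\<Sum>k\<le>n. 1)"
    unfolding harm_sum_def by (rule sum_norm_le) (rule norm_polylog_coeff_le)
  then show ?thesis by simp
qed

lemma summable_linear_geometric:
  assumes "norm (x :: complex) < 1" "\<And>n. norm (f n) \<le> c * (real n + 1)"
  shows "summable (\<lambda>n. f n * x ^ n)"
proof (rule summable_comparison_test)
  have "summable (\<lambda>n. c * (real n + 1) * norm x ^ n)"
    using summable_mult[OF geometric_deriv_sums[THEN sums_summable, of "norm x"], of c] assms(1)
    by (simp add: mult_ac add_ac)
  then show "summable (\<lambda>n. c * (real n + 1) * norm x ^ n)" .
  show "\<exists>N. \<forall>n\<ge>N. norm (f n * x ^ n) \<le> c * (real n + 1) * norm x ^ n"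
    using assms(2) by (auto simp: norm_mult norm_power intro!: mult_right_mono)
qed

text \<open>Multiplying a generating function by \<open>1 - x\<close> undoes the passage from
  coefficients to partial sums.\<close>

lemma polylog_eq_harm_sum:
  assumes "norm x < 1"
  shows "polylog w x = (1 - x) * (\<Sum>n. harm_sum w n * x ^ n)"
proof -
  let ?h = "\<lambda>n. harm_sum w n * x ^ n"
  have s: "summable ?h"
    by (rule summable_linear_geometric[where c = 1]) (use assms norm_harm_sum_le in auto)
  have s': "summable (\<lambda>n. harm_sum w n * x ^ Suc n)"
    using summable_mult[OF s, of x] by (simp add: mult_ac)
  have s'': "summable (\<lambda>n. harm_sum w (Suc n) * x ^ Suc n)"
    using s by (subst (asm) summable_Suc_iff[symmetric])
  have "(1 - x) * suminf ?h = suminf ?h - (\<Sum>n. harm_sum w n * x ^ Suc n)"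
    using suminf_mult[OF s, of x] by (simp add: left_diff_distrib mult_ac)
  moreover have "suminf ?h = harm_sum w 0 + (\<Sum>n. harm_sum w (Suc n) * x ^ Suc n)"
    using suminf_split_head[OF s] by simp
  moreover have "(\<Sum>n. harm_sum w (Suc n) * x ^ Suc n) - (\<Sum>n. harm_sum w n * x ^ Suc n) =
      (\<Sum>n. polylog_coeff w (Suc n) * x ^ Suc n)"
    using suminf_diff[OF s'' s'] by (simp add: harm_sum_def algebra_simps)
  moreover have "polylog w x = harm_sum w 0 + (\<Sum>n. polylog_coeff w (Suc n) * x ^ Suc n)"
    using suminf_split_head[OF summable_polylog[OF assms, of w]] by (simp add: polylog_def harm_sum_def)
  ultimately show ?thesis by (simp add: algebra_simps)
qed

lemma polylog_Nil: "polylog [] x = 1"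
proof -
  have "(\<lambda>n. polylog_coeff [] n * x ^ n) sums (\<Sum>n\<in>{0}. polylog_coeff [] n * x ^ n)"
    by (rule sums_finite) auto
  then show ?thesis by (simp add: polylog_def sums_iff)
qed

text \<open>A nonempty word has no constant term, so its series may be divided by \<open>x\<close>;
  for the empty word the integral would be a logarithm.\<close>

lemma polylog_E0_has_derivative:
  assumes x: "norm x < 1" "x \<noteq> 0" and w: "w \<noteq> []"
  shows "(polylog (E0 # w) has_field_derivative polylog w x / x) (at x)"
proof -
  have "(\<Sum>n. polylog_coeff w (Suc n) * x ^ Suc n) = polylog w x"
    using suminf_split_head[OF summable_polylog[OF x(1), of w]] w
    by (simp add: polylog_def polylog_coeff_0)
  moreover have "diffs (polylog_coeff (E0 # w)) n * x ^ n = polylog_coeff w (Suc n) * x ^ Suc n / x" for n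
    using x by (simp add: diffs_def field_simps del: of_nat_Suc)
  moreover have "summable (\<lambda>n. polylog_coeff w (Suc n) * x ^ Suc n)"
    using summable_polylog[OF x(1), of w] by (subst (asm) summable_Suc_iff[symmetric])
  ultimately show ?thesis
    using polylog_has_derivative[OF x(1), of "E0 # w"] by (simp only: suminf_divide)
qed

text \<open>Differentiation cancels the denominator and leaves minus the harmonic sums of
  \<open>w\<close>, whose generating function is \<open>polylog w x / (1 - x)\<close>.\<close>

lemma polylog_E1_has_derivative:
  assumes x: "norm x < 1"
  shows "(polylog (E1 # w) has_field_derivative polylog w x / (x - 1)) (at x)"
proof -
  have "x \<noteq> 1" using x by auto
  have "diffs (polylog_coeff (E1 # w)) n * x ^ n = - (harm_sum w n * x ^ n)" for n
    by (simp add: diffs_def harm_sum_def lessThan_Suc_atMost del: of_nat_Suc)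
  moreover have "summable (\<lambda>n. harm_sum w n * x ^ n)"
    by (rule summable_linear_geometric[where c = 1]) (use x norm_harm_sum_le in auto)
  ultimately have "(\<Sum>n. diffs (polylog_coeff (E1 # w)) n * x ^ n) = - (\<Sum>n. harm_sum w n * x ^ n)"
    by (simp only: suminf_minus)
  also have "\<dots> = polylog w x / (x - 1)"
    using \<open>x \<noteq> 1\<close> by (simp add: polylog_eq_harm_sum[OF x] divide_simps) (simp add: algebra_simps)
  finally show ?thesis using polylog_has_derivative[OF x, of "E1 # w"] by simp
qed

lemma polylog_tendsto_0: "((\<lambda>t. polylog w (of_real t)) \<longlongrightarrow> (if w = [] then 1 else 0)) (at_right 0)"
proof -
  have "isCont (polylog w) (of_real 0)"
    using polylog_has_derivative[of 0 w] by (intro DERIV_isCont) simp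
  then have "isCont (\<lambda>t::real. polylog w (of_real t)) 0"
    by (rule isCont_o2[where g = "polylog w" and f = of_real, rotated]) simp
  then have "((\<lambda>t::real. polylog w (of_real t)) \<longlongrightarrow> polylog w 0) (at_right 0)"
    unfolding isCont_def of_real_0 by (rule tendsto_within_subset) simp
  moreover have "polylog w 0 = (if w = [] then 1 else 0)"
    unfolding polylog_def powser_zero by (simp add: polylog_coeff_0)
  ultimately show ?thesis by simp
qed

text \<open>Stripping the first letter, both sides have the same derivative by the induction
  hypothesis and the same limit at 0. On \<open>W_words\<close> that limit exists without
  regularization, by \<open>KZ_asymptotics_0\<close>.\<close>

lemma KZ_solution_polylog:
  assumes G: "KZ_eq e0 e1 G"
    and lim: "series_tendsto (\<lambda>t. G t * rpow t (- e0)) 1 (at_right 0)"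
  shows "w \<in> W_words \<Longrightarrow> z \<in> {0<..<1} \<Longrightarrow> scoeff (G z) w = polylog w (of_real z)"
proof (induction w arbitrary: z)
  case Nil
  show ?case
    using KZ_normalized_wone[OF G e_wone lim Nil(2)] unfolding polylog_Nil wone_list_def .
next
  case (Cons x w)
  have w: "w \<in> W_words" using W_words_suffix[of "[x]" w] Cons.prems(1) by simp
  define f where "f = (\<lambda>t. scoeff (G t) (x # w) - polylog (x # w) (of_real t))"
  have D: "(f has_vector_derivative 0) (at t)" if t: "t \<in> {0<..<1}" for t
  proof -
    have GD: "((\<lambda>t. scoeff (G t) (x # w)) has_vector_derivative
        scoeff ((series_scale (of_real (1 / t)) e0 + series_scale (of_real (1 / (t - 1))) e1) * G t) (x # w)) (at t)"
      using bspec[OF G[unfolded KZ_eq_def series_deriv_def] t, THEN spec, of "x # w"] .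
    have nt: "norm (of_real t :: complex) < 1" "(of_real t :: complex) \<noteq> 0" using t by auto
    have IH: "scoeff (G t) w = polylog w (of_real t)" using Cons.IH[OF w t] .
    have "((\<lambda>t. polylog (x # w) (of_real t)) has_vector_derivative
        scoeff ((series_scale (of_real (1 / t)) e0 + series_scale (of_real (1 / (t - 1))) e1) * G t) (x # w)) (at t)"
    proof (cases x)
      case E0
      then have "w \<noteq> []" using Cons.prems(1) by (auto simp: W_words_def)
      have "scoeff ((series_scale (of_real (1 / t)) e0 + series_scale (of_real (1 / (t - 1))) e1) * G t) (x # w) =
          polylog w (of_real t) / of_real t"
        using E0 by (simp add: distrib_right series_scale_mult_left e0_def e1_def scoeff_letter_mult IH)
      then show ?thesis
        using has_vector_derivative_real_field[OF polylog_E0_has_derivative[OF nt \<open>w \<noteq> []\<close>]] E0 by (simp only:)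
    next
      case E1
      have "scoeff ((series_scale (of_real (1 / t)) e0 + series_scale (of_real (1 / (t - 1))) e1) * G t) (x # w) =
          polylog w (of_real t) / (of_real t - 1)"
        using E1 by (simp add: distrib_right series_scale_mult_left e0_def e1_def scoeff_letter_mult IH)
      then show ?thesis
        using has_vector_derivative_real_field[OF polylog_E1_has_derivative[OF nt(1), of w]] E1 by (simp only:)
    qed
    from has_vector_derivative_diff[OF GD this] show ?thesis unfolding f_def by (simp only: diff_self)
  qed
  have const: "f t = f z" if "t \<in> {0<..<1}" for t
    by (rule zero_derivative_constant[OF D that Cons.prems(2)])
  have "(f \<longlongrightarrow> f z) (at_right 0)"
    by (rule tendsto_eventually, rule eventually_mono[OF eventually_at_right_0_1 const])
  moreover have "(f \<longlongrightarrow> 0 - 0) (at_right 0)"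
    unfolding f_def
    using KZ_asymptotics_0[OF lim Cons.prems(1)] polylog_tendsto_0[of "x # w"]
    by (intro tendsto_diff) (simp_all only: scoeff_simps wone_list_def if_False list.simps)
  ultimately have "f z = 0 - 0" by (rule tendsto_unique[OF trivial_limit_at_right_real])
  then show ?case by (simp add: f_def)
qed

section \<open>The generating series of truncated harmonic sums\<close>

definition harm_series :: "nat \<Rightarrow> nc_series" where
  "harm_series n = Series (\<lambda>w. harm_sum w n)"

lemma scoeff_harm_series [simp]: "scoeff (harm_series n) w = harm_sum w n"
  by (simp add: harm_series_def)

lemma harm_sum_0: "harm_sum w 0 = (if w = [] then 1 else 0)"
  by (simp add: harm_sum_def polylog_coeff_0)

lemma harm_sum_Nil [simp]: "harm_sum [] n = 1"
proof -
  have "harm_sum [] n = (\<Sum>k\<in>{0}. polylog_coeff [] k)"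
    unfolding harm_sum_def by (rule sum.mono_neutral_right) auto
  then show ?thesis by simp
qed

lemma harm_sum_Suc: "harm_sum w (Suc n) = harm_sum w n + polylog_coeff w (Suc n)"
  by (simp add: harm_sum_def)

lemma polylog_coeff_not_W: "w \<notin> W_words \<Longrightarrow> polylog_coeff w n = 0"
proof (induction w arbitrary: n)
  case (Cons x w)
  show ?case
  proof (cases "w = []")
    case True
    with Cons.prems have "x = E0" by (cases x) (auto simp: W_words_def)
    with True show ?thesis by simp
  next
    case False
    then have "w \<notin> W_words" using Cons.prems by (auto simp: W_words_def)
    then show ?thesis by (cases x) (simp_all add: Cons.IH)
  qed
qed (simp add: W_words_def)

lemma harm_series_W_alg: "harm_series n \<in> W_alg"
  by (simp add: W_alg_def harm_sum_def polylog_coeff_not_W)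

text \<open>The sum of \<open>Y_gen n\<close> weighted by \<open>t ^ n\<close>, given
  coefficientwise because a word occurs in no \<open>Y_gen n\<close> other than that of its own
  length. At t = 1/m it is the factor Q_m.\<close>

definition Y_exp :: "complex \<Rightarrow> nc_series" where
  "Y_exp t = Series (\<lambda>u. t ^ length u * scoeff (Y_gen (length u)) u)"

lemma scoeff_Y_exp: "scoeff (Y_exp t) u = t ^ length u * scoeff (Y_gen (length u)) u"
  by (simp add: Y_exp_def)

lemma scoeff_Y_gen: "n \<ge> 1 \<Longrightarrow> scoeff (Y_gen n) w = (if w = replicate (n - 1) E0 @ [E1] then - 1 else 0)"
  by (simp add: Y_gen_eq)

lemma scoeff_Y_gen_0: "scoeff (Y_gen 0) w = (if w = [] then 1 else 0)"
  by (simp add: Y_gen_def wone_list_def)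

lemma Y_exp_W_alg: "Y_exp t \<in> W_alg"
  using Y_gen_homog by (auto simp: W_alg_def scoeff_Y_exp)

text \<open>The recursion expresses that \<open>Y_exp t - 1 = - (1 - t e0)\<inverse> t e1\<close>.\<close>

lemma Y_exp_rec: "Y_exp t - 1 = series_scale t (e0 * (Y_exp t - 1)) - series_scale t e1"
proof (rule series_eqI)
  fix w :: "letter list"
  show "scoeff (Y_exp t - 1) w = scoeff (series_scale t (e0 * (Y_exp t - 1)) - series_scale t e1) w"
  proof (cases w)
    case Nil
    then show ?thesis
      by (simp add: scoeff_Y_exp scoeff_Y_gen_0 e0_def e1_def scoeff_letter_mult wone_list_def del: mult_minus_right)
  next
    case (Cons x v)
    show ?thesis
    proof (cases x)
      case E1
      have "E1 # v = replicate (length v) E0 @ [E1] \<longleftrightarrow> v = []"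
        by (cases "length v") auto
      with Cons E1 show ?thesis
        by (simp add: scoeff_Y_exp scoeff_Y_gen e0_def e1_def scoeff_letter_mult wone_list_def)
    next
      case E0
      show ?thesis
      proof (cases v)
        case Nil
        with Cons E0 show ?thesis
          by (simp add: scoeff_Y_exp scoeff_Y_gen scoeff_Y_gen_0 e0_def e1_def scoeff_letter_mult wone_list_def)
      next
        case (Cons y u)
        with \<open>w = x # v\<close> E0 show ?thesis
          by (simp add: scoeff_Y_exp scoeff_Y_gen e0_def e1_def scoeff_letter_mult wone_list_def)
      qed
    qed
  qed
qed

text \<open>With t = 1/(n+1), the increment \<open>K\<close> obeys letter by letter the recursion
  that defines \<open>polylog_coeff\<close> at n+1: a leading \<open>E0\<close> divides by n+1, a
  leading \<open>E1\<close> falls back on the harmonic sums up to n with a minus sign.\<close>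

lemma harm_series_Suc: "harm_series (Suc n) = Y_exp (1 / of_nat (Suc n)) * harm_series n"
proof -
  define t :: complex where "t = 1 / of_nat (Suc n)"
  define K where "K = (Y_exp t - 1) * harm_series n"
  have K: "K = series_scale t (e0 * K) - series_scale t (e1 * harm_series n)"
    unfolding K_def by (subst Y_exp_rec) (simp add: left_diff_distrib series_scale_mult_left mult.assoc)
  have "scoeff K w = polylog_coeff w (Suc n)" for w
  proof (induction w)
    case Nil
    show ?case by (subst K) (simp add: e0_def e1_def scoeff_letter_mult)
  next
    case (Cons x w)
    show ?case
      by (subst K, cases x)
         (simp_all add: Cons.IH e0_def e1_def scoeff_letter_mult t_def harm_sum_def lessThan_Suc_atMost del: of_nat_Suc sum.lessThan_Suc)
  qed
  then have "harm_series (Suc n) = harm_series n + K"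
    by (intro series_eqI) (simp add: harm_sum_Suc)
  also have "\<dots> = Y_exp t * harm_series n" by (simp add: K_def left_diff_distrib)
  finally show ?thesis by (simp add: t_def)
qed

lemma harm_series_0: "harm_series 0 = 1"
  by (rule series_eqI) (simp add: harm_sum_0 wone_list_def)

lemma harm_coproduct_1: "harm_coproduct 1 = 1"
  unfolding harm_coproduct_def Y_expansion_1 by (rule alg_ext_1)

lemma harm_coproduct_scale: "harm_coproduct (series_scale c f) = series_scale c (harm_coproduct f)"
proof -
  have "harm_coproduct 0 = 0"
    using harm_coproduct_linear[of "-1" 0 0] by (simp add: series_scale_minus1)
  then show ?thesis using harm_coproduct_linear[of c f 0] by simp
qed

text \<open>The coproduct formula for the generators says precisely that their generating series is
  group-like. In a given bidegree only one generator matters, and in its coproduct only the term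
  with \<open>i = length u\<close>.\<close>

lemma harm_coproduct_Y_exp: "harm_coproduct (Y_exp t) = tensor (Y_exp t) (Y_exp t)"
proof (rule series_eqI)
  fix m :: "letter list \<times> letter list"
  obtain u v where m: "m = (u, v)" by (cases m)
  let ?d = "length u + length v"
  have "scoeff (harm_coproduct (Y_exp t)) m = scoeff (harm_coproduct (series_scale (t ^ ?d) (Y_gen ?d))) m"
    by (rule harm_coproduct_local) (simp add: m scoeff_Y_exp wdeg_prod_def wdeg_list_def)
  also have "\<dots> = t ^ ?d * (\<Sum>i\<le>?d. scoeff (Y_gen i) u * scoeff (Y_gen (?d - i)) v)"
    by (simp add: harm_coproduct_scale harm_coproduct_Y_gen m)
  also have "(\<Sum>i\<le>?d. scoeff (Y_gen i) u * scoeff (Y_gen (?d - i)) v) =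
      (\<Sum>i\<in>{length u}. scoeff (Y_gen i) u * scoeff (Y_gen (?d - i)) v)"
    by (rule sum.mono_neutral_right) (use Y_gen_homog in auto)
  finally show "scoeff (harm_coproduct (Y_exp t)) m = scoeff (tensor (Y_exp t) (Y_exp t)) m"
    by (simp add: m scoeff_Y_exp power_add)
qed

lemma harm_coproduct_harm_series: "harm_coproduct (harm_series n) = tensor (harm_series n) (harm_series n)"
proof (induction n)
  case (Suc n)
  show ?case
    unfolding harm_series_Suc harm_coproduct_mult[OF Y_exp_W_alg] harm_coproduct_Y_exp Suc.IH tensor_mult ..
qed (simp add: harm_series_0 harm_coproduct_1 tensor_1_1)

section \<open>Asymptotics of harmonic sums\<close>

text \<open>Growth at most like a power of log n. The measure \<open>1 + harm n\<close> is monotone,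
  is at least 1 from n = 0 on, and is what nested harmonic sums produce directly.\<close>

definition slow :: "(nat \<Rightarrow> complex) \<Rightarrow> bool" where
  "slow f \<longleftrightarrow> (\<exists>C k. \<forall>n. norm (f n) \<le> C * (1 + harm n) ^ k)"

lemma slowI: "(\<And>n. norm (f n) \<le> C * (1 + harm n) ^ k) \<Longrightarrow> slow f"
  unfolding slow_def by blast

lemma slowD:
  assumes "slow f"
  shows "\<exists>C k. C \<ge> 0 \<and> (\<forall>n. norm (f n) \<le> C * (1 + harm n) ^ k)"
proof -
  obtain C k where C: "\<And>n. norm (f n) \<le> C * (1 + harm n) ^ k"
    using assms unfolding slow_def by blast
  have "0 \<le> C * (1 + harm 0) ^ k" using C[of 0] norm_ge_zero[of "f 0"] by linarith
  then have "C \<ge> 0" by (simp add: harm_expand)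
  with C show ?thesis by blast
qed

lemma slow_bounded: "(\<And>n. norm (f n) \<le> C) \<Longrightarrow> slow f"
  by (rule slowI[where C = C and k = 0]) simp

lemma slow_add: "slow f \<Longrightarrow> slow g \<Longrightarrow> slow (\<lambda>n. f n + g n)"
proof -
  assume "slow f" "slow g"
  obtain C k where C: "C \<ge> 0" "\<And>n. norm (f n) \<le> C * (1 + harm n) ^ k" using slowD[OF \<open>slow f\<close>] by blast
  obtain D l where D: "D \<ge> 0" "\<And>n. norm (g n) \<le> D * (1 + harm n) ^ l" using slowD[OF \<open>slow g\<close>] by blast
  show ?thesis
  proof (rule slowI)
    fix n
    have "(1 + harm n :: real) ^ k \<le> (1 + harm n) ^ (k + l)" "(1 + harm n :: real) ^ l \<le> (1 + harm n) ^ (k + l)"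
      by (intro power_increasing; simp add: harm_nonneg)+
    then have "C * (1 + harm n) ^ k + D * (1 + harm n) ^ l \<le> (C + D) * (1 + harm n) ^ (k + l)"
      unfolding distrib_right using C(1) D(1) by (intro add_mono mult_left_mono)
    then show "norm (f n + g n) \<le> (C + D) * (1 + harm n) ^ (k + l)"
      using C(2)[of n] D(2)[of n] norm_triangle_ineq[of "f n" "g n"] by linarith
  qed
qed

lemma slow_mult: "slow f \<Longrightarrow> slow g \<Longrightarrow> slow (\<lambda>n. f n * g n)"
proof -
  assume "slow f" "slow g"
  obtain C k where C: "C \<ge> 0" "\<And>n. norm (f n) \<le> C * (1 + harm n) ^ k" using slowD[OF \<open>slow f\<close>] by blast
  obtain D l where D: "D \<ge> 0" "\<And>n. norm (g n) \<le> D * (1 + harm n) ^ l" using slowD[OF \<open>slow g\<close>] by blast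
  show ?thesis
  proof (rule slowI)
    fix n
    have "norm (f n) * norm (g n) \<le> (C * (1 + harm n) ^ k) * (D * (1 + harm n) ^ l)"
      by (intro mult_mono C D mult_nonneg_nonneg zero_le_power) (simp_all add: harm_nonneg)
    then show "norm (f n * g n) \<le> (C * D) * (1 + harm n) ^ (k + l)"
      by (simp add: norm_mult power_add mult_ac)
  qed
qed

lemma slow_const: "slow (\<lambda>_. c)"
  by (rule slow_bounded) (rule order.refl)

lemma slow_uminus: "slow f \<Longrightarrow> slow (\<lambda>n. - f n)"
  using slow_mult[OF slow_const[of "-1"]] by simp

lemma slow_sum: "(\<And>i. i \<in> I \<Longrightarrow> slow (f i)) \<Longrightarrow> slow (\<lambda>n. \<Sum>i\<in>I. f i n)"
  by (induction I rule: infinite_finite_induct) (simp_all add: slow_const slow_add)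

lemma slow_Suc: "slow f \<Longrightarrow> slow (\<lambda>n. f (Suc n))"
proof -
  assume "slow f"
  obtain C k where C: "C \<ge> 0" "\<And>n. norm (f n) \<le> C * (1 + harm n) ^ k" using slowD[OF \<open>slow f\<close>] by blast
  show ?thesis
  proof (rule slowI)
    fix n
    have "inverse (real (Suc n)) \<le> 1 + harm n"
      by (rule order.trans[of _ 1]) (simp_all add: field_simps harm_nonneg)
    then have "1 + harm (Suc n) \<le> 2 * (1 + harm n :: real)"
      unfolding harm_Suc by (simp del: of_nat_Suc)
    then have "(1 + harm (Suc n) :: real) ^ k \<le> (2 * (1 + harm n)) ^ k"
      by (intro power_mono) (simp_all add: harm_nonneg)
    then have "C * (1 + harm (Suc n)) ^ k \<le> C * (2 * (1 + harm n)) ^ k"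
      using C(1) by (rule mult_left_mono)
    with C(2)[of "Suc n"] show "norm (f (Suc n)) \<le> (C * 2 ^ k) * (1 + harm n) ^ k"
      unfolding power_mult_distrib mult.assoc by (rule order.trans)
  qed
qed

text \<open>A leading \<open>E1\<close> costs one factor \<open>harm n\<close>, a leading
  \<open>E0\<close> only shrinks the terms. The absolute values stand inside the sum because the
  step for \<open>E0\<close> compares term by term.\<close>

lemma sum_norm_polylog_coeff_le: "(\<Sum>k\<le>n. norm (polylog_coeff w k)) \<le> (1 + harm n) ^ length w"
proof (induction w arbitrary: n)
  case Nil
  have "(\<Sum>k\<le>n. norm (polylog_coeff [] k)) = (\<Sum>k\<in>{0}. norm (polylog_coeff [] k))"
    by (rule sum.mono_neutral_right) auto
  then show ?case by simp
next
  case (Cons x w)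
  have h: "(0::real) \<le> (1 + harm n) ^ length w" by (intro zero_le_power) (simp add: harm_nonneg)
  show ?case
  proof (cases x)
    case E0
    have "(\<Sum>k\<le>n. norm (polylog_coeff (x # w) k)) \<le> (\<Sum>k\<le>n. norm (polylog_coeff w k))"
    proof (rule sum_mono)
      fix k show "norm (polylog_coeff (x # w) k) \<le> norm (polylog_coeff w k)"
        unfolding E0 polylog_coeff.simps norm_divide norm_of_nat
        by (cases k) (simp_all add: divide_le_eq mult_le_cancel_left1 del: of_nat_Suc)
    qed
    also have "\<dots> \<le> (1 + harm n) ^ length w" by (rule Cons.IH)
    also have "\<dots> \<le> (1 + harm n) ^ length (x # w)"
      by (rule power_increasing) (simp_all add: harm_nonneg)
    finally show ?thesis .
  next
    case E1
    have "norm (polylog_coeff (x # w) (Suc k)) \<le> (1 + harm n) ^ length w * inverse (of_nat (Suc k))" if "k < n" for k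
    proof -
      have "norm (\<Sum>i\<le>k. polylog_coeff w i) \<le> (1 + harm k) ^ length w"
        by (rule order.trans[OF norm_sum Cons.IH])
      also have "\<dots> \<le> (1 + harm n) ^ length w"
        using that by (intro power_mono) (simp_all add: harm_nonneg harm_mono)
      finally show ?thesis
        unfolding E1 polylog_coeff.simps norm_divide norm_of_nat norm_minus_cancel lessThan_Suc_atMost
        by (simp add: divide_inverse mult_right_mono del: of_nat_Suc)
    qed
    then have "(\<Sum>k<n. norm (polylog_coeff (x # w) (Suc k))) \<le>
        (\<Sum>k<n. (1 + harm n) ^ length w * inverse (of_nat (Suc k)))"
      by (intro sum_mono) simp
    also have "\<dots> = (1 + harm n) ^ length w * harm n"
      by (simp add: harm_altdef sum_distrib_left)
    also have "\<dots> \<le> (1 + harm n) ^ length (x # w)"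
      using h by (simp add: algebra_simps)
    also have "(\<Sum>k<n. norm (polylog_coeff (x # w) (Suc k))) = (\<Sum>k\<le>n. norm (polylog_coeff (x # w) k))"
      unfolding sum.atMost_shift by (simp add: polylog_coeff_0)
    finally show ?thesis .
  qed
qed

lemma slow_harm_sum: "slow (harm_sum w)"
  by (rule slowI[where C = 1 and k = "length w"])
     (simp add: harm_sum_def order.trans[OF norm_sum sum_norm_polylog_coeff_le])

text \<open>For x = (2 + ln n) / 2 one has x^k <= exp x eventually, and exp x is a constant times
  the square root of n. With \<open>harm n\<close> at most 1 + ln n this bounds the terms by a
  multiple of n^(-3/2).\<close>

lemma summable_harm_power: "summable (\<lambda>n. (1 + harm n :: real) ^ k / real (Suc n) ^ 2)"
proof -
  have "filterlim (\<lambda>n::nat. (2 + ln (real n)) / 2) at_top sequentially"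
    by real_asymp
  from filterlim_compose[OF tendsto_power_div_exp_0[of k] this]
  have "(\<lambda>n::nat. ((2 + ln (real n)) / 2) ^ k / exp ((2 + ln (real n)) / 2)) \<longlonglongrightarrow> 0" .
  then have "eventually (\<lambda>n::nat. ((2 + ln (real n)) / 2) ^ k / exp ((2 + ln (real n)) / 2) < 1) sequentially"
    by (rule order_tendstoD) simp
  then have "eventually (\<lambda>n::nat. norm ((1 + harm n :: real) ^ k / real (Suc n) ^ 2) \<le>
      2 ^ k * exp 1 * real n powr (- 3 / 2)) sequentially"
    using eventually_gt_at_top[of 0]
  proof eventually_elim
    case (elim n)
    have "harm n - ln (real n) \<le> harm 1 - ln (real 1)"
      by (rule euler_mascheroni_sequence_decreasing) (use elim in auto)
    then have "(1 + harm n :: real) ^ k \<le> (2 + ln (real n)) ^ k"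
      by (intro power_mono) (simp_all add: harm_nonneg harm_expand)
    also have "\<dots> = 2 ^ k * ((2 + ln (real n)) / 2) ^ k" by (simp add: power_divide)
    also have "\<dots> \<le> 2 ^ k * exp ((2 + ln (real n)) / 2)"
      using elim by (simp add: divide_less_eq)
    also have "exp ((2 + ln (real n)) / 2) = exp 1 * real n powr (1 / 2)"
      using elim by (simp add: powr_def add_divide_distrib exp_add)
    finally have "(1 + harm n :: real) ^ k / real (Suc n) ^ 2 \<le> (2 ^ k * (exp 1 * real n powr (1 / 2))) / real n ^ 2"
      using elim by (intro frac_le) auto
    also have "\<dots> = 2 ^ k * exp 1 * (real n powr (1 / 2) / real n powr 2)"
      using elim by simp
    also have "real n powr (1 / 2) / real n powr 2 = real n powr (- 3 / 2)"
      by (simp only: powr_diff [symmetric]) simp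
    finally show ?case by (simp add: harm_nonneg)
  qed
  moreover have "summable (\<lambda>n. 2 ^ k * exp 1 * real n powr (- 3 / 2))"
    by (intro summable_mult) (simp add: summable_real_powr_iff)
  ultimately show ?thesis by (rule summable_comparison_test_ev)
qed

lemma slow_increments_convergent:
  assumes "slow (\<lambda>n. of_nat (Suc n) ^ 2 * (d (Suc n) - d n))"
  shows "convergent d"
proof -
  obtain C k where C: "C \<ge> 0" "\<And>n. norm (of_nat (Suc n) ^ 2 * (d (Suc n) - d n)) \<le> C * (1 + harm n) ^ k"
    using slowD[OF assms] by blast
  have "summable (\<lambda>n. d (Suc n) - d n)"
  proof (rule summable_comparison_test)
    show "summable (\<lambda>n. C * ((1 + harm n) ^ k / real (Suc n) ^ 2))"
      by (intro summable_mult summable_harm_power)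
    show "\<exists>N. \<forall>n\<ge>N. norm (d (Suc n) - d n) \<le> C * ((1 + harm n) ^ k / real (Suc n) ^ 2)"
    proof (intro exI allI impI)
      fix n
      show "norm (d (Suc n) - d n) \<le> C * ((1 + harm n) ^ k / real (Suc n) ^ 2)"
        using C(2)[of n] unfolding norm_mult norm_power norm_of_nat
        by (simp add: field_simps del: of_nat_Suc)
    qed
  qed
  then have "convergent (\<lambda>n. \<Sum>i<n. d (Suc i) - d i)" by (simp add: summable_iff_convergent)
  then have "convergent (\<lambda>n. d n - d 0)" by (simp add: sum_lessThan_telescope)
  then show ?thesis by (simp add: convergent_diff_const_right_iff)
qed

text \<open>The difference \<open>d n - l\<close> is a tail of the increments. Since
  \<open>harm\<close> is monotone, the bound for \<open>e n\<close> can be moved inside the tail and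
  evaluated at the running index, which leaves a tail of one fixed convergent series.\<close>

lemma slow_mult_tail_tendsto_0:
  assumes e: "slow e" and d: "slow (\<lambda>n. of_nat (Suc n) ^ 2 * (d (Suc n) - d n))" and l: "d \<longlonglongrightarrow> l"
  shows "(\<lambda>n. e n * (d n - l)) \<longlonglongrightarrow> 0"
proof -
  obtain C k where C: "C \<ge> 0" "\<And>n. norm (of_nat (Suc n) ^ 2 * (d (Suc n) - d n)) \<le> C * (1 + harm n) ^ k"
    using slowD[OF d] by blast
  obtain D j where D: "D \<ge> 0" "\<And>n. norm (e n) \<le> D * (1 + harm n) ^ j" using slowD[OF e] by blast
  define g where "g = (\<lambda>n. C * D * ((1 + harm n) ^ (k + j) / real (Suc n) ^ 2))"
  have g: "summable g" unfolding g_def by (intro summable_mult summable_harm_power)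
  have le: "norm (e n * (d n - l)) \<le> (\<Sum>i. g (i + n))" for n
  proof -
    have sg: "summable (\<lambda>i. g (i + n))" using g by (simp add: summable_iff_shift)
    have "(\<lambda>i. d (i + n)) \<longlonglongrightarrow> l" using l by (rule LIMSEQ_ignore_initial_segment)
    from telescope_sums[OF this] have "(\<lambda>i. d (Suc i + n) - d (i + n)) sums (l - d n)" by simp
    from sums_mult[OF this, of "e n"]
    have s: "(\<lambda>i. e n * (d (Suc i + n) - d (i + n))) sums (e n * (l - d n))" .
    have bound: "norm (e n * (d (Suc i + n) - d (i + n))) \<le> g (i + n)" for i
    proof -
      let ?m = "i + n"
      have "norm (d (Suc ?m) - d ?m) \<le> C * (1 + harm ?m) ^ k / real (Suc ?m) ^ 2"
        using C(2)[of ?m] unfolding norm_mult norm_power norm_of_nat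
        by (simp add: field_simps del: of_nat_Suc)
      moreover have "norm (e n) \<le> D * (1 + harm ?m) ^ j"
        by (rule order.trans[OF D(2)], intro mult_left_mono power_mono add_left_mono harm_mono)
           (use D(1) in \<open>simp_all add: harm_nonneg\<close>)
      ultimately have "norm (e n) * norm (d (Suc ?m) - d ?m) \<le>
          (D * (1 + harm ?m) ^ j) * (C * (1 + harm ?m) ^ k / real (Suc ?m) ^ 2)"
        by (intro mult_mono mult_nonneg_nonneg zero_le_power D(1)) (simp_all add: harm_nonneg)
      then show ?thesis by (simp add: g_def norm_mult power_add mult_ac)
    qed
    have "norm (\<Sum>i. e n * (d (Suc i + n) - d (i + n))) \<le> (\<Sum>i. g (i + n))"
      by (rule norm_suminf_le[OF bound sg])
    then have "norm (e n * (l - d n)) \<le> (\<Sum>i. g (i + n))"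
      using sums_unique[OF s] by simp
    then show ?thesis by (simp add: norm_mult norm_minus_commute)
  qed
  have "(\<lambda>n. suminf g - (\<Sum>i<n. g i)) \<longlonglongrightarrow> suminf g - suminf g"
    by (intro tendsto_intros summable_LIMSEQ g)
  then have "(\<lambda>n. \<Sum>i. g (i + n)) \<longlonglongrightarrow> 0"
    by (simp add: suminf_minus_initial_segment[OF g])
  then show ?thesis by (rule Lim_null_comparison[OF always_eventually[OF allI[OF le]]])
qed

text \<open>
  \<open>binomial_fps n\<close> is the polynomial \<open>(s + n choose n)\<close> in \<open>s\<close>; it describes the divergent part of
  the harmonic sums.
\<close>

definition binomial_fps :: "nat \<Rightarrow> complex fps" where
  "binomial_fps n = (\<Prod>j<n. 1 + fps_const (1 / of_nat (Suc j)) * fps_X)"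

lemma binomial_fps_0 [simp]: "binomial_fps 0 = 1"
  by (simp add: binomial_fps_def)

lemma binomial_fps_Suc: "binomial_fps (Suc n) = binomial_fps n * (1 + fps_const (1 / of_nat (Suc n)) * fps_X)"
  by (simp add: binomial_fps_def)

lemma binomial_fps_nth_0 [simp]: "fps_nth (binomial_fps n) 0 = 1"
  by (induction n) (simp_all add: binomial_fps_Suc)

text \<open>Both sides are the elementary symmetric functions of 1, 1/2, ..., 1/n; the sign undoes
  the minus attached to each \<open>E1\<close>.\<close>

lemma binomial_fps_nth: "fps_nth (binomial_fps n) k = (- 1) ^ k * harm_sum (replicate k E1) n"
proof (induction n arbitrary: k)
  case 0
  show ?case by (cases k) (simp_all add: harm_sum_0)
next
  case (Suc n)
  show ?case
  proof (cases k)
    case (Suc j)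
    have "fps_nth (binomial_fps (Suc n)) (Suc j) =
        fps_nth (binomial_fps n) (Suc j) + 1 / of_nat (Suc n) * fps_nth (binomial_fps n) j"
      unfolding binomial_fps_Suc distrib_left mult_1_right
      by (simp add: mult.commute[of _ "fps_const _ * _"] mult.assoc del: of_nat_Suc)
    then show ?thesis
      unfolding Suc by (simp add: Suc.IH harm_sum_Suc harm_sum_def[of "replicate j E1" n]
          lessThan_Suc_atMost right_diff_distrib del: of_nat_Suc sum.lessThan_Suc sum.atMost_Suc)
  qed simp
qed

lemma slow_binomial_fps: "slow (\<lambda>n. fps_nth (binomial_fps n) k)"
  unfolding binomial_fps_nth by (intro slow_mult slow_const slow_harm_sum)

lemma slow_inverse_binomial_fps: "slow (\<lambda>n. fps_nth (inverse (binomial_fps n)) k)"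
proof (induction k rule: less_induct)
  case (less k)
  show ?case
  proof (cases "k = 0")
    case False
    have "fps_nth (inverse (binomial_fps n)) k =
        - (\<Sum>i<k. fps_nth (inverse (binomial_fps n)) i * fps_nth (binomial_fps n) (k - i))" for n
    proof -
      have "fps_nth (inverse (binomial_fps n) * binomial_fps n) k = 0"
        using False by (subst inverse_mult_eq_1) simp_all
      then have "(\<Sum>i\<le>k. fps_nth (inverse (binomial_fps n)) i * fps_nth (binomial_fps n) (k - i)) = 0"
        by (simp add: fps_mult_nth atLeast0AtMost)
      moreover have "{..k} = insert k {..<k}" by auto
      ultimately show ?thesis by (simp add: eq_neg_iff_add_eq_0)
    qed
    then show ?thesis
      by (simp only:) (intro slow_uminus slow_sum slow_mult less slow_binomial_fps, simp)
  qed (simp add: slow_const)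
qed

lemma scoeff_fps_subst_Y1:
  "scoeff (fps_subst F (Y_gen 1)) a =
     (if a = replicate (length a) E1 then (- 1) ^ length a * fps_nth F (length a) else 0)"
proof -
  have "Y_gen 1 = series_scale (- 1) (word_monom [E1])"
    by (simp add: Y_gen_eq series_scale_minus1)
  then show ?thesis by (simp only: scoeff_fps_subst_letter)
qed

lemma Y_gen_1_wone [simp]: "scoeff (Y_gen 1) wone = 0" "scoeff (Y_gen (Suc 0)) wone = 0"
  by (simp_all add: scoeff_Y_gen wone_list_def)

lemma Y_gen_1_W_alg: "Y_gen 1 \<in> W_alg"
  using Y_gen_homog by (auto simp: W_alg_def)

text \<open>The divergence is divided out by the polynomial P_n(y_1), whose last factor matches the
  linear part of Q_n exactly; see \<open>harm_reg_increment\<close>.\<close>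

definition harm_reg :: "nat \<Rightarrow> nc_series" where
  "harm_reg n = fps_subst (inverse (binomial_fps n)) (Y_gen 1) * harm_series n"

lemma harm_series_eq_reg: "harm_series n = fps_subst (binomial_fps n) (Y_gen 1) * harm_reg n"
proof -
  have "fps_subst (binomial_fps n) (Y_gen 1) * harm_reg n =
      fps_subst (binomial_fps n * inverse (binomial_fps n)) (Y_gen 1) * harm_series n"
    by (simp only: harm_reg_def fps_subst_mult Y_gen_1_wone mult.assoc)
  also have "binomial_fps n * inverse (binomial_fps n) = 1"
    by (rule inverse_mult_eq_1') simp
  finally show ?thesis by simp
qed

lemma norm_Y_exp_tail_le:
  assumes "norm t \<le> 1"
  shows "norm (scoeff (Y_exp t - (1 + series_scale t (Y_gen 1))) a) \<le> norm t ^ 2"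
proof -
  consider "a = []" | "length a = 1" | "length a \<ge> 2" by (cases a) (auto simp: Suc_le_eq)
  then show ?thesis
  proof cases
    case 1
    then show ?thesis by (simp add: scoeff_Y_exp scoeff_Y_gen_0 scoeff_Y_gen wone_list_def)
  next
    case 2
    then show ?thesis by (auto simp: scoeff_Y_exp wone_list_def)
  next
    case 3
    then have "a \<noteq> []" "a \<noteq> [E1]" by auto
    then have "scoeff (Y_exp t - (1 + series_scale t (Y_gen 1))) a = t ^ length a * scoeff (Y_gen (length a)) a"
      by (simp add: scoeff_Y_exp scoeff_Y_gen wone_list_def)
    also have "norm \<dots> \<le> norm t ^ length a * 1"
      unfolding norm_mult norm_power using 3 by (intro mult_left_mono) (auto simp: scoeff_Y_gen)
    also have "\<dots> \<le> norm t ^ 2" using power_decreasing[OF 3 norm_ge_zero assms] by simp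
    finally show ?thesis .
  qed
qed

text \<open>Passing from n to n+1 multiplies \<open>harm_series\<close> by Q_(n+1) and the binomial
  polynomial by 1 + y_1/(n+1). Over the common factor only the part of Q_(n+1) of degree at least 2
  survives, which is of size (n+1)^(-2).\<close>

lemma harm_reg_increment:
  "harm_reg (Suc n) - harm_reg n = fps_subst (inverse (binomial_fps (Suc n))) (Y_gen 1) *
     ((Y_exp (1 / of_nat (Suc n)) - (1 + series_scale (1 / of_nat (Suc n)) (Y_gen 1))) * harm_series n)"
proof -
  define t :: complex where "t = 1 / of_nat (Suc n)"
  let ?f = "1 + fps_const t * fps_X"
  let ?P = "fps_subst (inverse (binomial_fps (Suc n))) (Y_gen 1)"
  have "inverse (binomial_fps n) = inverse (binomial_fps (Suc n)) * ?f"
    unfolding binomial_fps_Suc t_def[symmetric] fps_inverse_mult mult.assoc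
    by (subst inverse_mult_eq_1) simp_all
  then have "harm_reg n = ?P * (fps_subst ?f (Y_gen 1) * harm_series n)"
    by (simp only: harm_reg_def fps_subst_mult Y_gen_1_wone mult.assoc)
  moreover have "fps_subst ?f (Y_gen 1) = 1 + series_scale t (Y_gen 1)"
    by (simp add: fps_subst_add fps_subst_mult fps_subst_const series_scale_mult_left del: One_nat_def)
  moreover have "harm_reg (Suc n) = ?P * (Y_exp t * harm_series n)"
    by (simp only: harm_reg_def harm_series_Suc t_def)
  ultimately show ?thesis
    unfolding t_def[symmetric] by (simp only: right_diff_distrib left_diff_distrib)
qed

lemma slow_fps_subst_Y1:
  assumes "\<And>k. slow (\<lambda>n. fps_nth (F n) k)"
  shows "slow (\<lambda>n. scoeff (fps_subst (F n) (Y_gen 1)) a)"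
  unfolding scoeff_fps_subst_Y1
  by (cases "a = replicate (length a) E1") (auto intro: slow_mult slow_const assms simp del: replicate_length_same)

lemma slow_harm_reg_increments:
  "slow (\<lambda>n. of_nat (Suc n) ^ 2 * (scoeff (harm_reg (Suc n)) w - scoeff (harm_reg n) w))"
proof -
  let ?R = "\<lambda>n. Y_exp (1 / of_nat (Suc n)) - (1 + series_scale (1 / of_nat (Suc n)) (Y_gen 1))"
  let ?P = "\<lambda>n. fps_subst (inverse (binomial_fps (Suc n))) (Y_gen 1)"
  have R: "slow (\<lambda>n. of_nat (Suc n) ^ 2 * scoeff (?R n) a)" for a
  proof (rule slow_bounded)
    fix n
    have "norm (scoeff (?R n) a) \<le> norm (1 / of_nat (Suc n) :: complex) ^ 2"
      by (rule norm_Y_exp_tail_le) (simp add: norm_divide del: of_nat_Suc)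
    then show "norm (of_nat (Suc n) ^ 2 * scoeff (?R n) a) \<le> 1"
      by (simp add: norm_mult norm_divide norm_power field_simps del: of_nat_Suc scoeff_simps)
  qed
  have P: "slow (\<lambda>n. scoeff (?P n) a)" for a
    by (rule slow_fps_subst_Y1, rule slow_Suc[OF slow_inverse_binomial_fps])
  have RH: "slow (\<lambda>n. of_nat (Suc n) ^ 2 * scoeff (?R n * harm_series n) b)" for b
    unfolding scoeff_mult sum_distrib_left case_prod_unfold mult.assoc[symmetric] scoeff_harm_series
    by (intro slow_sum slow_mult R slow_harm_sum)
  have "slow (\<lambda>n. of_nat (Suc n) ^ 2 * scoeff (?P n * (?R n * harm_series n)) w)"
    unfolding scoeff_mult[of "?P _"] sum_distrib_left case_prod_unfold mult.left_commute[of "_ ^ 2"]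
    by (intro slow_sum slow_mult P RH)
  then show ?thesis
    by (simp only: scoeff_simps(5)[symmetric] harm_reg_increment)
qed

definition harm_limit :: nc_series where
  "harm_limit = Series (\<lambda>w. lim (\<lambda>n. scoeff (harm_reg n) w))"

lemma harm_reg_tendsto: "series_tendsto harm_reg harm_limit sequentially"
  using slow_increments_convergent[OF slow_harm_reg_increments]
  by (simp add: series_tendsto_def harm_limit_def convergent_LIMSEQ_iff)

text \<open>The difference is P_n(y_1) times \<open>harm_reg n - harm_limit\<close>, coefficientwise
  a finite sum of slow sequences times tails, as in \<open>slow_mult_tail_tendsto_0\<close>.\<close>

lemma harm_series_asymptotics:
  "(\<lambda>n. harm_sum w n - scoeff (fps_subst (binomial_fps n) (Y_gen 1) * harm_limit) w) \<longlonglongrightarrow> 0"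
proof -
  have "(\<lambda>n. scoeff (fps_subst (binomial_fps n) (Y_gen 1) * (harm_reg n - harm_limit)) w) \<longlonglongrightarrow> 0"
    unfolding scoeff_mult case_prod_unfold scoeff_simps(5)
    by (intro tendsto_null_sum slow_mult_tail_tendsto_0 slow_harm_reg_increments
        slow_fps_subst_Y1 slow_binomial_fps harm_reg_tendsto[unfolded series_tendsto_def, rule_format])
  then show ?thesis
    by (simp only: right_diff_distrib harm_series_eq_reg[symmetric] scoeff_simps(5) scoeff_harm_series)
qed

section \<open>Abel summation and the identification of the Y-part\<close>

lemma null_seq_Abel_tendsto:
  fixes r :: "nat \<Rightarrow> complex"
  assumes r: "r \<longlonglongrightarrow> 0"
  shows "((\<lambda>t. of_real t * (\<Sum>n. r n * of_real (1 - t) ^ n)) \<longlongrightarrow> 0) (at_right 0)"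
proof (rule tendstoI)
  fix \<epsilon> :: real assume \<epsilon>: "\<epsilon> > 0"
  obtain B where B: "B > 0" "\<And>n. norm (r n) \<le> B"
    using convergent_imp_Bseq[OF convergentI[OF r]] by (auto elim: BseqE)
  have "eventually (\<lambda>n. norm (r n) < \<epsilon> / 2) sequentially"
    using tendstoD[OF r, of "\<epsilon> / 2"] \<epsilon> by simp
  then obtain N where N: "\<And>n. n \<ge> N \<Longrightarrow> norm (r n) < \<epsilon> / 2"
    by (auto simp: eventually_sequentially)
  \<comment> \<open>\<open>c\<close> bounds the first \<open>N\<close> terms, whose contribution
    disappears with the factor \<open>t\<close>; the remaining terms give at most \<epsilon>/2
    because the weights \<open>t * (1 - t) ^ n\<close> sum to 1. The added 1 keeps \<open>c\<close>
    positive for \<open>N = 0\<close>.\<close>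
  define c where "c = B * real N + 1"
  have c: "c > 0" using B by (simp add: c_def add_nonneg_pos)
  have "eventually (\<lambda>t. t \<in> {0<..<min 1 (\<epsilon> / (2 * c))}) (at_right 0)"
    by (rule eventually_at_right_real) (use \<epsilon> c in simp)
  then show "eventually (\<lambda>t. dist (of_real t * (\<Sum>n. r n * of_real (1 - t) ^ n)) 0 < \<epsilon>) (at_right 0)"
  proof eventually_elim
    case (elim t)
    define x where "x = 1 - t"
    have x: "0 < x" "x < 1" and t: "0 < t" "t * c < \<epsilon> / 2"
      using elim c by (auto simp: x_def field_simps)
    let ?g = "\<lambda>n. (if n \<in> {..<N} then B * x ^ n else 0) + \<epsilon> / 2 * x ^ n"
    have "?g sums ((\<Sum>n<N. B * x ^ n) + \<epsilon> / 2 * (1 / (1 - x)))"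
      by (intro sums_add sums_If_finite_set sums_mult geometric_sums) (use x in auto)
    then have g: "summable ?g" "suminf ?g = (\<Sum>n<N. B * x ^ n) + \<epsilon> / 2 * (1 / t)"
      by (auto simp: sums_iff x_def)
    have le: "norm (r n * of_real x ^ n) \<le> ?g n" for n
    proof -
      have "norm (r n) \<le> (if n < N then B else 0) + \<epsilon> / 2"
        using B(2)[of n] N[of n] \<epsilon> by (cases "n < N") auto
      then have "norm (r n) * x ^ n \<le> ((if n < N then B else 0) + \<epsilon> / 2) * x ^ n"
        using x by (intro mult_right_mono) auto
      also have "\<dots> = ?g n" by (simp add: distrib_right)
      finally show ?thesis using x by (simp add: norm_mult norm_power)
    qed
    have "norm (\<Sum>n. r n * of_real x ^ n) \<le> suminf ?g"
      by (rule norm_suminf_le[OF le g(1)])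
    also have "(\<Sum>n<N. B * x ^ n) \<le> (\<Sum>n<N. B * 1)"
      using x B by (intro sum_mono mult_left_mono) (auto simp: power_le_one)
    then have "suminf ?g \<le> c + \<epsilon> / 2 * (1 / t)" unfolding g(2) c_def by (simp add: mult.commute)
    finally have "t * norm (\<Sum>n. r n * of_real x ^ n) \<le> t * (c + \<epsilon> / 2 * (1 / t))"
      using t by (intro mult_left_mono) auto
    also have "\<dots> = t * c + \<epsilon> / 2" using t by (simp add: field_simps)
    also have "\<dots> < \<epsilon>" using t by linarith
    finally show ?case using t by (simp add: norm_mult x_def del: of_real_diff)
  qed
qed

text \<open>Together with \<open>binomial_fps_nth\<close> this is the coefficient of s^k in the
  identity stating that (1 - z) times the sum of P_n(s) z^n equals (1 - z)^(-s).\<close>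

lemma polylog_E1_power:
  "z \<in> {0<..<1} \<Longrightarrow> polylog (replicate k E1) (of_real z) = of_real (ln (1 - z) ^ k / fact k)"
proof (induction k arbitrary: z)
  case 0
  show ?case by (simp add: polylog_Nil)
next
  case (Suc k)
  define f where "f = (\<lambda>t. polylog (replicate (Suc k) E1) (of_real t) - of_real (ln (1 - t) ^ Suc k / fact (Suc k)))"
  have D: "(f has_vector_derivative 0) (at t)" if t: "t \<in> {0<..<1}" for t
  proof -
    have "norm (of_real t :: complex) < 1" using t by auto
    from has_vector_derivative_real_field[OF polylog_E1_has_derivative[OF this, of "replicate k E1"]]
    have 1: "((\<lambda>t. polylog (replicate (Suc k) E1) (of_real t)) has_vector_derivative
        of_real (ln (1 - t) ^ k / fact k / (t - 1))) (at t)"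
      by (simp add: Suc.IH[OF t])
    have "((\<lambda>t. ln (1 - t)) has_real_derivative 1 / (t - 1)) (at t)"
      using t by (auto intro!: derivative_eq_intros simp: field_simps)
    then have "((\<lambda>t. ln (1 - t) ^ Suc k / fact (Suc k)) has_real_derivative
        of_nat (Suc k) * (1 / (t - 1) * ln (1 - t) ^ (Suc k - Suc 0)) / fact (Suc k)) (at t)"
      by (intro DERIV_cdivide DERIV_power)
    then have "((\<lambda>t. ln (1 - t) ^ Suc k / fact (Suc k)) has_real_derivative
        ln (1 - t) ^ k / fact k / (t - 1)) (at t)"
      by (simp add: fact_Suc mult.commute del: of_nat_Suc power_Suc)
    from has_vector_derivative_diff[OF 1 has_vector_derivative_of_real[OF this]]
    show ?thesis unfolding f_def by (simp only: diff_self)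
  qed
  have const: "f t = f z" if "t \<in> {0<..<1}" for t
    by (rule zero_derivative_constant[OF D that Suc.prems])
  have "(f \<longlongrightarrow> f z) (at_right 0)"
    by (rule tendsto_eventually, rule eventually_mono[OF eventually_at_right_0_1 const])
  moreover have "((\<lambda>t::real. of_real (ln (1 - t) ^ Suc k / fact (Suc k))) \<longlongrightarrow>
      (of_real (ln (1 - 0) ^ Suc k / fact (Suc k)) :: complex)) (at_right 0)"
    by (intro tendsto_intros tendsto_ident_at) simp_all
  then have "(f \<longlongrightarrow> 0 - 0) (at_right 0)"
    unfolding f_def using polylog_tendsto_0[of "replicate (Suc k) E1"]
    by (intro tendsto_diff) simp_all
  ultimately have "f z = 0 - 0" by (rule tendsto_unique[OF trivial_limit_at_right_real])
  then show ?case by (simp add: f_def)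
qed

text \<open>For z = 1 - t and s = y_1 = -e1 the power (1 - z)^(-s) is \<open>rpow t e1\<close>. Only
  powers of \<open>E1\<close> occur as left factors, and for them the sum is a polylogarithm divided
  by 1 - z.\<close>

lemma harm_series_generating_function:
  assumes t: "t \<in> {0<..<1::real}"
  shows "(\<lambda>n. scoeff (fps_subst (binomial_fps n) (Y_gen 1) * D) w * of_real (1 - t) ^ n) sums
           (scoeff (rpow t e1 * D) w / of_real t)"
proof -
  let ?x = "of_real (1 - t) :: complex"
  have e1: "e1 = series_scale 1 (word_monom [E1])" by (simp add: e1_def)
  have x: "norm ?x < 1" unfolding norm_of_real using t by auto
  have summand: "(\<lambda>n. scoeff (fps_subst (binomial_fps n) (Y_gen 1)) a * b * ?x ^ n) sums
      (scoeff (rpow t e1) a * b / of_real t)" for a b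
  proof (cases "a = replicate (length a) E1")
    case True
    have "summable (\<lambda>n. harm_sum a n * ?x ^ n)"
      by (rule summable_linear_geometric[where c = 1]) (use x norm_harm_sum_le in auto)
    then have "(\<lambda>n. harm_sum a n * ?x ^ n) sums (polylog a ?x / of_real t)"
      using polylog_eq_harm_sum[OF x, of a] t by (simp add: sums_iff)
    from sums_mult[OF this, of b]
    have "(\<lambda>n. harm_sum a n * b * ?x ^ n) sums (polylog a ?x * b / of_real t)"
      by (simp add: mult_ac)
    moreover have "polylog a ?x = scoeff (rpow t e1) a"
    proof -
      have "1 - t \<in> {0<..<1}" using t by auto
      from polylog_E1_power[OF this, of "length a"] True
      have "polylog a ?x = of_real (ln t ^ length a / fact (length a))" by simp
      moreover have "scoeff (rpow t e1) a = of_real (ln t ^ length a / fact (length a))"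
        unfolding e1 scoeff_fps_subst_letter using True by simp
      ultimately show ?thesis by simp
    qed
    moreover have "scoeff (fps_subst (binomial_fps n) (Y_gen 1)) a = harm_sum a n" for n
      unfolding scoeff_fps_subst_Y1 binomial_fps_nth using True
      by (simp flip: mult.assoc power_mult_distrib)
    ultimately show ?thesis by simp
  next
    case False
    then show ?thesis
      unfolding scoeff_fps_subst_Y1 e1 scoeff_fps_subst_letter by simp
  qed
  show ?thesis
    unfolding scoeff_mult case_prod_unfold sum_distrib_right sum_divide_distrib
    by (intro sums_sum summand)
qed

lemma scoeff_mult_e1:
  "scoeff (f * e1) (v @ [E1]) = scoeff f v" "scoeff (f * e1) [] = 0"
  "scoeff (f * e1) (v @ [E0]) = 0"
proof -
  have "scoeff (f * e1) (v @ [E1]) = (\<Sum>(a, b)\<in>{(v, [E1])}. scoeff f a * scoeff e1 b)"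
    unfolding scoeff_mult
    by (rule sum.mono_neutral_right, rule finite_factorizations)
       (auto simp: wcat_list_def e1_def split: if_splits)
  then show "scoeff (f * e1) (v @ [E1]) = scoeff f v" by (simp add: e1_def)
  show "scoeff (f * e1) [] = 0"
    using scoeff_mult_wone[of f e1, unfolded wone_list_def] by (simp add: e1_def)
  show "scoeff (f * e1) (v @ [E0]) = 0"
    unfolding scoeff_mult
    by (rule sum.neutral) (auto simp: wcat_list_def e1_def split: if_splits)
qed

lemma scoeff_Y_part:
  assumes "scoeff f [] = 1"
  shows "scoeff (Y_part f) w = (if w \<in> W_words then scoeff f w else 0)"
proof (cases w rule: rev_cases)
  case Nil
  then show ?thesis using assms by (simp add: Y_part_def scoeff_mult_e1 wone_list_def W_words_def)
next
  case (snoc v x)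
  then show ?thesis
    by (cases x) (auto simp: Y_part_def scoeff_mult_e1 wone_list_def W_words_def right_quot.rep_eq)
qed

lemma harm_limit_W_alg: "harm_limit \<in> W_alg"
proof -
  have "harm_reg n \<in> W_alg" for n
    unfolding harm_reg_def by (intro W_alg_mult W_alg_fps_subst Y_gen_1_W_alg harm_series_W_alg)
  then show ?thesis by (simp add: W_alg_def harm_limit_def)
qed

text \<open>
  The lowest-degree coefficients of a nonzero \<open>V\<close> on \<open>W_words\<close> are also coefficients of
  \<open>rpow t e1 * V\<close>.
\<close>

lemma rpow_mult_tendsto_0_imp_0:
  assumes E: "scoeff E wone = 0"
    and lim: "\<And>w. w \<in> W_words \<Longrightarrow> ((\<lambda>t. scoeff (rpow t E * V) w) \<longlongrightarrow> 0) (at_right 0)"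
  shows "w \<in> W_words \<Longrightarrow> scoeff V w = 0"
proof (induction "length w" arbitrary: w rule: less_induct)
  case less
  have "scoeff (rpow t E * V) w = scoeff V w" for t
  proof -
    have "scoeff (rpow t E * V) w = (\<Sum>(a, b)\<in>{(wone, w)}. scoeff (rpow t E) a * scoeff V b)"
      unfolding scoeff_mult
    proof (rule sum.mono_neutral_right, rule finite_factorizations)
      show "\<forall>p\<in>{(a, b). wcat a b = w} - {(wone, w)}.
          (case p of (a, b) \<Rightarrow> scoeff (rpow t E) a * scoeff V b) = 0"
      proof (intro ballI)
        fix p assume "p \<in> {(a, b). wcat a b = w} - {(wone, w)}"
        then obtain a b where p: "p = (a, b)" and w: "w = a @ b" and "a \<noteq> []"
          by (cases p) (auto simp: wone_list_def wcat_list_def)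
        then have "length b < length w" "b \<in> W_words"
          using less.prems W_words_suffix by auto
        with less.hyps show "(case p of (a, b) \<Rightarrow> scoeff (rpow t E) a * scoeff V b) = 0"
          by (simp add: p)
      qed
    qed auto
    then show ?thesis using E by simp
  qed
  then have "((\<lambda>t::real. scoeff V w) \<longlongrightarrow> 0) (at_right 0)" using lim[OF less.prems] by simp
  then show ?case by (simp add: tendsto_const_iff)
qed

text \<open>On \<open>W_words\<close>, \<open>G\<close> has two descriptions near 1 with the same
  divergent factor: \<open>rpow t e1 * A\<close> from the connection, and
  \<open>rpow t e1 * harm_limit\<close> from Abel summation of the harmonic sums. Hence
  \<open>rpow t e1 * (harm_limit - A)\<close> tends to 0 there, which forces the difference itself
  to vanish there.\<close>

lemma Y_part_eq_harm_limit:
  assumes G: "KZ_eq e0 e1 G"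
    and lim: "series_tendsto (\<lambda>t. G t * rpow t (- e0)) 1 (at_right 0)"
    and A: "\<And>w. ((\<lambda>t. scoeff (G (1 - t)) w - scoeff (rpow t e1 * A) w) \<longlongrightarrow> 0) (at_right 0)"
    and A1: "scoeff A [] = 1"
  shows "Y_part A = harm_limit"
proof -
  have "((\<lambda>t. scoeff (rpow t e1 * (harm_limit - A)) w) \<longlongrightarrow> 0) (at_right 0)" if w: "w \<in> W_words" for w
  proof -
    define r where "r = (\<lambda>n. harm_sum w n - scoeff (fps_subst (binomial_fps n) (Y_gen 1) * harm_limit) w)"
    have "((\<lambda>t. of_real t * (\<Sum>n. r n * of_real (1 - t) ^ n)) \<longlongrightarrow> 0) (at_right 0)"
      unfolding r_def by (intro null_seq_Abel_tendsto harm_series_asymptotics)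
    from tendsto_diff[OF A[of w] this]
    have "((\<lambda>t. scoeff (G (1 - t)) w - scoeff (rpow t e1 * A) w -
        of_real t * (\<Sum>n. r n * of_real (1 - t) ^ n)) \<longlongrightarrow> 0) (at_right 0)" by simp
    moreover have "eventually (\<lambda>t. scoeff (G (1 - t)) w - scoeff (rpow t e1 * A) w -
        of_real t * (\<Sum>n. r n * of_real (1 - t) ^ n) = scoeff (rpow t e1 * (harm_limit - A)) w) (at_right 0)"
      using eventually_at_right_0_1
    proof eventually_elim
      case (elim t)
      let ?x = "of_real (1 - t) :: complex"
      have x: "norm ?x < 1" "1 - t \<in> {0<..<1}" unfolding norm_of_real using elim by auto
      have "summable (\<lambda>n. harm_sum w n * ?x ^ n)"
        by (rule summable_linear_geometric[where c = 1]) (use x norm_harm_sum_le in auto)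
      moreover note harm_series_generating_function[OF elim, of harm_limit w]
      ultimately have "(\<lambda>n. harm_sum w n * ?x ^ n - scoeff (fps_subst (binomial_fps n) (Y_gen 1) * harm_limit) w * ?x ^ n)
          sums ((\<Sum>n. harm_sum w n * ?x ^ n) - scoeff (rpow t e1 * harm_limit) w / of_real t)"
        by (intro sums_diff summable_sums)
      then have "(\<Sum>n. r n * ?x ^ n) = (\<Sum>n. harm_sum w n * ?x ^ n) - scoeff (rpow t e1 * harm_limit) w / of_real t"
        unfolding r_def left_diff_distrib by (rule sums_unique[symmetric])
      then have "of_real t * (\<Sum>n. r n * ?x ^ n) = polylog w ?x - scoeff (rpow t e1 * harm_limit) w"
        unfolding polylog_eq_harm_sum[OF x(1)] using elim by (simp add: right_diff_distrib)
      moreover have "scoeff (G (1 - t)) w = polylog w ?x"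
        by (rule KZ_solution_polylog[OF G lim w x(2)])
      ultimately show ?case by (simp add: right_diff_distrib)
    qed
    ultimately show ?thesis by (rule Lim_transform_eventually)
  qed
  then have eq: "scoeff harm_limit w = scoeff A w" if "w \<in> W_words" for w
    using rpow_mult_tendsto_0_imp_0[of e1 "harm_limit - A" w] that by simp
  show ?thesis
    by (rule series_eqI) (use harm_limit_W_alg eq in \<open>simp add: scoeff_Y_part[OF A1] W_alg_def\<close>)
qed

section \<open>The expansion of the Gamma function\<close>

definition Gamma_fps :: "complex fps" where
  "Gamma_fps = fps_expansion Gamma 1"

definition Digamma_fps :: "complex fps" where
  "Digamma_fps = fps_expansion Digamma 1"

lemma Gamma_fps_nth_0 [simp]: "fps_nth Gamma_fps 0 = 1"
  by (simp add: Gamma_fps_def fps_expansion_def)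

lemma ball_1_1_no_nonpos_Ints: "ball (1 :: complex) 1 \<inter> \<int>\<^sub>\<le>\<^sub>0 = {}"
proof -
  have False if "x \<in> ball (1 :: complex) 1" "x \<in> \<int>\<^sub>\<le>\<^sub>0" for x
  proof -
    from that(2) obtain n :: int where n: "x = of_int n" "n \<le> 0" by (auto elim!: nonpos_Ints_cases)
    then have "dist 1 x = \<bar>1 - real_of_int n\<bar>"
      unfolding dist_norm by (metis norm_of_real of_real_1 of_real_diff of_real_of_int_eq)
    with that(1) n(2) show False by simp
  qed
  then show ?thesis by blast
qed

lemma fps_deriv_Gamma_fps: "fps_deriv Gamma_fps = Gamma_fps * Digamma_fps"
proof -
  have an: "Gamma analytic_on {1}" "Digamma analytic_on {1::complex}"
    using ball_1_1_no_nonpos_Ints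
    by (auto simp: analytic_at intro!: exI[of _ "ball 1 1"] holomorphic_Gamma holomorphic_on_Polygamma)
  have 1: "deriv (\<lambda>w. Gamma (1 + w)) has_fps_expansion fps_deriv Gamma_fps"
    unfolding Gamma_fps_def by (intro has_fps_expansion_deriv analytic_at_imp_has_fps_expansion an)
  have 2: "eventually (\<lambda>w. deriv (\<lambda>w. Gamma (1 + w)) w = Gamma (1 + w) * Digamma (1 + w)) (nhds (0 :: complex))"
  proof -
    have "eventually (\<lambda>w. w \<in> ball (0 :: complex) 1) (nhds 0)"
      by (intro eventually_nhds_in_open) auto
    then show ?thesis
    proof eventually_elim
      case (elim w)
      then have "1 + w \<in> ball 1 1" by (simp add: dist_norm)
      then have "1 + w \<notin> \<int>\<^sub>\<le>\<^sub>0" using ball_1_1_no_nonpos_Ints by blast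
      then have "((\<lambda>w. Gamma (1 + w)) has_field_derivative Gamma (1 + w) * Digamma (1 + w)) (at w)"
        by (auto intro!: derivative_eq_intros)
      then show ?case by (rule DERIV_imp_deriv)
    qed
  qed
  have "(\<lambda>w. Gamma (1 + w) * Digamma (1 + w)) has_fps_expansion fps_deriv Gamma_fps"
    by (rule iffD1[OF has_fps_expansion_cong[OF 2 refl] 1])
  moreover have "(\<lambda>w. Gamma (1 + w) * Digamma (1 + w)) has_fps_expansion Gamma_fps * Digamma_fps"
    unfolding Gamma_fps_def Digamma_fps_def
    by (intro has_fps_expansion_mult analytic_at_imp_has_fps_expansion an)
  ultimately show ?thesis by (rule fps_expansion_unique_complex)
qed

lemma one_not_nonpos_Int: "(1 :: complex) \<notin> \<int>\<^sub>\<le>\<^sub>0"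
  using ball_1_1_no_nonpos_Ints by auto

lemma Digamma_fps_nth: "fps_nth Digamma_fps n = Polygamma n 1 / fact n"
  using higher_deriv_Polygamma[OF one_not_nonpos_Int, of n 0] by (simp add: Digamma_fps_def fps_expansion_def)

lemma zeta_sums:
  assumes "n > 0"
  shows "(\<lambda>k. 1 / of_nat (Suc k) ^ Suc n) sums ((- 1) ^ Suc n * fps_nth Digamma_fps n)"
  using Polygamma_LIMSEQ[of "1 :: complex" n] assms by (simp add: Digamma_fps_nth inverse_eq_divide)

lemma Digamma_fps_nth_0: "fps_nth Digamma_fps 0 = - euler_mascheroni"
  by (simp add: Digamma_fps_nth)

lemma zeta_Suc: "n > 0 \<Longrightarrow> zeta (Suc n) = (- 1) ^ Suc n * fps_nth Digamma_fps n"
  unfolding zeta_def by (rule sums_unique[symmetric], rule zeta_sums)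

section \<open>Power series determined by their logarithmic derivative\<close>

lemma fps_nth_Suc_of_deriv:
  assumes "fps_deriv f = f * (m :: complex fps)"
  shows "fps_nth f (Suc j) = (\<Sum>i\<le>j. fps_nth f i * fps_nth m (j - i)) / of_nat (Suc j)"
proof -
  have "of_nat (Suc j) * fps_nth f (Suc j) = fps_nth (f * m) j"
    unfolding assms[symmetric] by (simp only: fps_deriv_nth Suc_eq_plus1)
  also have "\<dots> = (\<Sum>i\<le>j. fps_nth f i * fps_nth m (j - i))"
    by (simp only: fps_mult_nth atLeast0AtMost)
  finally show ?thesis
    unfolding nonzero_eq_divide_eq[OF of_nat_neq_0] by (simp only: mult.commute)
qed

text \<open>Each coefficient is a fixed polynomial in earlier ones and in the coefficients of the
  logarithmic derivative. Convergence of infinite products is thus reduced to convergence of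
  sums.\<close>

lemma fps_linear_ode_tendsto:
  fixes f m :: "nat \<Rightarrow> complex fps"
  assumes f: "\<And>n. fps_deriv (f n) = f n * m n" "\<And>n. fps_nth (f n) 0 = 1"
    and F: "fps_deriv F = F * M" "fps_nth F 0 = 1"
    and lim: "\<And>k. (\<lambda>n. fps_nth (m n) k) \<longlonglongrightarrow> fps_nth M k"
  shows "(\<lambda>n. fps_nth (f n) k) \<longlonglongrightarrow> fps_nth F k"
proof (induction k rule: less_induct)
  case (less k)
  show ?case
  proof (cases k)
    case (Suc j)
    show ?thesis
      unfolding Suc fps_nth_Suc_of_deriv[OF f(1)] fps_nth_Suc_of_deriv[OF F(1)]
      by (intro tendsto_intros lim less) (auto simp: Suc simp del: of_nat_Suc)
  qed (simp add: f F)
qed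

lemma fps_linear_ode_unique:
  fixes F G :: "complex fps"
  assumes "fps_deriv F = F * M" "fps_nth F 0 = 1" "fps_deriv G = G * M" "fps_nth G 0 = 1"
  shows "F = G"
proof (rule fps_ext)
  fix k
  have "(\<lambda>_::nat. fps_nth F k) \<longlonglongrightarrow> fps_nth G k"
    by (rule fps_linear_ode_tendsto[where m = "\<lambda>_. M"]) (use assms in auto)
  then show "fps_nth F k = fps_nth G k" by (simp add: LIMSEQ_const_iff)
qed

lemma fps_deriv_inverse_Gamma: "fps_deriv (inverse Gamma_fps) = inverse Gamma_fps * - Digamma_fps"
proof -
  have "Gamma_fps * inverse Gamma_fps = 1" by (rule inverse_mult_eq_1') simp
  then show ?thesis
    by (simp add: fps_inverse_deriv fps_deriv_Gamma_fps power2_eq_square mult_ac)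
qed

text \<open>The expansion in s of the sum of 1/(j + s) over j from 1 to n.\<close>

definition binomial_log_deriv :: "nat \<Rightarrow> complex fps" where
  "binomial_log_deriv n = Abs_fps (\<lambda>k. (- 1) ^ k * (\<Sum>j<n. 1 / of_nat (Suc j) ^ Suc k))"

lemma fps_deriv_binomial_fps: "fps_deriv (binomial_fps n) = binomial_fps n * binomial_log_deriv n"
proof (induction n)
  case 0
  show ?case by (simp add: binomial_log_deriv_def fps_eq_iff)
next
  case (Suc n)
  define c :: complex where "c = 1 / of_nat (Suc n)"
  \<comment> \<open>The geometric series of c / (1 + c s), the logarithmic derivative of the new
    factor.\<close>
  define r where "r = Abs_fps (\<lambda>k. (- 1) ^ k * c ^ Suc k)"
  let ?f = "1 + fps_const c * fps_X"
  have r: "?f * r = fps_const c"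
  proof (rule fps_ext)
    fix k show "fps_nth ((1 + fps_const c * fps_X) * r) k = fps_nth (fps_const c) k"
      by (cases k) (simp_all add: r_def distrib_right mult.assoc)
  qed
  have m: "binomial_log_deriv (Suc n) = binomial_log_deriv n + r"
    by (rule fps_ext)
       (simp add: binomial_log_deriv_def r_def c_def distrib_left power_divide del: of_nat_Suc power_Suc)
  have "fps_deriv ?f = fps_const c" by simp
  then have "fps_deriv (binomial_fps (Suc n)) =
      binomial_fps n * (?f * r) + binomial_fps n * binomial_log_deriv n * ?f"
    by (simp only: binomial_fps_Suc c_def[symmetric] fps_deriv_mult Suc.IH r)
  also have "P * (F * r) + P * l * F = P * F * (l + r)" for P F l :: "complex fps"
    by (simp add: algebra_simps)
  finally show ?case
    by (simp only: m binomial_fps_Suc c_def[symmetric])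
qed

definition binomial_reg :: "nat \<Rightarrow> complex fps" where
  "binomial_reg n = fps_exp (- of_real (ln (real n))) * binomial_fps n"

text \<open>This is the limit n^(-s) (1 + s/1) ... (1 + s/n) -> 1 / Gamma(1 + s), read
  coefficientwise. For the logarithmic derivatives, the constant terms \<open>harm n - ln n\<close>
  tend to the Euler-Mascheroni constant, and the higher coefficients are, up to sign, partial sums
  of zeta values.\<close>

lemma binomial_reg_tendsto: "(\<lambda>n. fps_nth (binomial_reg n) k) \<longlonglongrightarrow> fps_nth (inverse Gamma_fps) k"
proof (rule fps_linear_ode_tendsto)
  show "fps_deriv (binomial_reg n) =
      binomial_reg n * (binomial_log_deriv n - fps_const (of_real (ln (real n))))" for n
    by (simp add: binomial_reg_def fps_deriv_binomial_fps algebra_simps flip: fps_const_neg)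
  show "fps_nth (binomial_reg n) 0 = 1" for n by (simp add: binomial_reg_def)
  show "fps_deriv (inverse Gamma_fps) = inverse Gamma_fps * - Digamma_fps"
    by (rule fps_deriv_inverse_Gamma)
  show "fps_nth (inverse Gamma_fps) 0 = 1" by simp
  show "(\<lambda>n. fps_nth (binomial_log_deriv n - fps_const (of_real (ln (real n)))) k) \<longlonglongrightarrow>
      fps_nth (- Digamma_fps) k" for k
  proof (cases "k = 0")
    case True
    have "(\<Sum>j<n. 1 / of_nat (Suc j) ^ Suc 0) = (of_real (harm n) :: complex)" for n
      by (simp add: harm_altdef inverse_eq_divide)
    with True show ?thesis
      using euler_mascheroni_LIMSEQ_of_real[where 'a = complex]
      by (simp add: binomial_log_deriv_def Digamma_fps_nth_0)
  next
    case False
    have "(\<lambda>n. (- 1) ^ k * (\<Sum>j<n. 1 / of_nat (Suc j) ^ Suc k)) \<longlonglongrightarrow>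
        (- 1) ^ k * ((- 1) ^ Suc k * fps_nth Digamma_fps k)"
      using zeta_sums[of k] False unfolding sums_def by (intro tendsto_intros) simp
    moreover have "(- 1) ^ k * ((- 1) ^ Suc k * fps_nth Digamma_fps k) = - fps_nth Digamma_fps k"
      by (simp flip: mult.assoc power_add power_mult_distrib)
    ultimately show ?thesis using False by (simp add: binomial_log_deriv_def)
  qed
qed

section \<open>The regularized double shuffle relations\<close>

text \<open>Only lists of positive integers of bounded sum contribute; injectivity of
  \<open>Y_word\<close> translates them back into words, so that the coefficient becomes a fixed
  finite linear form in \<open>f\<close> and limits pass through.\<close>

lemma scoeff_harm_coproduct_finite:
  "\<exists>S c. finite S \<and> (\<forall>f. scoeff (harm_coproduct f) m = (\<Sum>w\<in>S. scoeff f w * c w))"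
proof -
  let ?S = "{ns \<in> lists {1..}. sum_list (map id ns) \<le> wdeg m}"
  have fin: "finite ?S"
    by (rule finite_wt_lists[of "\<lambda>n. \<Sum>i\<le>n. tensor (Y_gen i) (Y_gen (n - i))"])
       (use harm_homog finite_pos_le in auto)
  let ?c = "\<lambda>ns. (- 1) ^ length ns * scoeff (prod_list (map (\<lambda>n. \<Sum>i\<le>n. tensor (Y_gen i) (Y_gen (n - i))) ns)) m"
  have "scoeff (harm_coproduct f) m = (\<Sum>w\<in>Y_word ` ?S. scoeff f w * ?c (the_inv_into ?S Y_word w))" for f
  proof -
    have pos: "0 \<notin> set ns" if "ns \<in> ?S" for ns using that by auto
    have inj: "inj_on Y_word ?S"
      by (rule inj_onI, rule Y_word_inj[OF pos pos])
    have "scoeff (harm_coproduct f) m = (\<Sum>ns\<in>?S. scoeff (Y_expansion f) ns *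
        scoeff (prod_list (map (\<lambda>n. \<Sum>i\<le>n. tensor (Y_gen i) (Y_gen (n - i))) ns)) m)"
      unfolding harm_coproduct_def
      by (rule scoeff_alg_ext[where X = "{1..}" and wt = id])
         (use Y_expansion_support finite_pos_le harm_homog fin in \<open>auto simp del: scoeff_sum\<close>)
    also have "\<dots> = (\<Sum>ns\<in>?S. scoeff f (Y_word ns) * ?c (the_inv_into ?S Y_word (Y_word ns)))"
      by (intro sum.cong refl) (simp only: scoeff_Y_expansion pos the_inv_into_f_f[OF inj] if_False mult_ac)
    also have "\<dots> = (\<Sum>w\<in>Y_word ` ?S. scoeff f w * ?c (the_inv_into ?S Y_word w))"
      by (simp only: sum.reindex[OF inj] o_def)
    finally show ?thesis .
  qed
  then show ?thesis using fin by (intro exI[of _ "Y_word ` ?S"] exI[of _ "\<lambda>w. ?c (the_inv_into ?S Y_word w)"]) blast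
qed

lemma series_tendsto_harm_coproduct:
  assumes "series_tendsto F L A"
  shows "series_tendsto (\<lambda>t. harm_coproduct (F t)) (harm_coproduct L) A"
  unfolding series_tendsto_def
proof
  fix m
  obtain S c where "finite S" "\<And>f. scoeff (harm_coproduct f) m = (\<Sum>w\<in>S. scoeff f w * c w)"
    using scoeff_harm_coproduct_finite by metis
  then show "((\<lambda>t. scoeff (harm_coproduct (F t)) m) \<longlongrightarrow> scoeff (harm_coproduct L) m) A"
    using assms by (auto simp: series_tendsto_def intro!: tendsto_intros)
qed

lemma series_tendsto_unique:
  assumes "series_tendsto F L A" "series_tendsto F M A" "A \<noteq> bot"
  shows "L = M"
  using assms by (auto simp: series_tendsto_def intro!: series_eqI intro: tendsto_unique)

lemma harm_coproduct_Y1: "harm_coproduct (Y_gen 1) = tensor (Y_gen 1) 1 + tensor 1 (Y_gen 1)"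
proof -
  have "{..1::nat} = {0, 1}" by auto
  moreover have "Y_gen 0 = 1" by (simp add: Y_gen_def)
  ultimately show ?thesis unfolding harm_coproduct_Y_gen by (simp add: add.commute)
qed

lemma harm_coproduct_fps_subst_Y1:
  "harm_coproduct (fps_subst F (Y_gen 1)) = fps_subst F (tensor (Y_gen 1) 1 + tensor 1 (Y_gen 1))"
  using harm_coproduct_fps_subst[OF Y_gen_1_wone(1) Y_gen_1_W_alg] unfolding harm_coproduct_Y1 .

lemma harm_coproduct_exp_Y1:
  "harm_coproduct (fps_subst (fps_exp c) (Y_gen 1)) =
     tensor (fps_subst (fps_exp c) (Y_gen 1)) (fps_subst (fps_exp c) (Y_gen 1))"
  unfolding harm_coproduct_fps_subst_Y1 by (rule fps_subst_exp_primitive) (rule Y_gen_1_wone(1))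

lemma harm_coproduct_fps_subst_Y1_mult:
  "harm_coproduct (fps_subst F (Y_gen 1) * f) = harm_coproduct (fps_subst F (Y_gen 1)) * harm_coproduct f"
  by (intro harm_coproduct_mult W_alg_fps_subst Y_gen_1_W_alg)

text \<open>One sequence has two factorizations. As n^(-y_1) times \<open>harm_series n\<close> it
  is group-like for every n; as \<open>binomial_reg n\<close> at y_1 times \<open>harm_reg n\<close>
  it is a product of convergent factors.\<close>

lemma harm_limit_group_like:
  "harm_coproduct (fps_subst (inverse Gamma_fps) (Y_gen 1) * harm_limit) =
     tensor (fps_subst (inverse Gamma_fps) (Y_gen 1) * harm_limit)
       (fps_subst (inverse Gamma_fps) (Y_gen 1) * harm_limit)"
proof -
  let ?e = "\<lambda>n. fps_subst (fps_exp (- of_real (ln (real n)))) (Y_gen 1)"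
  let ?U = "fps_subst (inverse Gamma_fps) (Y_gen 1) * harm_limit"
  have U: "?e n * harm_series n = fps_subst (binomial_reg n) (Y_gen 1) * harm_reg n" for n
    unfolding harm_series_eq_reg[of n] binomial_reg_def fps_subst_mult[OF Y_gen_1_wone(1)] mult.assoc ..
  have "series_tendsto (\<lambda>n. fps_subst (binomial_reg n) (Y_gen 1)) (fps_subst (inverse Gamma_fps) (Y_gen 1)) sequentially"
    unfolding series_tendsto_def
  proof
    fix a :: "letter list"
    have "(\<lambda>n. if P then (- 1) ^ length a * fps_nth (binomial_reg n) (length a) else 0) \<longlonglongrightarrow>
        (if P then (- 1) ^ length a * fps_nth (inverse Gamma_fps) (length a) else 0)" for P
      using tendsto_mult_left[OF binomial_reg_tendsto] by simp
    then show "(\<lambda>n. scoeff (fps_subst (binomial_reg n) (Y_gen 1)) a) \<longlonglongrightarrow>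
        scoeff (fps_subst (inverse Gamma_fps) (Y_gen 1)) a"
      unfolding scoeff_fps_subst_Y1 .
  qed
  from series_tendsto_mult[OF this harm_reg_tendsto]
  have lim: "series_tendsto (\<lambda>n. ?e n * harm_series n) ?U sequentially" by (simp only: U)
  have "harm_coproduct (?e n * harm_series n) = tensor (?e n * harm_series n) (?e n * harm_series n)" for n
    unfolding harm_coproduct_fps_subst_Y1_mult harm_coproduct_exp_Y1 harm_coproduct_harm_series tensor_mult ..
  with series_tendsto_harm_coproduct[OF lim]
  have "series_tendsto (\<lambda>n. tensor (?e n * harm_series n) (?e n * harm_series n)) (harm_coproduct ?U) sequentially"
    by (simp only:)
  then show ?thesis
    using series_tendsto_tensor[OF lim lim] by (rule series_tendsto_unique) simp
qed

section \<open>Beta relation and corrected series as group-likeness conditions\<close>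

lemma Gamma_fps_subst_inverse:
  "fps_subst Gamma_fps (Y_gen 1) * fps_subst (inverse Gamma_fps) (Y_gen 1) = 1"
  "fps_subst (inverse Gamma_fps) (Y_gen 1) * fps_subst Gamma_fps (Y_gen 1) = 1"
proof -
  have "Gamma_fps * inverse Gamma_fps = 1" by (rule inverse_mult_eq_1') simp
  then show "fps_subst Gamma_fps (Y_gen 1) * fps_subst (inverse Gamma_fps) (Y_gen 1) = 1"
    "fps_subst (inverse Gamma_fps) (Y_gen 1) * fps_subst Gamma_fps (Y_gen 1) = 1"
    by (simp_all only: fps_subst_mult[OF Y_gen_1_wone(1), symmetric] mult.commute[of "inverse Gamma_fps"]
        fps_subst_1[OF Y_gen_1_wone(1)])
qed

lemma left_invertible_cancel: "q * g = 1 \<Longrightarrow> g * x = g * y \<longleftrightarrow> x = (y :: 'a::monoid_mult)"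
  by (metis mult.assoc mult_1_left)

text \<open>The sum of the two arguments of the beta factor is the harmonic coproduct of y_1, so its
  third factor is the coproduct of 1 / Gamma(1 + y_1), while the first two form the tensor square of
  Gamma(1 + y_1). Multiplicativity merges the former with the coproduct of the Y-part, and the
  invertible tensor square cancels.\<close>

lemma beta_relation_iff:
  "beta_relation f \<longleftrightarrow> harm_coproduct (fps_subst (inverse Gamma_fps) (Y_gen 1) * Y_part f) =
     tensor (fps_subst (inverse Gamma_fps) (Y_gen 1) * Y_part f) (fps_subst (inverse Gamma_fps) (Y_gen 1) * Y_part f)"
proof -
  let ?g = "fps_subst Gamma_fps (Y_gen 1)" and ?q = "fps_subst (inverse Gamma_fps) (Y_gen 1)"
  let ?f = "Y_part f"
  have inv: "tensor ?q ?q * tensor ?g ?g = 1"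
    unfolding tensor_mult Gamma_fps_subst_inverse by (rule tensor_1_1)
  have "beta_factor (tensor (Y_gen 1) 1) (tensor 1 (Y_gen 1)) = tensor ?g ?g * harm_coproduct ?q"
    unfolding beta_factor_def Gamma_fps_def[symmetric] harm_coproduct_fps_subst_Y1
      tensor_fps_subst_left[OF Y_gen_1_wone(1), symmetric] tensor_fps_subst_right[OF Y_gen_1_wone(1), symmetric]
      tensor_mult by simp
  then have "beta_factor (tensor (Y_gen 1) 1) (tensor 1 (Y_gen 1)) * harm_coproduct ?f =
      tensor ?g ?g * harm_coproduct (?q * ?f)"
    by (simp only: harm_coproduct_fps_subst_Y1_mult mult.assoc)
  moreover have "tensor ?f ?f = tensor ?g ?g * tensor (?q * ?f) (?q * ?f)"
    unfolding tensor_mult mult.assoc[symmetric] Gamma_fps_subst_inverse by simp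
  ultimately have "beta_relation f \<longleftrightarrow> tensor ?g ?g * harm_coproduct (?q * ?f) = tensor ?g ?g * tensor (?q * ?f) (?q * ?f)"
    by (simp only: beta_relation_def)
  also have "\<dots> \<longleftrightarrow> harm_coproduct (?q * ?f) = tensor (?q * ?f) (?q * ?f)"
    by (rule left_invertible_cancel[OF inv])
  finally show ?thesis .
qed

text \<open>
  Both sides satisfy the same linear differential equation, because the coefficients of the
  logarithmic derivative of \<open>\<Gamma>\<close> at 1 are \<open>-\<gamma>\<close> and \<open>(-1)^(n+1) \<zeta>(n+1)\<close>.
\<close>

lemma exp_zeta_series:
  "fps_exp 1 oo Abs_fps (\<lambda>n. if n \<ge> 2 then (- 1) ^ (n - 1) * zeta n / of_nat n else 0) =
     fps_exp (- euler_mascheroni) * inverse Gamma_fps"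
proof -
  define L where "L = Abs_fps (\<lambda>n. if n \<ge> 2 then (- 1) ^ (n - 1) * zeta n / of_nat n else 0)"
  have L': "fps_deriv L = - Digamma_fps - fps_const euler_mascheroni"
  proof (rule fps_ext)
    fix n
    show "fps_nth (fps_deriv L) n = fps_nth (- Digamma_fps - fps_const euler_mascheroni) n"
    proof (cases "n = 0")
      case False
      then have "fps_nth (fps_deriv L) n = (- 1) ^ n * zeta (Suc n)"
        by (simp add: L_def del: of_nat_Suc)
      also have "\<dots> = - fps_nth Digamma_fps n"
        using False by (simp add: zeta_Suc flip: mult.assoc power_mult_distrib)
      finally show ?thesis using False by simp
    qed (simp add: L_def Digamma_fps_nth_0)
  qed
  have L0: "fps_nth L 0 = 0" by (simp add: L_def)
  have "fps_exp 1 oo L = fps_exp (- euler_mascheroni) * inverse Gamma_fps"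
  proof (rule fps_linear_ode_unique)
    show "fps_deriv (fps_exp 1 oo L) = (fps_exp 1 oo L) * (- Digamma_fps - fps_const euler_mascheroni)"
      by (simp add: fps_compose_deriv L0 L')
    show "fps_deriv (fps_exp (- euler_mascheroni) * inverse Gamma_fps) =
        fps_exp (- euler_mascheroni) * inverse Gamma_fps * (- Digamma_fps - fps_const euler_mascheroni)"
      by (simp add: fps_deriv_inverse_Gamma algebra_simps flip: fps_const_neg)
  qed simp_all
  then show ?thesis by (simp only: L_def)
qed

lemma corrected_Y_part_eq:
  "corrected_Y_part f = fps_subst (fps_exp (- euler_mascheroni)) (Y_gen 1) *
     (fps_subst (inverse Gamma_fps) (Y_gen 1) * Y_part f)"
proof -
  let ?L = "Abs_fps (\<lambda>n. if n \<ge> 2 then (- 1) ^ (n - 1) * zeta n / of_nat n else 0)"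
  have "series_exp (fps_subst ?L (Y_gen 1)) = fps_subst (fps_exp 1 oo ?L) (Y_gen 1)"
    unfolding series_exp_def by (rule fps_subst_compose) (simp_all del: One_nat_def)
  then show ?thesis
    by (simp only: corrected_Y_part_def exp_zeta_series fps_subst_mult[OF Y_gen_1_wone(1)] mult.assoc)
qed

lemma Y_part_W_alg: "scoeff f [] = 1 \<Longrightarrow> Y_part f \<in> W_alg"
  by (simp add: W_alg_def scoeff_Y_part)

text \<open>The correction in \<open>corrected_Y_part\<close> differs from 1 / Gamma(1 + y_1) by the
  exponential of minus the Euler-Mascheroni constant times y_1. As the exponential of a primitive
  element this is group-like and invertible, so it cancels from the condition.\<close>

lemma beta_relation_iff_harm_group_like:
  assumes f: "scoeff f [] = 1"
  shows "beta_relation f \<longleftrightarrow> harm_group_like (corrected_Y_part f)"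
proof -
  let ?c = "fps_subst (fps_exp (- euler_mascheroni)) (Y_gen 1)"
  let ?c' = "fps_subst (fps_exp euler_mascheroni) (Y_gen 1)"
  let ?U = "fps_subst (inverse Gamma_fps) (Y_gen 1) * Y_part f"
  have "scoeff (Y_part f) wone = 1"
    using scoeff_Y_part[OF f, of "[]"] f by (simp add: wone_list_def W_words_def)
  then have "scoeff (?c * ?U) wone = 1" by (simp del: One_nat_def)
  then have "scoeff (?c * ?U) [] = 1" by (simp only: wone_list_def)
  moreover have "?c * ?U \<in> W_alg"
    by (intro W_alg_mult W_alg_fps_subst Y_gen_1_W_alg Y_part_W_alg f)
  moreover have "harm_coproduct (?c * ?U) = tensor ?c ?c * harm_coproduct ?U"
    unfolding harm_coproduct_fps_subst_Y1_mult[of "fps_exp _"] harm_coproduct_exp_Y1 ..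
  moreover have "tensor (?c * ?U) (?c * ?U) = tensor ?c ?c * tensor ?U ?U"
    by (rule tensor_mult[symmetric])
  moreover have "tensor ?c' ?c' * tensor ?c ?c = 1"
    unfolding tensor_mult fps_subst_exp_uminus(2)[OF Y_gen_1_wone(1)] by (rule tensor_1_1)
  note left_invertible_cancel[OF this, of "harm_coproduct ?U" "tensor ?U ?U"]
  ultimately show ?thesis
    unfolding harm_group_like_def corrected_Y_part_eq beta_relation_iff by (simp only: simp_thms)
qed

theorem theorem2:
  fixes G0 G1 :: "real \<Rightarrow> nc_series" and A :: nc_series and z :: real
  assumes "KZ_solution G0" and "KZ_normalized_0 G0"
    and "KZ_solution G1" and "KZ_normalized_1 G1"
    and "z \<in> {0<..<1}" and "A = series_inverse (G1 z) * G0 z"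
  shows "beta_factor (tensor (Y_gen 1) 1) (tensor 1 (Y_gen 1)) * harm_coproduct (Y_part A) =
           tensor (Y_part A) (Y_part A) \<and>
         group_like A \<and>
         (\<forall>f. scoeff f [] = 1 \<longrightarrow>
            (group_like f \<and> beta_relation f \<longleftrightarrow> regularized_double_shuffle f))"
proof -
  have e_neg: "scoeff (- e0) wone = 0" "scoeff (- e1) wone = 0" by simp_all
  have K0: "KZ_eq e0 e1 G0" and K1: "KZ_eq e0 e1 G1"
    using assms(1,3) by (simp_all only: KZ_solution_iff)
  note K1' = KZ_eq_reflect[OF K1]
  have N0: "series_tendsto (\<lambda>t. G0 t * rpow t (- e0)) 1 (at_right 0)"
    using assms(2) by (simp only: KZ_normalized_0_def real_pow_eq[OF e_neg(1)])
  have refl: "filterlim (\<lambda>t::real. 1 - t) (at_left 1) (at_right 0)" by real_asymp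
  \<comment> \<open>Rewriting the normalization at 1 in the variable 1 - t makes it a normalization
    at 0 for the reflected equation.\<close>
  have N1: "series_tendsto (\<lambda>t. G1 (1 - t) * rpow t (- e1)) 1 (at_right 0)"
    unfolding series_tendsto_def
  proof
    fix w
    have "((\<lambda>t. scoeff (G1 t * real_pow (1 - t) (- e1)) w) \<longlongrightarrow> scoeff 1 w) (at_left 1)"
      using assms(4) by (simp only: KZ_normalized_1_def series_tendsto_def)
    from filterlim_compose[OF this refl]
    show "((\<lambda>t. scoeff (G1 (1 - t) * rpow t (- e1)) w) \<longlongrightarrow> scoeff 1 w) (at_right 0)"
      by (simp add: real_pow_eq[OF e_neg(2)])
  qed
  have z': "1 - z \<in> {0<..<1}" using assms(5) by auto
  have G1_1: "scoeff (G1 z) wone = 1"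
    using KZ_normalized_wone[OF K1' e_wone(2,1) N1 z'] by simp
  have G0_1: "scoeff (G0 z) wone = 1"
    by (rule KZ_normalized_wone[OF K0 e_wone N0 assms(5)])
  note inv = series_inverse[OF G1_1]
  have "scoeff (series_inverse (G1 z)) wone = 1"
    using arg_cong[OF inv(1), of "\<lambda>f. scoeff f wone"] by (simp add: G1_1)
  then have "scoeff A wone = 1" by (simp add: assms(6) G0_1)
  then have A1: "scoeff A [] = 1" by (simp only: wone_list_def)

  have conn: "G0 t = G1 t * A" if "t \<in> {0<..<1}" for t
    unfolding assms(6) by (rule KZ_eq_connection[OF K0 K1 e_wone G1_1 assms(5) that])
  have "Y_part A = harm_limit"
    by (rule Y_part_eq_harm_limit[OF K0 N0 KZ_asymptotics_1[OF K1 e_wone N1 conn] A1])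
  then have beta: "beta_relation A"
    unfolding beta_relation_iff by (simp only: harm_limit_group_like)

  have \<Delta>0: "prim_coproduct (G0 z) = tensor (G0 z) (G0 z)"
    by (rule KZ_normalized_group_like[OF K0 e_wone prim_coproduct_e N0 assms(5)])
  have \<Delta>1: "prim_coproduct (G1 z) = tensor (G1 z) (G1 z)"
    using KZ_normalized_group_like[OF K1' e_wone(2,1) prim_coproduct_e(2,1) N1 z'] by simp
  \<comment> \<open>Both solutions are group-like and \<open>G0 z = G1 z * A\<close>, so the claim
    for \<open>A\<close> remains after cancelling the invertible tensor square of
    \<open>G1 z\<close>.\<close>
  have "tensor (G1 z) (G1 z) * prim_coproduct A = prim_coproduct (G1 z * A)"
    by (simp only: prim_coproduct_mult \<Delta>1)
  also have "\<dots> = tensor (G1 z * A) (G1 z * A)"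
    by (simp only: conn[OF assms(5), symmetric] \<Delta>0)
  also have "\<dots> = tensor (G1 z) (G1 z) * tensor A A" by (rule tensor_mult[symmetric])
  finally have "tensor (G1 z) (G1 z) * prim_coproduct A = tensor (G1 z) (G1 z) * tensor A A" .
  moreover have "tensor (series_inverse (G1 z)) (series_inverse (G1 z)) * tensor (G1 z) (G1 z) = 1"
    unfolding tensor_mult inv by (rule tensor_1_1)
  ultimately have "prim_coproduct A = tensor A A" by (simp only: left_invertible_cancel)
  with A1 have "group_like A" by (simp add: group_like_def)
  with beta show ?thesis
    using beta_relation_iff_harm_group_like by (auto simp: beta_relation_def regularized_double_shuffle_def)
qed

end
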